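(* (i) Let $X$ be a separable infinite-dimensional Banach space such that $(SP_w(X),\le)$ is a countable chain (totally ordered). Then there is a countable ordinal $\alpha$ such that $SP_w(X)$ is order-isomorphic to $\alpha$ with the reverse order. (ii) Conversely, for every countable ordinal $\alpha\ge1$ there exists a reflexive Banach space $X$ such that $(SP_w(X),\le)$ is order-isomorphic to $\alpha$ with the reverse order.
   Context: A normalized basic sequence $(x_i)$ in a Banach space $X$ generates a spreading model $(\tilde x_i)$ if there exist $\varepsilon_n\downarrow0$ such that for all $n$, $(a_i)_{i=1}^n\subseteq[-1,1]$, $n\le k_1<\cdots<k_n$: $(1+\varepsilon_n)^{-1}\|\sum a_i\tilde x_i\|\le\|\sum a_ix_{k_i}\|\le(1+\varepsilon_n)\|\sum a_i\tilde x_i\|$. $(v_i)$ dominates $(u_i)$ if $\|\sum a_iu_i\|\le C\|\sum a_iv_i\|$ for some $C<\infty$ and all finitely supported $(a_i)$; equivalent means mutual domination. $SP_w(X)$ is the set of equivalence classes of spreading models generated by normalized weakly null sequences in $X$, ordered by $[(\tilde x_i)]\le[(\tilde y_i)]$ iff $(\tilde y_i)$ dominates $(\tilde x_i)$. *)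

theory Defs
  imports "HOL-Analysis.Analysis"
begin

text \<open>A (real) Banach space is represented by a linear subspace V of a real vector
  space together with a function N that is a complete norm on V.\<close>

definition normed_on :: "'v::real_vector set \<Rightarrow> ('v \<Rightarrow> real) \<Rightarrow> bool" where
  "normed_on V N \<longleftrightarrow> subspace V \<and>
     (\<forall>x\<in>V. 0 \<le> N x \<and> (N x = 0 \<longleftrightarrow> x = 0)) \<and>
     (\<forall>x\<in>V. \<forall>y\<in>V. N (x + y) \<le> N x + N y) \<and>
     (\<forall>x\<in>V. \<forall>c. N (c *\<^sub>R x) = \<bar>c\<bar> * N x)"

definition ncauchy :: "('v::real_vector \<Rightarrow> real) \<Rightarrow> (nat \<Rightarrow> 'v) \<Rightarrow> bool" where
  "ncauchy N x \<longleftrightarrow> (\<forall>e>0. \<exists>M. \<forall>m\<ge>M. \<forall>n\<ge>M. N (x m - x n) < e)"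

definition nlim :: "('v::real_vector \<Rightarrow> real) \<Rightarrow> (nat \<Rightarrow> 'v) \<Rightarrow> 'v \<Rightarrow> bool" where
  "nlim N x y \<longleftrightarrow> (\<forall>e>0. \<exists>M. \<forall>n\<ge>M. N (x n - y) < e)"

definition banach_on :: "'v::real_vector set \<Rightarrow> ('v \<Rightarrow> real) \<Rightarrow> bool" where
  "banach_on V N \<longleftrightarrow> normed_on V N \<and>
     (\<forall>x. range x \<subseteq> V \<and> ncauchy N x \<longrightarrow> (\<exists>y\<in>V. nlim N x y))"

definition separable_on :: "'v::real_vector set \<Rightarrow> ('v \<Rightarrow> real) \<Rightarrow> bool" where
  "separable_on V N \<longleftrightarrow> (\<exists>D. D \<subseteq> V \<and> countable D \<and>
     (\<forall>y\<in>V. \<forall>e>0. \<exists>d\<in>D. N (y - d) < e))"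

definition infinite_dim_on :: "'v::real_vector set \<Rightarrow> bool" where
  "infinite_dim_on V \<longleftrightarrow> \<not> (\<exists>B. finite B \<and> B \<subseteq> V \<and> V \<subseteq> span B)"

definition dual :: "'v::real_vector set \<Rightarrow> ('v \<Rightarrow> real) \<Rightarrow> ('v \<Rightarrow> real) set" where
  "dual V N = {f. (\<forall>x\<in>V. \<forall>y\<in>V. f (x + y) = f x + f y) \<and>
                  (\<forall>x\<in>V. \<forall>c. f (c *\<^sub>R x) = c * f x) \<and>
                  (\<exists>C. \<forall>x\<in>V. \<bar>f x\<bar> \<le> C * N x) \<and>
                  (\<forall>x. x \<notin> V \<longrightarrow> f x = 0)}"

definition dualnorm :: "'v::real_vector set \<Rightarrow> ('v \<Rightarrow> real) \<Rightarrow> ('v \<Rightarrow> real) \<Rightarrow> real" where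
  "dualnorm V N f = (SUP x\<in>{x\<in>V. N x \<le> 1}. \<bar>f x\<bar>)"

definition reflexive_on :: "'v::real_vector set \<Rightarrow> ('v \<Rightarrow> real) \<Rightarrow> bool" where
  "reflexive_on V N \<longleftrightarrow>
     (\<forall>\<Phi>::('v \<Rightarrow> real) \<Rightarrow> real.
        (\<forall>f\<in>dual V N. \<forall>g\<in>dual V N. \<Phi> (\<lambda>x. f x + g x) = \<Phi> f + \<Phi> g) \<and>
        (\<forall>f\<in>dual V N. \<forall>c. \<Phi> (\<lambda>x. c * f x) = c * \<Phi> f) \<and>
        (\<exists>C. \<forall>f\<in>dual V N. \<bar>\<Phi> f\<bar> \<le> C * dualnorm V N f)
      \<longrightarrow> (\<exists>x\<in>V. \<forall>f\<in>dual V N. \<Phi> f = f x))"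

definition weakly_null :: "'v::real_vector set \<Rightarrow> ('v \<Rightarrow> real) \<Rightarrow> (nat \<Rightarrow> 'v) \<Rightarrow> bool" where
  "weakly_null V N x \<longleftrightarrow> range x \<subseteq> V \<and>
     (\<forall>f\<in>dual V N. (\<lambda>n. f (x n)) \<longlonglongrightarrow> 0)"

definition normalized_seq :: "('v::real_vector \<Rightarrow> real) \<Rightarrow> (nat \<Rightarrow> 'v) \<Rightarrow> bool" where
  "normalized_seq N x \<longleftrightarrow> (\<forall>i. N (x i) = 1)"

definition closed_span_on :: "'v::real_vector set \<Rightarrow> ('v \<Rightarrow> real) \<Rightarrow> (nat \<Rightarrow> 'v) \<Rightarrow> 'v set" where
  "closed_span_on V N x = {y\<in>V. \<exists>s. range s \<subseteq> span (range x) \<and> nlim N s y}"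

definition basic_seq :: "'v::real_vector set \<Rightarrow> ('v \<Rightarrow> real) \<Rightarrow> (nat \<Rightarrow> 'v) \<Rightarrow> bool" where
  "basic_seq V N x \<longleftrightarrow> range x \<subseteq> V \<and>
     (\<forall>y\<in>closed_span_on V N x. \<exists>!a::nat \<Rightarrow> real. nlim N (\<lambda>n. \<Sum>i<n. a i *\<^sub>R x i) y)"

text \<open>A spreading model (x~_i) (a sequence in some normed space) is encoded by the
  function S a = norm (sum a_i x~_i) on finitely supported scalar sequences a;
  such an S is exactly a seminorm on the finitely supported sequences.\<close>

definition finsupp :: "(nat \<Rightarrow> real) \<Rightarrow> bool" where
  "finsupp a \<longleftrightarrow> finite {i. a i \<noteq> 0}"

definition c00_seminorm :: "((nat \<Rightarrow> real) \<Rightarrow> real) \<Rightarrow> bool" where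
  "c00_seminorm S \<longleftrightarrow>
     (\<forall>a b. finsupp a \<and> finsupp b \<longrightarrow> S (\<lambda>i. a i + b i) \<le> S a + S b) \<and>
     (\<forall>a c. finsupp a \<longrightarrow> S (\<lambda>i. c * a i) = \<bar>c\<bar> * S a)"

definition generates_sm :: "('v::real_vector \<Rightarrow> real) \<Rightarrow> (nat \<Rightarrow> 'v) \<Rightarrow> ((nat \<Rightarrow> real) \<Rightarrow> real) \<Rightarrow> bool" where
  "generates_sm N x S \<longleftrightarrow> c00_seminorm S \<and>
     (\<exists>\<epsilon>::nat \<Rightarrow> real. decseq \<epsilon> \<and> \<epsilon> \<longlonglongrightarrow> 0 \<and>
       (\<forall>n (a::nat \<Rightarrow> real) (k::nat \<Rightarrow> nat).
          (\<forall>i<n. \<bar>a i\<bar> \<le> 1) \<and> (\<forall>i j. i < j \<and> j < n \<longrightarrow> k i < k j) \<and> n \<le> k 0 \<longrightarrow>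
            inverse (1 + \<epsilon> n) * S (\<lambda>i. if i < n then a i else 0)
              \<le> N (\<Sum>i<n. a i *\<^sub>R x (k i)) \<and>
            N (\<Sum>i<n. a i *\<^sub>R x (k i))
              \<le> (1 + \<epsilon> n) * S (\<lambda>i. if i < n then a i else 0)))"

definition dominates :: "((nat \<Rightarrow> real) \<Rightarrow> real) \<Rightarrow> ((nat \<Rightarrow> real) \<Rightarrow> real) \<Rightarrow> bool" where
  "dominates T S \<longleftrightarrow> (\<exists>C::real. \<forall>a. finsupp a \<longrightarrow> S a \<le> C * T a)"

definition equiv_sm :: "((nat \<Rightarrow> real) \<Rightarrow> real) \<Rightarrow> ((nat \<Rightarrow> real) \<Rightarrow> real) \<Rightarrow> bool" where
  "equiv_sm S T \<longleftrightarrow> dominates S T \<and> dominates T S"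

definition wsm :: "'v::real_vector set \<Rightarrow> ('v \<Rightarrow> real) \<Rightarrow> ((nat \<Rightarrow> real) \<Rightarrow> real) set" where
  "wsm V N = {S. \<exists>x. normalized_seq N x \<and> basic_seq V N x \<and> weakly_null V N x \<and>
                      generates_sm N x S}"

definition SPw :: "'v::real_vector set \<Rightarrow> ('v \<Rightarrow> real) \<Rightarrow> ((nat \<Rightarrow> real) \<Rightarrow> real) set set" where
  "SPw V N = (\<lambda>S. {T\<in>wsm V N. equiv_sm S T}) ` wsm V N"

definition sp_le :: "((nat \<Rightarrow> real) \<Rightarrow> real) set \<Rightarrow> ((nat \<Rightarrow> real) \<Rightarrow> real) set \<Rightarrow> bool" where
  "sp_le c1 c2 \<longleftrightarrow> (\<exists>S\<in>c1. \<exists>T\<in>c2. dominates T S)"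

text \<open>(SP_w(V,N), <=) is order-isomorphic to the ordinal (well-order) r with the reverse order.\<close>

definition iso_reverse :: "'v::real_vector set \<Rightarrow> ('v \<Rightarrow> real) \<Rightarrow> nat rel \<Rightarrow> bool" where
  "iso_reverse V N r \<longleftrightarrow> (\<exists>h. bij_betw h (SPw V N) (Field r) \<and>
     (\<forall>c1\<in>SPw V N. \<forall>c2\<in>SPw V N. sp_le c1 c2 \<longleftrightarrow> (h c2, h c1) \<in> r))"

end

theory Submission
  imports Defs "HOL-Complex_Analysis.Great_Picard" "HOL-Library.Ramsey"
    "HOL-Library.Diagonal_Subsequence" "HOL-Library.Nat_Bijection"
begin

text \<open>
  (i) Suppose \<open>S 0 < S 1 < \<dots>\<close> are spreading models of normalized weakly null sequences \<open>xs n\<close>, and form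
  \<open>y i = (\<Sum>n. c n * xs n i)\<close> with rapidly decreasing weights. A subsequence of the normalized \<open>y\<close> is basic and
  generates a spreading model \<open>U\<close>. By a gliding hump the weights can be chosen so that no \<open>S n\<close> dominates
  \<open>U\<close>, hence \<open>U\<close> lies above every \<open>S n\<close> because the spreading models form a chain. Diagonalising at
  the same time against an enumeration of the countably many classes, \<open>U\<close> can be kept from dominating
  any upper bound of all \<open>S n\<close>, in particular its own class. So there is no strictly increasing
  sequence, and the reverse order is a well-order.

  (ii) Map the ordinal order-preservingly into \<open>[2, 3]\<close>, with least value 2, by \<open>n \<mapsto> p n\<close>. The \<open>l\<^sub>2\<close> sum of the spaces
  \<open>l\<^bsub>p n\<^esub>\<close> is reflexive. A normalized weakly null sequence is, up to a subsequence and a small perturbation, disjointly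
  supported; its spreading model is equivalent to \<open>l\<^sub>2\<close> if some mass escapes through the outer sum, and
  otherwise to the \<open>l\<^bsub>p n\<^esub>\<close> with the least exponent among the components retaining mass.
\<close>

section \<open>Sublinear functionals and the Hahn--Banach theorem\<close>

text \<open>In (i) the estimates on \<open>y\<close> compare it with a given \<open>S n\<close> only
  at single vectors, so they can refute a domination but never establish one; totality of the order
  turns the refutation around. With halving weights, all terms after stage \<open>r\<close> are
  controlled by the next weight alone, so a requirement met at one finitely supported vector stays
  met if the next weight is small enough. In (ii) a larger exponent means a smaller norm, which
  reverses the order. The exponents start at 2 because vectors spread over different components
  generate \<open>l2\<close> anyway; with 2 as least exponent this model is no new class. The same
  bound gives an upper 2-estimate, whose dual form makes tails of functionals small; the bound 3
  gives a uniform lower 3-estimate, which makes tails of vectors small. Both together give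
  reflexivity. A limit norm may mix infinitely many exponents; it is equivalent to a single
  \<open>lp\<close> norm because the least exponent involved is attained, and this is where the
  well-ordering enters.\<close>

definition sublinear :: "('v::real_vector \<Rightarrow> real) \<Rightarrow> bool" where
  "sublinear q \<longleftrightarrow> (\<forall>x y. q (x + y) \<le> q x + q y) \<and> (\<forall>c\<ge>0. \<forall>x. q (c *\<^sub>R x) = c * q x)"

lemma sublinearI:
  assumes "\<And>x y. q (x + y) \<le> q x + q y" "\<And>c x. 0 < c \<Longrightarrow> q (c *\<^sub>R x) \<le> c * q x" "q 0 = 0"
  shows "sublinear q"
proof -
  have "q (c *\<^sub>R x) = c * q x" if "0 \<le> c" for c x
  proof (cases "c = 0")
    case False
    then have c: "0 < c" using that by simp
    have "q (inverse c *\<^sub>R (c *\<^sub>R x)) \<le> inverse c * q (c *\<^sub>R x)"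
      by (rule assms(2)) (use c in simp)
    then have "c * q x \<le> q (c *\<^sub>R x)" using c by (simp add: field_simps)
    then show ?thesis using assms(2)[OF c, of x] by simp
  qed (use assms in simp)
  then show ?thesis using assms by (auto simp: sublinear_def)
qed

lemma sublinear_lower:
  assumes "sublinear q" shows "- q (- x) \<le> q x"
proof -
  have "q (0 *\<^sub>R x) = 0 * q x" using assms unfolding sublinear_def by blast
  moreover have "q (x + - x) \<le> q x + q (- x)" using assms unfolding sublinear_def by blast
  ultimately show ?thesis by simp
qed

text \<open>Moving by \<open>t\<close> along \<open>y\<close> and paying \<open>t * q y\<close>
  lowers \<open>q\<close> as far as sublinearity permits; the bound \<open>- q (- x)\<close> keeps
  the infimum finite. The result satisfies \<open>q' y = q y = - q' (- y)\<close>, so it is linear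
  along \<open>y\<close>.\<close>

lemma sublinear_shift:
  assumes q: "sublinear q"
  obtains q' where "sublinear q'" "\<And>x. q' x \<le> q x" "q' (- y) \<le> - q y"
proof
  define g where "g x t = q (x + t *\<^sub>R y) - t * q y" for x t
  define q' where "q' x = (INF t\<in>{0..}. g x t)" for x
  have add: "q (x + z) \<le> q x + q z" for x z using q by (simp add: sublinear_def)
  have hom: "0 \<le> c \<Longrightarrow> q (c *\<^sub>R x) = c * q x" for x c using q by (simp add: sublinear_def)
  have q0: "q 0 = 0" using hom[of 0 0] by simp
  have low: "- q (- x) \<le> g x t" if "t \<ge> 0" for x t
  proof -
    have "t * q y \<le> q (x + t *\<^sub>R y) + q (- x)"
      using add[of "x + t *\<^sub>R y" "- x"] hom[OF that, of y] by simp
    then show ?thesis by (simp add: g_def)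
  qed
  have bdd: "bdd_below (g x ` {0..})" for x
    using low by (intro bdd_belowI2[where m="- q (- x)"]) auto
  have le: "q' x \<le> g x t" if "t \<ge> 0" for x t
    unfolding q'_def by (rule cINF_lower[OF bdd]) (use that in auto)
  have ge: "m \<le> q' x" if "\<And>t. t \<ge> 0 \<Longrightarrow> m \<le> g x t" for x m
    unfolding q'_def by (rule cINF_greatest) (use that in auto)
  show *: "q' x \<le> q x" for x using le[of 0 x] by (simp add: g_def)
  show "q' (- y) \<le> - q y" using le[of 1 "- y"] by (simp add: g_def q0)
  show "sublinear q'"
  proof (rule sublinearI)
    fix x z
    have "q' (x + z) - g x t \<le> g z s" if "t \<ge> 0" "s \<ge> 0" for t s
    proof -
      have "q' (x + z) \<le> g (x + z) (t + s)" using le that by simp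
      also have "\<dots> \<le> g x t + g z s"
        using add[of "x + t *\<^sub>R y" "z + s *\<^sub>R y"] by (simp add: g_def algebra_simps)
      finally show ?thesis by simp
    qed
    then have "q' (x + z) - g x t \<le> q' z" if "t \<ge> 0" for t using ge that by blast
    then have "q' (x + z) - q' z \<le> g x t" if "t \<ge> 0" for t using that by (simp add: algebra_simps)
    then have "q' (x + z) - q' z \<le> q' x" using ge by blast
    then show "q' (x + z) \<le> q' x + q' z" by simp
  next
    fix c :: real and x assume c: "0 < c"
    have "inverse c * q' (c *\<^sub>R x) \<le> g x t" if "t \<ge> 0" for t
    proof -
      have "q' (c *\<^sub>R x) \<le> g (c *\<^sub>R x) (c * t)" using le that c by simp
      also have "\<dots> = c * g x t"
        using hom[of c "x + t *\<^sub>R y"] c by (simp add: g_def algebra_simps)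
      finally show ?thesis using c by (simp add: field_simps)
    qed
    then have "inverse c * q' (c *\<^sub>R x) \<le> q' x" using ge by blast
    then show "q' (c *\<^sub>R x) \<le> c * q' x" using c by (simp add: field_simps)
  next
    have "0 \<le> q' 0" using low[of _ 0] q0 by (intro ge) simp
    then show "q' 0 = 0" using *[of 0] q0 by simp
  qed
qed

text \<open>A minimal sublinear functional is unchanged by the shift construction above, which makes it
  additive.\<close>

lemma sublinear_dominates_linear:
  fixes p :: "'v::real_vector \<Rightarrow> real"
  assumes p: "sublinear p"
  obtains f where "linear f" "\<And>x. f x \<le> p x"
proof -
  define A where "A = {q. sublinear q \<and> (\<forall>x. q x \<le> p x)}"
  \<comment> \<open>The order is reversed, so the maximal element supplied by Zorn's lemma is a
    pointwise minimal functional.\<close>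
  define P :: "('v \<Rightarrow> real) \<Rightarrow> ('v \<Rightarrow> real) \<Rightarrow> bool" where "P = (\<lambda>a b. \<forall>x. b x \<le> a x)"
  have "\<exists>m\<in>A. \<forall>a\<in>A. P m a \<longrightarrow> a = m"
  proof (rule predicate_Zorn)
    show "partial_order_on A (relation_of P A)"
      by (auto simp: partial_order_on_def preorder_on_def refl_on_def trans_def antisym_def
          relation_of_def P_def intro: order_trans) (meson ext order_antisym)
  next
    fix C assume C: "C \<in> Chains (relation_of P A)"
    then have CA: "C \<subseteq> A" and ch: "\<And>a b. a \<in> C \<Longrightarrow> b \<in> C \<Longrightarrow> P a b \<or> P b a"
      by (auto simp: Chains_def relation_of_def)
    show "\<exists>u\<in>A. \<forall>a\<in>C. P a u"
    proof (cases "C = {}")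
      case True
      then show ?thesis using p by (auto simp: A_def)
    next
      case False
      define u where "u x = (INF q\<in>C. q x)" for x
      have sub: "sublinear q" and qp: "q x \<le> p x" if "q \<in> C" for q x
        using CA that by (auto simp: A_def)
      have bdd: "bdd_below ((\<lambda>q. q x) ` C)" for x
      proof (rule bdd_belowI2[where m="- p (- x)"])
        fix q assume "q \<in> C"
        then show "- p (- x) \<le> q x" using sublinear_lower[OF sub, of q x] qp[of q "- x"] by simp
      qed
      have le: "u x \<le> q x" if "q \<in> C" for x q
        unfolding u_def by (rule cINF_lower[OF bdd that])
      have ge: "m \<le> u x" if "\<And>q. q \<in> C \<Longrightarrow> m \<le> q x" for x m
        unfolding u_def by (rule cINF_greatest[OF False that])
      have zero: "q 0 = 0" if "q \<in> C" for q
        using sub[OF that] unfolding sublinear_def by (metis order_refl mult_zero_left scaleR_zero_left)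
      have "sublinear u"
      proof (rule sublinearI)
        fix x z
        have "u (x + z) - q x \<le> q' z" if q: "q \<in> C" "q' \<in> C" for q q'
        proof -
          \<comment> \<open>Comparability within the chain gives one \<open>r\<close> below both
            \<open>q\<close> and \<open>q'\<close>; this keeps the infimum subadditive.\<close>
          obtain r where r: "r \<in> C" "\<forall>x. r x \<le> q x" "\<forall>x. r x \<le> q' x"
            using ch[OF q] q by (auto simp: P_def)
          have "u (x + z) \<le> r (x + z)" using le r by blast
          also have "\<dots> \<le> r x + r z" using sub[OF r(1)] by (simp add: sublinear_def)
          also have "\<dots> \<le> q x + q' z" using r by (intro add_mono) auto
          finally show ?thesis by simp
        qed
        then have "u (x + z) - q x \<le> u z" if "q \<in> C" for q using ge that by blast
        then have "u (x + z) - u z \<le> q x" if "q \<in> C" for q using that by (simp add: algebra_simps)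
        then have "u (x + z) - u z \<le> u x" using ge by blast
        then show "u (x + z) \<le> u x + u z" by simp
      next
        fix c :: real and x assume c: "0 < c"
        have "inverse c * u (c *\<^sub>R x) \<le> q x" if "q \<in> C" for q
        proof -
          have "u (c *\<^sub>R x) \<le> c * q x"
            using le[OF that, of "c *\<^sub>R x"] sub[OF that] c by (simp add: sublinear_def)
          then show ?thesis using c by (simp add: field_simps)
        qed
        then have "inverse c * u (c *\<^sub>R x) \<le> u x" using ge by blast
        then show "u (c *\<^sub>R x) \<le> c * u x" using c by (simp add: field_simps)
      next
        obtain q where "q \<in> C" using False by blast
        then show "u 0 = 0" using zero le[of q 0] ge[of 0 0] by fastforce
      qed
      moreover have "u x \<le> p x" for x
      proof -
        obtain q where "q \<in> C" using False by blast
        then show ?thesis using le[of q x] qp[of q x] by simp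
      qed
      ultimately show ?thesis using le by (auto simp: A_def P_def)
    qed
  qed
  then obtain m where m: "sublinear m" "\<And>x. m x \<le> p x"
    and min: "\<And>a. sublinear a \<Longrightarrow> (\<And>x. a x \<le> m x) \<Longrightarrow> a = m"
    by (auto simp: A_def P_def) (metis order_trans)
  have neg: "m (- y) = - m y" for y
  proof -
    obtain q' where q': "sublinear q'" "\<And>x. q' x \<le> m x" "q' (- y) \<le> - m y"
      using sublinear_shift[OF m(1)] by blast
    then have "m (- y) \<le> - m y" using min by metis
    then show ?thesis using sublinear_lower[OF m(1), of "- y"] by simp
  qed
  have add: "m (x + y) = m x + m y" for x y
  proof -
    have "m (x + y) \<le> m x + m y" using m(1) by (simp add: sublinear_def)
    moreover have "m (- x + - y) \<le> m (- x) + m (- y)" using m(1) unfolding sublinear_def by blast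
    ultimately show ?thesis using neg[of "x + y"] by (simp add: neg)
  qed
  have scale: "m (c *\<^sub>R x) = c * m x" for c x
  proof (cases "c \<ge> 0")
    case True
    then show ?thesis using m(1) by (simp add: sublinear_def)
  next
    case False
    then have "0 \<le> - c" by simp
    then have "m ((- c) *\<^sub>R x) = - c * m x" using m(1) unfolding sublinear_def by blast
    then show ?thesis by (simp add: neg)
  qed
  have "linear m" by (rule linearI) (simp_all add: add scale)
  then show ?thesis using m(2) that by blast
qed

text \<open>Shifting \<open>p\<close> along \<open>x0\<close> before minimising forces
  \<open>f (- x0) \<le> - p x0\<close> for every linear \<open>f\<close> below the shifted
  functional, so \<open>p x0\<close> is attained.\<close>

theorem seminorm_support_functional:
  fixes p :: "'v::real_vector \<Rightarrow> real"
  assumes "\<And>x y. p (x + y) \<le> p x + p y" "\<And>c x. p (c *\<^sub>R x) = \<bar>c\<bar> * p x"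
  obtains f where "linear f" "\<And>x. \<bar>f x\<bar> \<le> p x" "f x0 = p x0"
proof -
  have p: "sublinear p" using assms by (simp add: sublinear_def)
  obtain q where q: "sublinear q" "\<And>x. q x \<le> p x" "q (- x0) \<le> - p x0"
    using sublinear_shift[OF p] by blast
  obtain f where f: "linear f" "\<And>x. f x \<le> q x" using sublinear_dominates_linear[OF q(1)] by blast
  have neg: "f (- x) = - f x" for x using f(1) by (rule linear_neg)
  have fp: "f x \<le> p x" for x using f(2)[of x] q(2)[of x] by simp
  have pneg: "p (- x) = p x" for x using assms(2)[of "-1" x] by simp
  have "\<bar>f x\<bar> \<le> p x" for x using fp[of x] fp[of "- x"] by (simp add: neg pneg abs_le_iff)
  moreover have "f x0 = p x0" using f(2)[of "- x0"] q(3) fp[of x0] by (simp add: neg)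
  ultimately show ?thesis using f(1) that by blast
qed

section \<open>Normed carriers\<close>

text \<open>A carrier set instead of a type class: the space of part (ii) is a subspace of a type
  with a norm different from that of the type, while ordinary normed spaces are the case
  \<open>UNIV\<close>.\<close>

locale normed_carrier =
  fixes V :: "'v::real_vector set" and N :: "'v \<Rightarrow> real"
  assumes normed: "normed_on V N"
begin

lemma sub: "subspace V" using normed by (simp add: normed_on_def)

lemma V_0 [simp]: "0 \<in> V" and V_add: "x \<in> V \<Longrightarrow> y \<in> V \<Longrightarrow> x + y \<in> V"
  and V_diff: "x \<in> V \<Longrightarrow> y \<in> V \<Longrightarrow> x - y \<in> V" and V_scale: "x \<in> V \<Longrightarrow> c *\<^sub>R x \<in> V"
  and V_sum: "(\<And>i. i \<in> I \<Longrightarrow> g i \<in> V) \<Longrightarrow> sum g I \<in> V"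
  using sub by (auto intro: subspace_0 subspace_add subspace_diff subspace_scale subspace_sum)

lemma N_nonneg: "x \<in> V \<Longrightarrow> 0 \<le> N x" and N_eq_0: "x \<in> V \<Longrightarrow> N x = 0 \<longleftrightarrow> x = 0"
  and N_triangle: "x \<in> V \<Longrightarrow> y \<in> V \<Longrightarrow> N (x + y) \<le> N x + N y"
  and N_scale: "x \<in> V \<Longrightarrow> N (c *\<^sub>R x) = \<bar>c\<bar> * N x"
  using normed by (auto simp: normed_on_def)

lemma N_0 [simp]: "N 0 = 0" using N_eq_0[OF V_0] by simp

lemma N_minus_commute: "x \<in> V \<Longrightarrow> y \<in> V \<Longrightarrow> N (x - y) = N (y - x)"
  using N_scale[of "y - x" "-1"] V_diff[of y x] by simp

lemma N_triangle_diff: "x \<in> V \<Longrightarrow> y \<in> V \<Longrightarrow> z \<in> V \<Longrightarrow> N (x - z) \<le> N (x - y) + N (y - z)"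
  using N_triangle[of "x - y" "y - z"] by (simp add: V_diff)

lemma N_le_diff: "x \<in> V \<Longrightarrow> y \<in> V \<Longrightarrow> N x \<le> N y + N (x - y)"
  using N_triangle[of y "x - y"] by (simp add: V_diff)

lemma N_abs_diff_le: "x \<in> V \<Longrightarrow> y \<in> V \<Longrightarrow> \<bar>N x - N y\<bar> \<le> N (x - y)"
  using N_le_diff[of x y] N_le_diff[of y x] N_minus_commute[of x y] by (simp add: abs_le_iff)

lemma N_sum_le: "finite I \<Longrightarrow> (\<And>i. i \<in> I \<Longrightarrow> g i \<in> V) \<Longrightarrow> N (sum g I) \<le> (\<Sum>i\<in>I. N (g i))"
proof (induction I rule: finite_induct)
  case (insert i I)
  then show ?case using N_triangle[of "g i" "sum g I"] by (fastforce intro: V_sum)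
qed simp

text \<open>The \<open>i\<close>-th term is a difference of two consecutive partial sums, each
  controlled by \<open>gr\<close>; hence the factor \<open>2 * K\<close>. Since \<open>n\<close> is
  fixed, the bound also applies to a finite stretch of a sequence still under construction.\<close>

lemma coefficient_bound:
  fixes x :: "nat \<Rightarrow> 'v" and i n :: nat
  assumes x: "range x \<subseteq> V"
    and gr: "\<And>m a. m \<le> n \<Longrightarrow> N (\<Sum>i<m. a i *\<^sub>R x i) \<le> K * N (\<Sum>i<n. a i *\<^sub>R x i)"
    and i: "i < n"
  shows "\<bar>a i\<bar> * N (x i) \<le> 2 * K * N (\<Sum>i<n. a i *\<^sub>R x i)"
proof -
  have V: "(\<Sum>i<m. a i *\<^sub>R x i) \<in> V" for m using x by (intro V_sum V_scale) auto
  have "a i *\<^sub>R x i = (\<Sum>i<Suc i. a i *\<^sub>R x i) - (\<Sum>i<i. a i *\<^sub>R x i)" by simp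
  then have "\<bar>a i\<bar> * N (x i) = N ((\<Sum>i<Suc i. a i *\<^sub>R x i) - (\<Sum>i<i. a i *\<^sub>R x i))"
    using x by (simp add: N_scale image_subset_iff)
  also have "\<dots> \<le> N (\<Sum>i<Suc i. a i *\<^sub>R x i) + N (\<Sum>i<i. a i *\<^sub>R x i)"
    using N_triangle_diff[OF V[of "Suc i"] V_0 V[of i]] N_minus_commute[OF V_0 V[of i]] by simp
  also have "\<dots> \<le> K * N (\<Sum>i<n. a i *\<^sub>R x i) + K * N (\<Sum>i<n. a i *\<^sub>R x i)"
    using i by (intro add_mono gr) auto
  finally show ?thesis by simp
qed

lemma span_range_representation:
  assumes "s \<in> span (range (x::nat \<Rightarrow> 'v))"
  obtains b L where "s = (\<Sum>i<L. b i *\<^sub>R x i)" "\<And>i. i \<ge> L \<Longrightarrow> b i = 0"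
proof -
  have "\<exists>b L. s = (\<Sum>i<L. b i *\<^sub>R x i) \<and> (\<forall>i\<ge>L. b i = 0)"
    using assms
  proof (induction rule: span_induct_alt)
    case base
    then show ?case by (intro exI[of _ "\<lambda>_. 0"]) auto
  next
    case (step c y z)
    then obtain b L j where bL: "z = (\<Sum>i<L. b i *\<^sub>R x i)" "\<forall>i\<ge>L. b i = 0" and j: "y = x j" by blast
    define M where "M = max L (Suc j)"
    have "z = (\<Sum>i<M. b i *\<^sub>R x i)" unfolding bL(1)
      by (rule sum.mono_neutral_left) (use bL(2) in \<open>auto simp: M_def\<close>)
    moreover have "c *\<^sub>R y = (\<Sum>i<M. (if i = j then c else 0) *\<^sub>R x i)"
    proof -
      have "(\<Sum>i<M. (if i = j then c else 0) *\<^sub>R x i) = (\<Sum>i<M. if i = j then c *\<^sub>R x i else 0)"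
        by (rule sum.cong) auto
      moreover have "j < M" by (simp add: M_def)
      ultimately show ?thesis by (simp add: j)
    qed
    ultimately have "c *\<^sub>R y + z = (\<Sum>i<M. ((if i = j then c else 0) + b i) *\<^sub>R x i)"
      by (simp add: scaleR_add_left sum.distrib)
    then show ?case
      by (intro exI[of _ "\<lambda>i. (if i = j then c else 0) + b i"] exI[of _ M]) (use bL(2) in \<open>auto simp: M_def\<close>)
  qed
  then show ?thesis using that by blast
qed

text \<open>Grunblum's criterion. Finite combinations converging to \<open>y\<close> have
  coefficients that are Cauchy one by one; the limits of these expand \<open>y\<close> because the
  bound on partial sums is uniform in their length. Uniqueness follows from the same control of
  single coefficients.\<close>

theorem grunblum_basic:
  assumes x: "range x \<subseteq> V" and nz: "\<And>i. x i \<noteq> 0"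
    and gr: "\<And>m n a. m \<le> n \<Longrightarrow> N (\<Sum>i<m. a i *\<^sub>R x i) \<le> K * N (\<Sum>i<n. a i *\<^sub>R x i)"
  shows "basic_seq V N x"
  unfolding basic_seq_def
proof (intro conjI ballI x)
  have xV: "x i \<in> V" for i using x by auto
  have xpos: "0 < N (x i)" for i using N_nonneg[OF xV, of i] N_eq_0[OF xV, of i] nz[of i] by linarith
  have PV: "(\<Sum>i<m. a i *\<^sub>R x i) \<in> V" for m a using x by (intro V_sum V_scale) auto
  have coeff: "\<bar>a i\<bar> * N (x i) \<le> 2 * K * N (\<Sum>i<n. a i *\<^sub>R x i)" if "i < n" for a i n
    by (rule coefficient_bound[OF x _ that]) (rule gr)
  have K: "1 \<le> K"
  proof -
    have "N (x 0) \<le> K * N (x 0)" using gr[of 1 1 "\<lambda>_. 1"] by simp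
    then show ?thesis using xpos[of 0] by simp
  qed
  fix y assume "y \<in> closed_span_on V N x"
  then obtain s where yV: "y \<in> V" and s: "range s \<subseteq> span (range x)" and lim: "nlim N s y"
    by (auto simp: closed_span_on_def)
  have "\<exists>b L. s k = (\<Sum>i<L. b i *\<^sub>R x i) \<and> (\<forall>i\<ge>L. b i = 0)" for k
    using span_range_representation[of "s k" x] s by (metis range_subsetD)
  then obtain b L where b: "\<And>k. s k = (\<Sum>i<L k. b k i *\<^sub>R x i)" and bz: "\<And>k i. i \<ge> L k \<Longrightarrow> b k i = 0"
    by metis
  have sV: "s k \<in> V" for k unfolding b by (rule PV)
  have s_eq: "s k = (\<Sum>i<M. b k i *\<^sub>R x i)" if "M \<ge> L k" for k M
    unfolding b by (rule sum.mono_neutral_left) (use that bz in auto)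
  have diff: "s k - s l = (\<Sum>i<M. (b k i - b l i) *\<^sub>R x i)" if "M \<ge> L k" "M \<ge> L l" for k l M
    using s_eq[OF that(1)] s_eq[OF that(2)] by (simp add: scaleR_diff_left sum_subtractf)
  have part: "N (\<Sum>i<m. (b k i - b l i) *\<^sub>R x i) \<le> K * N (s k - s l)" for k l m
  proof -
    define M where "M = Max {m, L k, L l}"
    have "m \<le> M" "L k \<le> M" "L l \<le> M" by (auto simp: M_def)
    then show ?thesis using gr[of m M "\<lambda>i. b k i - b l i"] diff by metis
  qed
  have cauchy: "\<exists>M. \<forall>k\<ge>M. \<forall>l\<ge>M. N (s k - s l) < e" if "e > 0" for e
  proof -
    have "e / 2 > 0" using that by simp
    then obtain M where M: "\<And>n. n \<ge> M \<Longrightarrow> N (s n - y) < e / 2"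
      using lim unfolding nlim_def by blast
    have "N (s k - s l) < e" if "k \<ge> M" "l \<ge> M" for k l
      using N_triangle_diff[OF sV yV sV, of k l] N_minus_commute[OF yV sV, of l] M[OF that(1)] M[OF that(2)]
      by simp
    then show ?thesis by blast
  qed
  have bdiff: "\<bar>b k i - b l i\<bar> * N (x i) \<le> 2 * K * N (s k - s l)" for k l i
  proof -
    define M where "M = Max {Suc i, L k, L l}"
    have M: "Suc i \<le> M" "L k \<le> M" "L l \<le> M" by (auto simp: M_def)
    then show ?thesis using coeff[of i M "\<lambda>i. b k i - b l i"] diff[OF M(2,3)] by simp
  qed
  have "\<exists>a. (\<lambda>k. b k i) \<longlonglongrightarrow> a" for i
  proof -
    have "Cauchy (\<lambda>k. b k i)"
    proof (rule metric_CauchyI)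
      fix e :: real assume "e > 0"
      then have "e * N (x i) / (2 * K) > 0" using K xpos[of i] by simp
      then obtain M where M: "\<forall>k\<ge>M. \<forall>l\<ge>M. N (s k - s l) < e * N (x i) / (2 * K)" using cauchy by blast
      have "dist (b k i) (b l i) < e" if "k \<ge> M" "l \<ge> M" for k l
      proof -
        have "2 * K * N (s k - s l) < e * N (x i)" using M that K by (simp add: field_simps)
        then have "\<bar>b k i - b l i\<bar> * N (x i) < e * N (x i)" using bdiff[of k i l] by linarith
        then show ?thesis using xpos[of i] by (simp add: dist_real_def)
      qed
      then show "\<exists>M. \<forall>m\<ge>M. \<forall>n\<ge>M. dist (b m i) (b n i) < e" by blast
    qed
    then show ?thesis using Cauchy_convergent_iff convergent_def by blast
  qed
  then obtain a where a: "\<And>i. (\<lambda>k. b k i) \<longlonglongrightarrow> a i" by metis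
  have main: "nlim N (\<lambda>n. \<Sum>i<n. a i *\<^sub>R x i) y"
    unfolding nlim_def
  proof (intro allI impI)
    fix e :: real assume e: "e > 0"
    define d where "d = e / (2 * (K + 1))"
    have d: "d > 0" using e K by (simp add: d_def)
    obtain M1 where M1: "\<forall>k\<ge>M1. \<forall>l\<ge>M1. N (s k - s l) < d" using cauchy[OF d] by blast
    obtain M2 where M2: "\<forall>k\<ge>M2. N (s k - y) < d" using lim d unfolding nlim_def by blast
    define k where "k = max M1 M2"
    \<comment> \<open>The point is uniformity in \<open>m\<close>: passing from \<open>a\<close> to
      \<open>b l\<close> costs a finite sum that vanishes as \<open>l\<close> grows with
      \<open>m\<close> fixed, and the rest is bounded by \<open>part\<close> independently of
      \<open>m\<close>.\<close>
    have first: "N (\<Sum>i<m. (a i - b k i) *\<^sub>R x i) \<le> K * d" for m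
    proof -
      have small: "N (\<Sum>i<m. (a i - b l i) *\<^sub>R x i) \<le> (\<Sum>i<m. \<bar>a i - b l i\<bar> * N (x i))" for l
        using N_sum_le[of "{..<m}" "\<lambda>i. (a i - b l i) *\<^sub>R x i"] by (simp add: N_scale xV V_scale)
      have bound: "N (\<Sum>i<m. (a i - b k i) *\<^sub>R x i) \<le> (\<Sum>i<m. \<bar>a i - b l i\<bar> * N (x i)) + K * d" if l: "l \<ge> M1" for l
      proof -
        have eq: "(\<Sum>i<m. (a i - b k i) *\<^sub>R x i) = (\<Sum>i<m. (a i - b l i) *\<^sub>R x i) + (\<Sum>i<m. (b l i - b k i) *\<^sub>R x i)"
          by (simp add: sum.distrib[symmetric] algebra_simps)
        have "N (\<Sum>i<m. (b l i - b k i) *\<^sub>R x i) \<le> K * N (s l - s k)" by (rule part)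
        also have "\<dots> \<le> K * d" using M1 l K by (intro mult_left_mono) (auto simp: k_def less_imp_le)
        finally show ?thesis unfolding eq
          using N_triangle[OF PV[of "\<lambda>i. a i - b l i" m] PV[of "\<lambda>i. b l i - b k i" m]] small[of l] by linarith
      qed
      have "(\<lambda>l. (\<Sum>i<m. \<bar>a i - b l i\<bar> * N (x i)) + K * d) \<longlonglongrightarrow> (\<Sum>i<m. \<bar>a i - a i\<bar> * N (x i)) + K * d"
        by (intro tendsto_intros a)
      then have "(\<lambda>l. (\<Sum>i<m. \<bar>a i - b l i\<bar> * N (x i)) + K * d) \<longlonglongrightarrow> K * d" by simp
      then show ?thesis
        by (rule tendsto_lowerbound) (auto simp: eventually_sequentially intro!: exI[of _ M1] bound)
    qed
    have "N ((\<Sum>i<n. a i *\<^sub>R x i) - y) < e" if n: "n \<ge> L k" for n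
    proof -
      have "(\<Sum>i<n. a i *\<^sub>R x i) - s k = (\<Sum>i<n. (a i - b k i) *\<^sub>R x i)"
        by (simp add: s_eq[OF n] sum_subtractf scaleR_diff_left)
      then have "N ((\<Sum>i<n. a i *\<^sub>R x i) - y) \<le> K * d + N (s k - y)"
        using N_triangle_diff[OF PV sV yV, of a n k] first[of n] by simp
      also have "\<dots> < K * d + d" using M2 by (simp add: k_def)
      also have "\<dots> = (K + 1) * d" by (simp add: algebra_simps)
      also have "\<dots> = e / 2" using K by (simp add: d_def divide_simps del: distrib_left_numeral)
      also have "\<dots> \<le> e" using e by simp
      finally show ?thesis .
    qed
    then show "\<exists>M. \<forall>n\<ge>M. N ((\<Sum>i<n. a i *\<^sub>R x i) - y) < e" by blast
  qed
  show "\<exists>!a. nlim N (\<lambda>n. \<Sum>i<n. a i *\<^sub>R x i) y"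
  proof (rule ex1I[where P="\<lambda>a. nlim N (\<lambda>n. \<Sum>i<n. a i *\<^sub>R x i) y" and a=a, OF main], rule ext)
    fix c i assume c: "nlim N (\<lambda>n. \<Sum>i<n. c i *\<^sub>R x i) y"
    show "c i = a i"
    proof (rule ccontr)
      assume ne: "c i \<noteq> a i"
      define e where "e = \<bar>c i - a i\<bar> * N (x i) / (4 * K)"
      have e: "e > 0" using ne K xpos[of i] by (simp add: e_def)
      obtain M1 where M1: "\<forall>n\<ge>M1. N ((\<Sum>i<n. c i *\<^sub>R x i) - y) < e" using c e unfolding nlim_def by blast
      obtain M2 where M2: "\<forall>n\<ge>M2. N ((\<Sum>i<n. a i *\<^sub>R x i) - y) < e" using main e unfolding nlim_def by blast
      define n where "n = Max {M1, M2, Suc i}"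
      have n: "M1 \<le> n" "M2 \<le> n" "i < n" by (auto simp: n_def Suc_le_eq[symmetric])
      have "\<bar>c i - a i\<bar> * N (x i) \<le> 2 * K * N (\<Sum>i<n. (c i - a i) *\<^sub>R x i)"
        using coeff[of i n "\<lambda>i. c i - a i"] n by simp
      also have "(\<Sum>i<n. (c i - a i) *\<^sub>R x i) = (\<Sum>i<n. c i *\<^sub>R x i) - (\<Sum>i<n. a i *\<^sub>R x i)"
        by (simp add: sum_subtractf scaleR_diff_left)
      also have "2 * K * N \<dots> < 2 * K * (e + e)"
      proof -
        have "N ((\<Sum>i<n. c i *\<^sub>R x i) - (\<Sum>i<n. a i *\<^sub>R x i)) < e + e"
          using N_triangle_diff[OF PV[of c n] yV PV[of a n]] N_minus_commute[OF yV PV[of a n]] M1 M2 n by fastforce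
        then show ?thesis using K by simp
      qed
      also have "\<dots> = \<bar>c i - a i\<bar> * N (x i)" using K by (simp add: e_def)
      finally show False by simp
    qed
  qed
qed

text \<open>Replaces the two-sided estimates of the definition by an exact limit, valid along every
  subsequence. All later comparisons of spreading models are comparisons of such limits.\<close>

lemma spreading_model_limit:
  assumes x: "range x \<subseteq> V" and gen: "generates_sm N x S" and phi: "strict_mono \<phi>"
  shows "(\<lambda>t. N (\<Sum>j<m. a j *\<^sub>R x (\<phi> (t + j)))) \<longlonglongrightarrow> S (\<lambda>i. if i < m then a i else 0)"
proof -
  define b where "b = (\<lambda>i. if i < m then a i else 0)"
  \<comment> \<open>The definition admits only coefficients in \<open>[-1, 1]\<close>: dividing by
    \<open>M\<close> enforces this, and homogeneity undoes it. The summand 1 keeps \<open>M\<close>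
    positive.\<close>
  define M where "M = 1 + (\<Sum>j<m. \<bar>a j\<bar>)"
  have M: "M > 0" unfolding M_def by (simp add: add_pos_nonneg sum_nonneg)
  have bM: "\<bar>b i\<bar> \<le> M" for i
  proof (cases "i < m")
    case True
    then have "\<bar>a i\<bar> \<le> (\<Sum>j<m. \<bar>a j\<bar>)" by (intro member_le_sum) auto
    then show ?thesis using True by (simp add: b_def M_def)
  qed (use M in \<open>simp add: b_def\<close>)
  have fin: "finsupp b" unfolding finsupp_def by (rule finite_subset[of _ "{..<m}"]) (auto simp: b_def)
  obtain \<epsilon> where eps: "\<epsilon> \<longlonglongrightarrow> 0" and semi: "c00_seminorm S"
    and est: "\<And>n a k. (\<forall>i<n. \<bar>a i\<bar> \<le> 1) \<and> (\<forall>i j. i < j \<and> j < n \<longrightarrow> k i < k j) \<and> n \<le> k 0 \<Longrightarrow>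
            inverse (1 + \<epsilon> n) * S (\<lambda>i. if i < n then a i else 0)
              \<le> N (\<Sum>i<n. a i *\<^sub>R x (k i)) \<and>
            N (\<Sum>i<n. a i *\<^sub>R x (k i))
              \<le> (1 + \<epsilon> n) * S (\<lambda>i. if i < n then a i else 0)"
    using gen unfolding generates_sm_def by blast
  define F where "F t = N (\<Sum>j<m. a j *\<^sub>R x (\<phi> (t + j)))" for t
  have V: "(\<Sum>j<m. a j *\<^sub>R x (\<phi> (t + j))) \<in> V" for t using x by (intro V_sum V_scale) auto
  \<comment> \<open>The definition is applied to the vector padded with zeros to length
    \<open>t\<close>. Length and starting index grow together, so the error is
    \<open>\<epsilon> t\<close> and not the fixed \<open>\<epsilon> m\<close>.\<close>
  have bounds: "inverse (1 + \<epsilon> t) * S b \<le> F t" "F t \<le> (1 + \<epsilon> t) * S b" if t: "t \<ge> m" for t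
  proof -
    have eq1: "(\<lambda>i. if i < t then inverse M * b i else 0) = (\<lambda>i. inverse M * b i)"
      using t by (auto simp: b_def fun_eq_iff)
    have "(\<Sum>i<t. (inverse M * b i) *\<^sub>R x (\<phi> (t + i))) = (\<Sum>i<m. (inverse M * b i) *\<^sub>R x (\<phi> (t + i)))"
      by (rule sum.mono_neutral_right) (use t in \<open>auto simp: b_def\<close>)
    also have "\<dots> = inverse M *\<^sub>R (\<Sum>j<m. a j *\<^sub>R x (\<phi> (t + j)))"
      by (simp add: scaleR_sum_right b_def)
    finally have eq2: "N (\<Sum>i<t. (inverse M * b i) *\<^sub>R x (\<phi> (t + i))) = inverse M * F t"
      using M by (simp add: N_scale[OF V] F_def)
    have eq3: "S (\<lambda>i. inverse M * b i) = inverse M * S b"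
      using semi fin M unfolding c00_seminorm_def by simp
    have small: "\<bar>inverse M * b i\<bar> \<le> 1" for i using bM[of i] M by (simp add: abs_mult field_simps)
    have "t \<le> \<phi> (t + 0)" using phi seq_suble[OF phi, of t] by simp
    moreover have "\<forall>i j. i < j \<and> j < t \<longrightarrow> \<phi> (t + i) < \<phi> (t + j)"
      using phi by (simp add: strict_mono_def)
    ultimately have "inverse (1 + \<epsilon> t) * (inverse M * S b) \<le> inverse M * F t \<and>
        inverse M * F t \<le> (1 + \<epsilon> t) * (inverse M * S b)"
      using est[of t "\<lambda>i. inverse M * b i" "\<lambda>i. \<phi> (t + i)"] small unfolding eq1 eq2 eq3 by blast
    then have "inverse M * (inverse (1 + \<epsilon> t) * S b) \<le> inverse M * F t \<and>
        inverse M * F t \<le> inverse M * ((1 + \<epsilon> t) * S b)" by (simp add: mult_ac)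
    then show "inverse (1 + \<epsilon> t) * S b \<le> F t" "F t \<le> (1 + \<epsilon> t) * S b"
      using M by (auto simp: mult_le_cancel_left)
  qed
  have "F \<longlonglongrightarrow> S b"
  proof (rule real_tendsto_sandwich)
    show "\<forall>\<^sub>F t in sequentially. inverse (1 + \<epsilon> t) * S b \<le> F t"
      "\<forall>\<^sub>F t in sequentially. F t \<le> (1 + \<epsilon> t) * S b"
      using bounds by (auto simp: eventually_sequentially)
    have "(\<lambda>t. inverse (1 + \<epsilon> t) * S b) \<longlonglongrightarrow> inverse (1 + 0) * S b" by (intro tendsto_intros eps) simp
    then show "(\<lambda>t. inverse (1 + \<epsilon> t) * S b) \<longlonglongrightarrow> S b" by simp
    have "(\<lambda>t. (1 + \<epsilon> t) * S b) \<longlonglongrightarrow> (1 + 0) * S b" by (intro tendsto_intros eps)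
    then show "(\<lambda>t. (1 + \<epsilon> t) * S b) \<longlonglongrightarrow> S b" by simp
  qed
  then show ?thesis by (simp add: F_def[abs_def] b_def)
qed

end

section \<open>Domination of seminorms\<close>

lemma finsupp_bounded: "finsupp a \<Longrightarrow> \<exists>m. \<forall>i\<ge>m. a i = 0"
  unfolding finsupp_def finite_nat_set_iff_bounded using leD by blast

lemma finsupp_truncate [simp]: "finsupp (\<lambda>i. if i < m then a i else 0)"
  unfolding finsupp_def by (rule finite_subset[of _ "{..<m}"]) auto

lemma finsupp_scale: "finsupp a \<Longrightarrow> finsupp (\<lambda>i. c * a i)"
  unfolding finsupp_def by (rule finite_subset) auto

lemma c00_seminorm_nonneg:
  assumes "c00_seminorm S" "finsupp a" shows "0 \<le> S a"
proof -
  have "S (\<lambda>i. a i + (-1) * a i) \<le> S a + S (\<lambda>i. (-1) * a i)"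
    using assms finsupp_scale[OF assms(2), of "-1"] unfolding c00_seminorm_def by blast
  moreover have "S (\<lambda>i. (-1) * a i) = \<bar>-1\<bar> * S a" "S (\<lambda>i. 0 * a i) = \<bar>0\<bar> * S a"
    using assms unfolding c00_seminorm_def by blast+
  ultimately show ?thesis by simp
qed

lemma dominates_refl: "dominates S S"
  unfolding dominates_def by (rule exI[of _ 1]) simp

text \<open>The constant in \<open>dominates\<close> is an arbitrary real. Since \<open>T\<close> is
  nonnegative it may be enlarged to a positive one, which can then be multiplied and divided
  by.\<close>

lemma dominates_posE:
  assumes "dominates T S" "c00_seminorm T"
  obtains C where "C > 0" "\<And>a. finsupp a \<Longrightarrow> S a \<le> C * T a"
proof -
  obtain C where C: "\<And>a. finsupp a \<Longrightarrow> S a \<le> C * T a" using assms unfolding dominates_def by blast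
  have "S a \<le> (\<bar>C\<bar> + 1) * T a" if "finsupp a" for a
  proof -
    have "C * T a \<le> (\<bar>C\<bar> + 1) * T a" using c00_seminorm_nonneg[OF assms(2) that] by (intro mult_right_mono) auto
    then show ?thesis using C[OF that] by linarith
  qed
  then show ?thesis by (intro that[of "\<bar>C\<bar> + 1"]) auto
qed

lemma dominates_trans:
  assumes "dominates T S" "dominates U T" "c00_seminorm T" "c00_seminorm U"
  shows "dominates U S"
proof -
  obtain C where C: "C > 0" "\<And>a. finsupp a \<Longrightarrow> S a \<le> C * T a" using dominates_posE[OF assms(1,3)] by blast
  obtain D where D: "D > 0" "\<And>a. finsupp a \<Longrightarrow> T a \<le> D * U a" using dominates_posE[OF assms(2,4)] by blast
  have "S a \<le> (C * D) * U a" if "finsupp a" for a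
    using C(2)[OF that] mult_left_mono[OF D(2)[OF that] less_imp_le[OF C(1)]] by (simp only: mult.assoc)
  then show ?thesis unfolding dominates_def by blast
qed

lemma wsm_seminorm: "S \<in> wsm V N \<Longrightarrow> c00_seminorm S"
  by (auto simp: wsm_def generates_sm_def)

text \<open>\<open>sp_le\<close> asks for some pair of representatives; transitivity of domination
  makes every pair equally good.\<close>

lemma sp_le_iff:
  assumes "S \<in> wsm V N" "T \<in> wsm V N"
  shows "sp_le {S'\<in>wsm V N. equiv_sm S S'} {T'\<in>wsm V N. equiv_sm T T'} \<longleftrightarrow> dominates T S"
proof
  assume "sp_le {S'\<in>wsm V N. equiv_sm S S'} {T'\<in>wsm V N. equiv_sm T T'}"
  then obtain S' T' where "S' \<in> wsm V N" "T' \<in> wsm V N" "equiv_sm S S'" "equiv_sm T T'" "dominates T' S'"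
    unfolding sp_le_def by blast
  then show "dominates T S"
    using assms unfolding equiv_sm_def by (meson dominates_trans wsm_seminorm)
next
  assume "dominates T S"
  then show "sp_le {S'\<in>wsm V N. equiv_sm S S'} {T'\<in>wsm V N. equiv_sm T T'}"
    using assms unfolding sp_le_def equiv_sm_def by (blast intro: dominates_refl)
qed

lemma class_eq_iff:
  assumes "S \<in> wsm V N" "T \<in> wsm V N"
  shows "{S'\<in>wsm V N. equiv_sm S S'} = {T'\<in>wsm V N. equiv_sm T T'} \<longleftrightarrow> equiv_sm S T"
proof
  assume "{S'\<in>wsm V N. equiv_sm S S'} = {T'\<in>wsm V N. equiv_sm T T'}"
  moreover have "T \<in> {T'\<in>wsm V N. equiv_sm T T'}" using assms by (simp add: equiv_sm_def dominates_refl)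
  ultimately show "equiv_sm S T" by blast
next
  assume "equiv_sm S T"
  then show "{S'\<in>wsm V N. equiv_sm S S'} = {T'\<in>wsm V N. equiv_sm T T'}"
    using assms unfolding equiv_sm_def by (intro Collect_cong) (meson dominates_trans wsm_seminorm)
qed

section \<open>The Brunel--Sucheston theorem\<close>

definition norm_stable :: "(nat \<Rightarrow> 'a::real_normed_vector) \<Rightarrow> nat \<Rightarrow> (nat \<Rightarrow> real) \<Rightarrow> real \<Rightarrow> bool" where
  "norm_stable x n a e \<longleftrightarrow> (\<forall>k l. strict_mono_on {..<n} k \<longrightarrow> strict_mono_on {..<n} l \<longrightarrow>
      \<bar>norm (\<Sum>j<n. a j *\<^sub>R x (k j)) - norm (\<Sum>j<n. a j *\<^sub>R x (l j))\<bar> \<le> e)"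

lemma norm_stable_subseq:
  assumes "norm_stable x n a e" "strict_mono r"
  shows "norm_stable (x \<circ> r) n a e"
  unfolding norm_stable_def
proof (intro allI impI)
  fix k l :: "nat \<Rightarrow> nat"
  assume kl: "strict_mono_on {..<n} k" "strict_mono_on {..<n} l"
  have "strict_mono_on {..<n} (\<lambda>j. r (k j))" "strict_mono_on {..<n} (\<lambda>j. r (l j))"
    using kl assms(2) by (auto simp: strict_mono_on_def strict_mono_def)
  then show "\<bar>norm (\<Sum>j<n. a j *\<^sub>R (x \<circ> r) (k j)) - norm (\<Sum>j<n. a j *\<^sub>R (x \<circ> r) (l j))\<bar> \<le> e"
    using assms(1) unfolding norm_stable_def comp_def by blast
qed

text \<open>An \<open>n\<close>-element index set is coloured by the interval of length
  \<open>e\<close> into which its norm falls. The norms are at most \<open>n\<close>, so there are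
  finitely many colours, and the infinite Ramsey theorem gives a set on which all norms share one
  interval.\<close>

lemma ramsey_norm_subsequence:
  fixes x :: "nat \<Rightarrow> 'a::real_normed_vector" and n :: nat
  assumes x: "\<And>i. norm (x i) \<le> 1" and a: "\<And>j. \<bar>a j\<bar> \<le> 1" and e: "e > 0"
  obtains r :: "nat \<Rightarrow> nat" where "strict_mono r" "norm_stable (x \<circ> r) n a e"
proof -
  define g where "g k = norm (\<Sum>j<n. a j *\<^sub>R x (k j))" for k
  define f where "f X = nat \<lfloor>g (\<lambda>j. sorted_list_of_set X ! j) / e\<rfloor>" for X
  have g_le: "g k \<le> n" for k
  proof -
    have "g k \<le> (\<Sum>j<n. norm (a j *\<^sub>R x (k j)))" unfolding g_def by (rule norm_sum)
    also have "\<dots> \<le> (\<Sum>j<n. 1)"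
      by (intro sum_mono) (use x a in \<open>auto intro!: mult_le_one\<close>)
    finally show ?thesis by simp
  qed
  have "f X < nat \<lfloor>n / e\<rfloor> + 1" for X
  proof -
    have "\<lfloor>g (\<lambda>j. sorted_list_of_set X ! j) / e\<rfloor> \<le> \<lfloor>n / e\<rfloor>"
      using e by (intro floor_mono divide_right_mono g_le) auto
    then show ?thesis unfolding f_def by linarith
  qed
  then obtain Y t where Y: "infinite Y" and t: "\<And>X. X \<subseteq> Y \<Longrightarrow> finite X \<Longrightarrow> card X = n \<Longrightarrow> f X = t"
    using Ramsey[of "UNIV::nat set" n f "nat \<lfloor>n / e\<rfloor> + 1"] by auto
  define r where "r = enumerate Y"
  have r: "strict_mono r" unfolding r_def using Y by (simp add: strict_mono_enumerate)
  have val: "nat \<lfloor>g (\<lambda>j. r (k j)) / e\<rfloor> = t" if k: "strict_mono_on {..<n} k" for k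
  proof -
    define X where "X = (\<lambda>j. r (k j)) ` {..<n}"
    have mono: "r (k i) < r (k j)" if "i < j" "j < n" for i j
    proof -
      have "k i < k j" using k that unfolding strict_mono_on_def by auto
      then show ?thesis using r by (simp add: strict_mono_def)
    qed
    have inj: "inj_on (\<lambda>j. r (k j)) {..<n}"
    proof (rule inj_onI)
      fix i j assume "i \<in> {..<n}" "j \<in> {..<n}" "r (k i) = r (k j)"
      then show "i = j" using mono[of i j] mono[of j i] by (cases i j rule: linorder_cases) auto
    qed
    have X_eq: "X = set (map (\<lambda>j. r (k j)) [0..<n])" by (auto simp: X_def)
    have "sorted_list_of_set X = map (\<lambda>j. r (k j)) [0..<n]" unfolding X_eq
    proof (rule sorted_list_of_set.idem_if_sorted_distinct)
      show "sorted (map (\<lambda>j. r (k j)) [0..<n])"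
        by (auto simp: sorted_iff_nth_mono_less intro!: less_imp_le mono)
      show "distinct (map (\<lambda>j. r (k j)) [0..<n])"
        using inj by (auto simp: distinct_map intro: inj_on_subset)
    qed
    then have "g (\<lambda>j. sorted_list_of_set X ! j) = g (\<lambda>j. r (k j))"
      unfolding g_def by (intro arg_cong[of _ _ norm] sum.cong) auto
    moreover have "f X = t"
    proof (rule t)
      show "X \<subseteq> Y" using Y by (auto simp: X_def r_def enumerate_in_set)
      show "finite X" "card X = n" using inj by (auto simp: X_def card_image)
    qed
    ultimately show ?thesis by (simp add: f_def)
  qed
  show ?thesis
  proof (rule that[OF r], unfold norm_stable_def, intro allI impI)
    fix k l :: "nat \<Rightarrow> nat" assume k: "strict_mono_on {..<n} k" and l: "strict_mono_on {..<n} l"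
    have nn: "0 \<le> g (\<lambda>j. r (k j)) / e" "0 \<le> g (\<lambda>j. r (l j)) / e" using e by (auto simp: g_def)
    have "nat \<lfloor>g (\<lambda>j. r (k j)) / e\<rfloor> = nat \<lfloor>g (\<lambda>j. r (l j)) / e\<rfloor>" using val[OF k] val[OF l] by simp
    then have "\<lfloor>g (\<lambda>j. r (k j)) / e\<rfloor> = \<lfloor>g (\<lambda>j. r (l j)) / e\<rfloor>" using nn by (simp add: nat_eq_iff2)
    then have "\<bar>g (\<lambda>j. r (k j)) / e - g (\<lambda>j. r (l j)) / e\<bar> \<le> 1" by linarith
    then have "\<bar>(g (\<lambda>j. r (k j)) - g (\<lambda>j. r (l j))) / e\<bar> \<le> 1" by (simp add: diff_divide_distrib)
    then show "\<bar>norm (\<Sum>j<n. a j *\<^sub>R (x \<circ> r) (k j)) - norm (\<Sum>j<n. a j *\<^sub>R (x \<circ> r) (l j))\<bar> \<le> e"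
      using e by (simp add: g_def)
  qed
qed

lemma ramsey_norm_subsequence_finite:
  fixes x :: "nat \<Rightarrow> 'a::real_normed_vector" and n :: nat
  assumes x: "\<And>i. norm (x i) \<le> 1" and A: "finite A" "\<And>a j. a \<in> A \<Longrightarrow> \<bar>a j\<bar> \<le> 1" and e: "e > 0"
  shows "\<exists>r :: nat \<Rightarrow> nat. strict_mono r \<and> (\<forall>a\<in>A. norm_stable (x \<circ> r) n a e)"
  using A
proof (induction A rule: finite_induct)
  case empty
  then show ?case using strict_mono_id by auto
next
  case (insert a A)
  then obtain r where r: "strict_mono r" and rA: "\<And>a. a \<in> A \<Longrightarrow> norm_stable (x \<circ> r) n a e"
    by (metis insertI2)
  obtain s where s: "strict_mono s" and sa: "norm_stable ((x \<circ> r) \<circ> s) n a e"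
    by (rule ramsey_norm_subsequence[of "x \<circ> r" a e n]) (use x insert.prems e in auto)
  have "norm_stable (x \<circ> (r \<circ> s)) n b e" if "b \<in> insert a A" for b
    using sa norm_stable_subseq[OF rA s, of b] that by (auto simp: comp_assoc)
  then show ?case using strict_mono_o[OF r s] by blast
qed

text \<open>Ramsey handles finitely many coefficient vectors at a time, so a grid of mesh
  \<open>1 / q\<close> in the cube is stabilised to within \<open>e / 3\<close>. Rounding to the
  grid costs at most \<open>n / q \<le> e / 3\<close> at either index choice.\<close>

lemma stable_norm_subsequence:
  fixes x :: "nat \<Rightarrow> 'a::real_normed_vector" and n :: nat
  assumes x: "\<And>i. norm (x i) \<le> 1" and e: "e > 0"
  obtains r :: "nat \<Rightarrow> nat" where "strict_mono r"
    "\<And>a. (\<And>j. j < n \<Longrightarrow> \<bar>a j\<bar> \<le> 1) \<Longrightarrow> norm_stable (x \<circ> r) n a e"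
proof -
  obtain q :: nat where q: "real q > 3 * (real n + 1) / e" using reals_Archimedean2 by blast
  have "3 * (real n + 1) / e > 0" using e by (intro divide_pos_pos) auto
  then have q0: "0 < real q" using q by linarith
  have nq: "n / q \<le> e / 3" using q e q0 by (simp add: field_simps)
  define A where "A = (\<lambda>g j. if j < n then real_of_int (g j) / q else 0) ` ({..<n} \<rightarrow>\<^sub>E {- int q..int q})"
  have fin: "finite A" unfolding A_def by (intro finite_imageI finite_PiE) auto
  have A1: "\<bar>a j\<bar> \<le> 1" if "a \<in> A" for a j
  proof -
    obtain g where g: "a = (\<lambda>j. if j < n then real_of_int (g j) / q else 0)" "g \<in> {..<n} \<rightarrow>\<^sub>E {- int q..int q}"
      using \<open>a \<in> A\<close> unfolding A_def by blast
    show ?thesis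
    proof (cases "j < n")
      case True
      then have "g j \<in> {- int q..int q}" using g(2) by (auto simp: PiE_def)
      then have "\<bar>real_of_int (g j)\<bar> \<le> q" by (simp add: abs_le_iff)
      then show ?thesis using True q0 g(1) by simp
    qed (simp add: g(1))
  qed
  obtain r where r: "strict_mono r" and rA: "\<And>a. a \<in> A \<Longrightarrow> norm_stable (x \<circ> r) n a (e / 3)"
    using ramsey_norm_subsequence_finite[of x A "e/3" n] x fin A1 e by auto
  show ?thesis
  proof (rule that[OF r])
    fix a :: "nat \<Rightarrow> real" assume a: "\<And>j. j < n \<Longrightarrow> \<bar>a j\<bar> \<le> 1"
    define g where "g = restrict (\<lambda>j. \<lfloor>a j * q\<rfloor>) {..<n}"
    define b where "b = (\<lambda>j. if j < n then real_of_int (g j) / q else 0)"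
    have "g \<in> {..<n} \<rightarrow>\<^sub>E {- int q..int q}"
    proof -
      have "- int q \<le> \<lfloor>a j * q\<rfloor> \<and> \<lfloor>a j * q\<rfloor> \<le> int q" if "j < n" for j
      proof -
        have "-1 * real q \<le> a j * q" "a j * q \<le> 1 * real q"
          using a[OF that] by (intro mult_right_mono; simp add: abs_le_iff)+
        then show ?thesis by (auto simp: le_floor_iff floor_le_iff)
      qed
      then show ?thesis by (auto simp: g_def)
    qed
    then have bA: "b \<in> A" unfolding A_def b_def by blast
    have ab: "\<bar>a j - b j\<bar> \<le> 1 / q" if "j < n" for j
    proof -
      have "\<bar>a j * q - \<lfloor>a j * q\<rfloor>\<bar> \<le> 1" by linarith
      then have "\<bar>(a j * q - \<lfloor>a j * q\<rfloor>) / q\<bar> \<le> 1 / q" using q0 by (simp add: divide_right_mono)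
      then show ?thesis using that q0 by (simp add: b_def g_def diff_divide_distrib)
    qed
    have close: "\<bar>norm (\<Sum>j<n. a j *\<^sub>R x (r (k j))) - norm (\<Sum>j<n. b j *\<^sub>R x (r (k j)))\<bar> \<le> e / 3" for k
    proof -
      have "\<bar>norm (\<Sum>j<n. a j *\<^sub>R x (r (k j))) - norm (\<Sum>j<n. b j *\<^sub>R x (r (k j)))\<bar>
        \<le> norm ((\<Sum>j<n. a j *\<^sub>R x (r (k j))) - (\<Sum>j<n. b j *\<^sub>R x (r (k j))))" by (rule norm_triangle_ineq3)
      also have "(\<Sum>j<n. a j *\<^sub>R x (r (k j))) - (\<Sum>j<n. b j *\<^sub>R x (r (k j))) = (\<Sum>j<n. (a j - b j) *\<^sub>R x (r (k j)))"
        by (simp add: sum_subtractf scaleR_diff_left)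
      also have "norm \<dots> \<le> (\<Sum>j<n. 1 / q)"
      proof (rule sum_norm_le)
        fix j assume "j \<in> {..<n}"
        then have "\<bar>a j - b j\<bar> * norm (x (r (k j))) \<le> 1 / q * 1"
          using q0 by (intro mult_mono ab x) auto
        then show "norm ((a j - b j) *\<^sub>R x (r (k j))) \<le> 1 / q" by simp
      qed
      finally have "\<bar>norm (\<Sum>j<n. a j *\<^sub>R x (r (k j))) - norm (\<Sum>j<n. b j *\<^sub>R x (r (k j)))\<bar> \<le> n / q" by simp
      then show ?thesis using nq by linarith
    qed
    show "norm_stable (x \<circ> r) n a e"
      unfolding norm_stable_def
    proof (intro allI impI)
      fix k l :: "nat \<Rightarrow> nat"
      assume "strict_mono_on {..<n} k" "strict_mono_on {..<n} l"
      then have "\<bar>norm (\<Sum>j<n. b j *\<^sub>R x (r (k j))) - norm (\<Sum>j<n. b j *\<^sub>R x (r (l j)))\<bar> \<le> e / 3"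
        using rA[OF bA] unfolding norm_stable_def comp_def by blast
      then show "\<bar>norm (\<Sum>j<n. a j *\<^sub>R (x \<circ> r) (k j)) - norm (\<Sum>j<n. a j *\<^sub>R (x \<circ> r) (l j))\<bar> \<le> e"
        using close[of k] close[of l] unfolding comp_def by linarith
    qed
  qed
qed

text \<open>Diagonalising over \<open>n\<close> with accuracy \<open>1 / (n + 1)\<close> controls
  norms up to an additive error only. The coefficient bound \<open>low\<close> compares this error
  with the norm itself and so yields the multiplicative form of the definition.\<close>

theorem brunel_sucheston:
  fixes x :: "nat \<Rightarrow> 'a::real_normed_vector"
  assumes x: "\<And>i. norm (x i) \<le> 1" and \<delta>: "\<delta> > 0"
    and low: "\<And>(n::nat) a k i. strict_mono_on {..<n} k \<Longrightarrow> i < n \<Longrightarrow> \<delta> * \<bar>a i\<bar> \<le> norm (\<Sum>j<n. a j *\<^sub>R x (k j))"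
  obtains \<phi> S where "strict_mono \<phi>" "generates_sm norm (x \<circ> \<phi>) S"
proof -
  define P where "P n s \<longleftrightarrow> (\<forall>a. (\<forall>j<n. \<bar>a j\<bar> \<le> 1) \<longrightarrow> norm_stable (x \<circ> s) n a (1 / (real n + 1)))"
    for n and s :: "nat \<Rightarrow> nat"
  interpret subseqs P
  proof
    fix n and s :: "nat \<Rightarrow> nat"
    obtain r where "strict_mono r"
      "\<And>a. (\<And>j. j < n \<Longrightarrow> \<bar>a j\<bar> \<le> 1) \<Longrightarrow> norm_stable ((x \<circ> s) \<circ> r) n a (1 / (real n + 1))"
      using stable_norm_subsequence[of "x \<circ> s" "1 / (real n + 1)" n] x by auto
    then show "\<exists>r. strict_mono r \<and> P n (s \<circ> r)" unfolding P_def by (auto simp: comp_assoc)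
  qed
  have stable: "P n (s \<circ> r)" if "strict_mono r" "P n s" for n r s
    using that norm_stable_subseq[of "x \<circ> s"] unfolding P_def by (simp add: comp_assoc)
  \<comment> \<open>The shift by one matches \<open>diagseq_holds\<close>, which controls the
    diagonal sequence from \<open>Suc n\<close> on: after it, stage \<open>n\<close> governs exactly
    the indices \<open>\<ge> n\<close>.\<close>
  define \<phi> where "\<phi> t = diagseq (Suc t)" for t
  have phi: "strict_mono \<phi>" using subseq_diagseq by (simp add: \<phi>_def strict_mono_def)
  define z where "z = x \<circ> \<phi>"
  have key1: "\<bar>norm (\<Sum>j<n. a j *\<^sub>R z (k j)) - norm (\<Sum>j<n. a j *\<^sub>R z (l j))\<bar> \<le> 1 / (real n + 1)"
    if a: "\<And>j. j < n \<Longrightarrow> \<bar>a j\<bar> \<le> 1" and k: "strict_mono_on {..<n} k" and l: "strict_mono_on {..<n} l"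
      and kn: "\<And>j. j < n \<Longrightarrow> n \<le> k j" and ln: "\<And>j. j < n \<Longrightarrow> n \<le> l j" for n a k l
  proof -
    have P: "P n (diagseq \<circ> ((+) (Suc n)))" by (rule diagseq_holds) (rule stable)
    have eq: "z m = x ((diagseq \<circ> ((+) (Suc n))) (m - n))" if "n \<le> m" for m
      using that by (simp add: z_def \<phi>_def)
    have "strict_mono_on {..<n} (\<lambda>j. k j - n)" "strict_mono_on {..<n} (\<lambda>j. l j - n)"
      using k l kn ln by (auto simp: strict_mono_on_def intro!: diff_less_mono)
    then have "\<bar>norm (\<Sum>j<n. a j *\<^sub>R x ((diagseq \<circ> ((+) (Suc n))) (k j - n))) -
        norm (\<Sum>j<n. a j *\<^sub>R x ((diagseq \<circ> ((+) (Suc n))) (l j - n)))\<bar> \<le> 1 / (real n + 1)"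
      using P a unfolding P_def norm_stable_def by (simp add: comp_def)
    moreover have "(\<Sum>j<n. a j *\<^sub>R z (k j)) = (\<Sum>j<n. a j *\<^sub>R x ((diagseq \<circ> ((+) (Suc n))) (k j - n)))"
      by (intro sum.cong refl arg_cong[of _ _ "scaleR _"] eq kn) simp
    moreover have "(\<Sum>j<n. a j *\<^sub>R z (l j)) = (\<Sum>j<n. a j *\<^sub>R x ((diagseq \<circ> ((+) (Suc n))) (l j - n)))"
      by (intro sum.cong refl arg_cong[of _ _ "scaleR _"] eq ln) simp
    ultimately show ?thesis by simp
  qed
  \<comment> \<open>By homogeneity the error is proportional to the size \<open>s\<close> of the
    coefficients; without this it could not be absorbed into a factor
    \<open>1 + \<epsilon> n\<close>.\<close>
  have key: "\<bar>norm (\<Sum>j<n. a j *\<^sub>R z (k j)) - norm (\<Sum>j<n. a j *\<^sub>R z (l j))\<bar> \<le> s / (real n + 1)"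
    if s: "s > 0" and a: "\<And>j. j < n \<Longrightarrow> \<bar>a j\<bar> \<le> s" and k: "strict_mono_on {..<n} k" and l: "strict_mono_on {..<n} l"
      and kn: "\<And>j. j < n \<Longrightarrow> n \<le> k j" and ln: "\<And>j. j < n \<Longrightarrow> n \<le> l j" for n a k l s
  proof -
    have sc: "norm (\<Sum>j<n. a j *\<^sub>R z (k j)) = s * norm (\<Sum>j<n. (a j / s) *\<^sub>R z (k j))" for k
    proof -
      have "(\<Sum>j<n. a j *\<^sub>R z (k j)) = s *\<^sub>R (\<Sum>j<n. (a j / s) *\<^sub>R z (k j))"
        using s by (simp add: scaleR_sum_right)
      then show ?thesis using s by simp
    qed
    have "\<bar>norm (\<Sum>j<n. (a j / s) *\<^sub>R z (k j)) - norm (\<Sum>j<n. (a j / s) *\<^sub>R z (l j))\<bar> \<le> 1 / (real n + 1)"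
      by (rule key1) (use s a k l kn ln in auto)
    then have "s * \<bar>norm (\<Sum>j<n. (a j / s) *\<^sub>R z (k j)) - norm (\<Sum>j<n. (a j / s) *\<^sub>R z (l j))\<bar> \<le> s * (1 / (real n + 1))"
      using s by (intro mult_left_mono) auto
    then show ?thesis unfolding sc[of k] sc[of l] using s by (simp add: abs_mult right_diff_distrib[symmetric])
  qed
  define F where "F m a t = norm (\<Sum>j<m. a j *\<^sub>R z (t + j))" for m a t
  have conv: "convergent (F m a)" for m a
  proof -
    define s where "s = 1 + (\<Sum>j<m. \<bar>a j\<bar>)"
    have s: "s > 0" unfolding s_def by (simp add: add_pos_nonneg sum_nonneg)
    have as: "\<bar>a j\<bar> \<le> s" if "j < m" for j
    proof -
      have "\<bar>a j\<bar> \<le> (\<Sum>j<m. \<bar>a j\<bar>)" using that by (intro member_le_sum) auto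
      then show ?thesis by (simp add: s_def)
    qed
    have pad: "\<bar>F m a t - F m a u\<bar> \<le> s / (real n + 1)" if "n \<ge> m" "t \<ge> n" "u \<ge> n" for n t u
    proof -
      have F_eq: "F m a t = norm (\<Sum>j<n. (if j < m then a j else 0) *\<^sub>R z (t + j))" for t
        unfolding F_def by (rule arg_cong[of _ _ norm], rule sum.mono_neutral_cong_left) (use that in auto)
      show ?thesis unfolding F_eq
        by (rule key) (use s as that in \<open>auto simp: strict_mono_on_def\<close>)
    qed
    have "Cauchy (F m a)"
    proof (rule metric_CauchyI)
      fix e :: real assume e: "e > 0"
      obtain n0 :: nat where n0: "real n0 > s / e" using reals_Archimedean2 by blast
      define n where "n = max m n0"
      have "s / e < real n + 1" using n0 by (simp add: n_def)
      then have "s / (real n + 1) < e" using e by (simp add: field_simps)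
      then show "\<exists>M. \<forall>t\<ge>M. \<forall>u\<ge>M. dist (F m a t) (F m a u) < e"
        using pad[of n] by (intro exI[of _ n]) (force simp: dist_real_def n_def)
    qed
    then show ?thesis by (simp add: Cauchy_convergent_iff)
  qed
  \<comment> \<open>Summing over the support makes the value independent of a cutoff;
    \<open>FS\<close> reintroduces any admissible cutoff \<open>m\<close>.\<close>
  define S where "S a = lim (\<lambda>t. norm (\<Sum>j\<in>{j. a j \<noteq> 0}. a j *\<^sub>R z (t + j)))" for a
  have FS: "F m a \<longlonglongrightarrow> S a" if "\<And>j. j \<ge> m \<Longrightarrow> a j = 0" for m a
  proof -
    have "(\<Sum>j<m. a j *\<^sub>R z (t + j)) = (\<Sum>j\<in>{j. a j \<noteq> 0}. a j *\<^sub>R z (t + j))" for t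
      by (rule sum.mono_neutral_right) (use that in \<open>auto simp: not_less[symmetric]\<close>)
    then have "F m a = (\<lambda>t. norm (\<Sum>j\<in>{j. a j \<noteq> 0}. a j *\<^sub>R z (t + j)))" by (simp add: F_def fun_eq_iff)
    then show ?thesis using conv[of m a] by (simp add: S_def convergent_LIMSEQ_iff)
  qed
  have semi: "c00_seminorm S"
    unfolding c00_seminorm_def
  proof (intro conjI allI impI)
    fix a b assume ab: "finsupp a \<and> finsupp b"
    then obtain m1 m2 where m12: "\<forall>i\<ge>m1. a i = 0" "\<forall>i\<ge>m2. b i = 0" using finsupp_bounded by blast
    define m where "m = max m1 m2"
    have la: "F m a \<longlonglongrightarrow> S a" and lb: "F m b \<longlonglongrightarrow> S b"
      and lab: "F m (\<lambda>i. a i + b i) \<longlonglongrightarrow> S (\<lambda>i. a i + b i)"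
      using m12 by (auto intro!: FS simp: m_def)
    show "S (\<lambda>i. a i + b i) \<le> S a + S b"
    proof (rule LIMSEQ_le[OF lab tendsto_add[OF la lb]])
      show "\<exists>N. \<forall>n\<ge>N. F m (\<lambda>i. a i + b i) n \<le> F m a n + F m b n"
        unfolding F_def by (simp add: scaleR_add_left sum.distrib norm_triangle_ineq)
    qed
  next
    fix a c assume "finsupp a"
    then obtain m where m: "\<forall>i\<ge>m. a i = 0" using finsupp_bounded by blast
    have la: "F m a \<longlonglongrightarrow> S a" and lc: "F m (\<lambda>i. c * a i) \<longlonglongrightarrow> S (\<lambda>i. c * a i)"
      using m by (auto intro!: FS)
    have "F m (\<lambda>i. c * a i) t = \<bar>c\<bar> * F m a t" for t
    proof -
      have "(\<Sum>j<m. (c * a j) *\<^sub>R z (t + j)) = c *\<^sub>R (\<Sum>j<m. a j *\<^sub>R z (t + j))"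
        by (simp add: scaleR_sum_right)
      then show ?thesis by (simp add: F_def)
    qed
    then have "F m (\<lambda>i. c * a i) = (\<lambda>t. \<bar>c\<bar> * F m a t)" by blast
    then have "F m (\<lambda>i. c * a i) \<longlonglongrightarrow> \<bar>c\<bar> * S a" using tendsto_mult_left[OF la] by simp
    then show "S (\<lambda>i. c * a i) = \<bar>c\<bar> * S a" using LIMSEQ_unique lc by blast
  qed
  \<comment> \<open>The quotient of the additive error \<open>s / (n + 1)\<close> and the lower
    bound \<open>\<delta> * s\<close> for the norm, where \<open>s\<close> is the largest
    coefficient in modulus.\<close>
  define \<epsilon> where "\<epsilon> n = 1 / (\<delta> * (real n + 1))" for n
  have eps_pos: "\<epsilon> n > 0" for n using \<delta> by (simp add: \<epsilon>_def)
  have "decseq \<epsilon>" unfolding decseq_def \<epsilon>_def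
    using \<delta> by (auto intro!: divide_left_mono mult_left_mono)
  moreover have "\<epsilon> \<longlonglongrightarrow> 0"
  proof -
    have "(\<lambda>n. inverse \<delta> * (1 / (real n + 1))) \<longlonglongrightarrow> inverse \<delta> * 0"
      using LIMSEQ_inverse_real_of_nat by (intro tendsto_intros) (simp add: divide_inverse add.commute)
    then show ?thesis using \<delta> by (simp add: \<epsilon>_def[abs_def] divide_inverse mult.commute)
  qed
  moreover have "inverse (1 + \<epsilon> n) * S (\<lambda>i. if i < n then a i else 0) \<le> norm (\<Sum>i<n. a i *\<^sub>R z (k i)) \<and>
      norm (\<Sum>i<n. a i *\<^sub>R z (k i)) \<le> (1 + \<epsilon> n) * S (\<lambda>i. if i < n then a i else 0)"
    if a1: "\<forall>i<n. \<bar>a i\<bar> \<le> 1" and kmono: "\<forall>i j. i < j \<and> j < n \<longrightarrow> k i < k j" and k0: "n \<le> k 0" for n a k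
  proof -
    define b where "b = (\<lambda>i. if i < n then a i else 0)"
    define G where "G = norm (\<Sum>i<n. a i *\<^sub>R z (k i))"
    have k: "strict_mono_on {..<n} k" using kmono by (auto simp: strict_mono_on_def)
    have kn: "n \<le> k j" if "j < n" for j
    proof (cases "j = 0")
      case False
      then have "k 0 < k j" using kmono that by blast
      then show ?thesis using k0 by simp
    qed (use k0 in simp)
    have Fb: "F n b \<longlonglongrightarrow> S b" by (rule FS) (simp add: b_def)
    have Fb_eq: "F n b t = norm (\<Sum>j<n. a j *\<^sub>R z (t + j))" for t by (simp add: F_def b_def)
    have low': "\<delta> * \<bar>a i\<bar> \<le> norm (\<Sum>j<n. a j *\<^sub>R z (l j))" if "strict_mono_on {..<n} l" "i < n" for l i
    proof -
      have "strict_mono_on {..<n} (\<lambda>j. \<phi> (l j))" using that phi by (auto simp: strict_mono_on_def strict_mono_def)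
      then show ?thesis using low[of n "\<lambda>j. \<phi> (l j)" i a] that by (simp add: z_def)
    qed
    show ?thesis
    proof (cases "\<exists>i<n. a i \<noteq> 0")
      case False
      then have "b = (\<lambda>i. 0 * a i)" and "G = 0" by (auto simp: b_def G_def)
      moreover have "S (\<lambda>i. 0 * b i) = \<bar>0\<bar> * S b" using semi unfolding c00_seminorm_def b_def by (metis finsupp_truncate)
      ultimately show ?thesis by (simp add: b_def G_def)
    next
      case True
      define s where "s = Max ((\<lambda>i. \<bar>a i\<bar>) ` {..<n})"
      have ne: "(\<lambda>i. \<bar>a i\<bar>) ` {..<n} \<noteq> {}" using True by auto
      have as: "\<bar>a i\<bar> \<le> s" if "i < n" for i unfolding s_def using that by (intro Max_ge) auto
      obtain i0 where i0: "i0 < n" "s = \<bar>a i0\<bar>" using Max_in[OF _ ne] unfolding s_def by auto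
      have s: "s > 0" using True as by (metis abs_le_zero_iff less_eq_real_def not_le order_trans zero_less_abs_iff)
      have dG: "\<delta> * s \<le> G" unfolding G_def i0(2) by (rule low'[OF k i0(1)])
      have tm: "strict_mono_on {..<n} (\<lambda>j. t + j)" for t :: nat by (auto simp: strict_mono_on_def)
      have dS: "\<delta> * s \<le> S b"
      proof (rule LIMSEQ_le_const[OF Fb])
        show "\<exists>N. \<forall>t\<ge>N. \<delta> * s \<le> F n b t" unfolding Fb_eq i0(2) using low'[OF tm i0(1)] by blast
      qed
      have "\<bar>G - S b\<bar> \<le> s / (real n + 1)"
      proof (rule LIMSEQ_le_const2)
        show "(\<lambda>t. \<bar>G - F n b t\<bar>) \<longlonglongrightarrow> \<bar>G - S b\<bar>" by (intro tendsto_intros Fb)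
        show "\<exists>N. \<forall>t\<ge>N. \<bar>G - F n b t\<bar> \<le> s / (real n + 1)"
          unfolding Fb_eq G_def
          by (intro exI[of _ n] allI impI key s as k kn tm) auto
      qed
      also have "s / (real n + 1) = \<epsilon> n * (\<delta> * s)" using \<delta> by (simp add: \<epsilon>_def)
      finally have close: "\<bar>G - S b\<bar> \<le> \<epsilon> n * (\<delta> * s)" .
      have "\<epsilon> n * (\<delta> * s) \<le> \<epsilon> n * G" "\<epsilon> n * (\<delta> * s) \<le> \<epsilon> n * S b"
        using eps_pos[of n] dG dS by (auto intro!: mult_left_mono)
      then have "S b \<le> (1 + \<epsilon> n) * G" "G \<le> (1 + \<epsilon> n) * S b" using close by (auto simp: algebra_simps)
      moreover have "inverse (1 + \<epsilon> n) * S b \<le> G"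
        using \<open>S b \<le> (1 + \<epsilon> n) * G\<close> eps_pos[of n] by (simp add: field_simps)
      ultimately show ?thesis by (simp add: b_def G_def)
    qed
  qed
  ultimately have "generates_sm norm z S" unfolding generates_sm_def using semi by blast
  then show ?thesis using that phi by (simp add: z_def)
qed

section \<open>Basic subsequences of weakly null sequences\<close>

interpretation UN: normed_carrier "UNIV :: 'a::real_normed_vector set" norm
  by unfold_locales (auto simp: normed_on_def norm_triangle_ineq)

lemma norming_functional:
  fixes e :: "'a::real_normed_vector"
  obtains f where "f \<in> dual UNIV norm" "linear f" "\<And>x. \<bar>f x\<bar> \<le> norm x" "f e = norm e"
proof -
  obtain f where f: "linear f" "\<And>x. \<bar>f x\<bar> \<le> norm x" "f e = norm e"
    by (rule seminorm_support_functional[of norm e]) (auto simp: norm_triangle_ineq)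
  have "f \<in> dual UNIV norm"
    unfolding dual_def using f(1,2) by (auto simp: linear_add linear_cmul intro!: exI[of _ 1])
  then show ?thesis using f that by blast
qed

lemma weakly_null_subseq:
  "weakly_null V N x \<Longrightarrow> strict_mono r \<Longrightarrow> weakly_null V N (x \<circ> r)"
  unfolding weakly_null_def by (auto intro: LIMSEQ_subseq_LIMSEQ[unfolded comp_def])

text \<open>Compactness argument. Counterexamples for arbitrarily large \<open>k\<close> have, after
  normalization, bounded coefficients, so a subsequence converges to some \<open>E l\<close> of norm
  1. A functional norming \<open>E l\<close> does not see \<open>w\<close> in the limit, hence tends
  to 1 on vectors of norm below \<open>inverse (1 + \<eta>)\<close>.\<close>

lemma mazur_step:
  fixes z w :: "nat \<Rightarrow> 'a::real_normed_vector"
  assumes w: "weakly_null UNIV norm w" "\<And>k. norm (w k) = 1"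
    and co: "\<And>a i. i < n \<Longrightarrow> \<bar>a i\<bar> \<le> C * norm (\<Sum>i<n. a i *\<^sub>R z i)" and \<eta>: "\<eta> > 0"
  shows "\<exists>K. \<forall>k\<ge>K. \<forall>a b. norm (\<Sum>i<n. a i *\<^sub>R z i) \<le> (1 + \<eta>) * norm ((\<Sum>i<n. a i *\<^sub>R z i) + b *\<^sub>R w k)"
proof (rule ccontr)
  define E where "E a = (\<Sum>i<n. a i *\<^sub>R z i)" for a
  have scale: "E (\<lambda>i. c * a i) = c *\<^sub>R E a" for c a unfolding E_def by (simp add: scaleR_sum_right)
  assume "\<not> ?thesis"
  then have bad: "\<exists>k\<ge>K. \<exists>a b. (1 + \<eta>) * norm (E a + b *\<^sub>R w k) < norm (E a)" for K
    unfolding E_def by (auto simp: not_le)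
  have "\<exists>k\<ge>K. \<exists>a b. (1 + \<eta>) * norm (E a + b *\<^sub>R w k) < 1 \<and> norm (E a) = 1" for K
  proof -
    obtain k a b where k: "k \<ge> K" and lt: "(1 + \<eta>) * norm (E a + b *\<^sub>R w k) < norm (E a)" using bad by blast
    have "0 \<le> (1 + \<eta>) * norm (E a + b *\<^sub>R w k)" using \<eta> by simp
    then have pos: "norm (E a) > 0" using lt by linarith
    define c where "c = inverse (norm (E a))"
    have c: "c > 0" "c * norm (E a) = 1" using pos by (auto simp: c_def)
    have "E (\<lambda>i. c * a i) + (c * b) *\<^sub>R w k = c *\<^sub>R (E a + b *\<^sub>R w k)"
      by (simp add: scale scaleR_add_right)
    then have "(1 + \<eta>) * norm (E (\<lambda>i. c * a i) + (c * b) *\<^sub>R w k) = c * ((1 + \<eta>) * norm (E a + b *\<^sub>R w k))"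
      using c by simp
    also have "\<dots> < c * norm (E a)" using lt c by (intro mult_strict_left_mono)
    finally have "(1 + \<eta>) * norm (E (\<lambda>i. c * a i) + (c * b) *\<^sub>R w k) < 1" using c by simp
    moreover have "norm (E (\<lambda>i. c * a i)) = 1" using c by (simp add: scale)
    ultimately show ?thesis using k by blast
  qed
  then obtain k a b where k: "\<And>K. k K \<ge> K"
    and lt: "\<And>K. (1 + \<eta>) * norm (E (a K) + b K *\<^sub>R w (k K)) < 1" and one: "\<And>K. norm (E (a K)) = 1"
    by metis
  have small: "norm (E (a K) + b K *\<^sub>R w (k K)) < inverse (1 + \<eta>)" for K
    using lt[of K] \<eta> by (simp add: field_simps)
  have inv: "inverse (1 + \<eta>) < 1" using \<eta> by (simp add: field_simps)
  have b2: "\<bar>b K\<bar> \<le> 2" for K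
  proof -
    have "\<bar>b K\<bar> = norm (b K *\<^sub>R w (k K))" by (simp add: w)
    also have "\<dots> \<le> norm (E (a K) + b K *\<^sub>R w (k K)) + norm (E (a K))"
      using norm_triangle_ineq4[of "E (a K) + b K *\<^sub>R w (k K)" "E (a K)"] by simp
    finally show ?thesis using small[of K] inv one[of K] by linarith
  qed
  \<comment> \<open>The coefficients and the scalar \<open>b K\<close> are packed into one sequence,
    with \<open>b K\<close> from index \<open>n\<close> on, so that a single extraction makes all of
    them converge.\<close>
  define g where "g K i = (if i < n then a K i else b K)" for K i
  have g_bound: "norm (g K i) \<le> max C 2" for K i
    using co[of i "a K"] one[of K] b2[of K] by (auto simp: g_def E_def)
  obtain r where r: "strict_mono r" "\<And>i. i \<in> UNIV \<Longrightarrow> \<exists>l. (\<lambda>K. g (r K) i) \<longlonglongrightarrow> l"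
    by (rule function_convergent_subsequence[of "UNIV::nat set" g "max C 2"]) (use g_bound in auto)
  have "\<forall>i. \<exists>l. (\<lambda>K. g (r K) i) \<longlonglongrightarrow> l" using r(2) by simp
  then obtain l where l: "\<And>i. (\<lambda>K. g (r K) i) \<longlonglongrightarrow> l i" by metis
  have la: "(\<lambda>K. a (r K) i) \<longlonglongrightarrow> l i" if "i < n" for i using l[of i] that by (simp add: g_def)
  have lb: "(\<lambda>K. b (r K)) \<longlonglongrightarrow> l n" using l[of n] by (simp add: g_def)
  have lE: "(\<lambda>K. E (a (r K))) \<longlonglongrightarrow> E l" unfolding E_def by (intro tendsto_intros la) simp
  have "(\<lambda>K. norm (E (a (r K)))) \<longlonglongrightarrow> norm (E l)" by (intro tendsto_intros lE)
  then have E1: "norm (E l) = 1" by (simp add: one LIMSEQ_const_iff)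
  obtain f where f: "f \<in> dual UNIV norm" "linear f" "\<And>x. \<bar>f x\<bar> \<le> norm x" "f (E l) = norm (E l)"
    using norming_functional by blast
  have "(\<lambda>K. f (w (k (r K)))) \<longlonglongrightarrow> 0"
  proof -
    have "(\<lambda>j. f (w j)) \<longlonglongrightarrow> 0" using w(1) f(1) by (simp add: weakly_null_def)
    moreover have "filterlim (\<lambda>K. k (r K)) at_top sequentially"
    proof (rule filterlim_at_top_mono[OF filterlim_ident])
      show "\<forall>\<^sub>F K in sequentially. K \<le> k (r K)"
        by (intro always_eventually allI order_trans[OF seq_suble[OF r(1)] k])
    qed
    ultimately show ?thesis by (rule filterlim_compose)
  qed
  then have "(\<lambda>K. f (E l) + (f (E (a (r K)) - E l) + b (r K) * f (w (k (r K))))) \<longlonglongrightarrow> f (E l) + (0 + l n * 0)"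
  proof (intro tendsto_intros lb)
    have "(\<lambda>K. norm (E (a (r K)) - E l)) \<longlonglongrightarrow> 0" using lE by (simp add: LIM_zero_iff tendsto_norm_zero)
    then show "(\<lambda>K. f (E (a (r K)) - E l)) \<longlonglongrightarrow> 0"
      by (rule Lim_null_comparison[rotated]) (simp add: f)
  qed
  then have "(\<lambda>K. f (E (a (r K)) + b (r K) *\<^sub>R w (k (r K)))) \<longlonglongrightarrow> 1"
    using f E1 by (simp add: linear_add linear_diff linear_cmul)
  then have "1 \<le> inverse (1 + \<eta>)"
  proof (rule LIMSEQ_le_const2)
    have "f (E (a (r K)) + b (r K) *\<^sub>R w (k (r K))) \<le> inverse (1 + \<eta>)" for K
      using f(3)[of "E (a (r K)) + b (r K) *\<^sub>R w (k (r K))"] small[of "r K"] by linarith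
    then show "\<exists>N. \<forall>K\<ge>N. f (E (a (r K)) + b (r K) *\<^sub>R w (k (r K))) \<le> inverse (1 + \<eta>)" by blast
  qed
  then show False using inv by simp
qed

theorem mazur_basic_subsequence:
  fixes w :: "nat \<Rightarrow> 'a::real_normed_vector"
  assumes w: "weakly_null UNIV norm w" "\<And>k. norm (w k) = 1"
  obtains \<phi> :: "nat \<Rightarrow> nat" where "strict_mono \<phi>"
    "\<And>m n a. m \<le> n \<Longrightarrow> norm (\<Sum>i<m. a i *\<^sub>R w (\<phi> i)) \<le> 2 * norm (\<Sum>i<n. a i *\<^sub>R w (\<phi> i))"
proof -
  \<comment> \<open>The permitted basis constant of the first \<open>n\<close> vectors: strictly
    increasing, so each step has room for a factor \<open>1 + \<eta>\<close>, yet bounded by the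
    final constant 2.\<close>
  define \<kappa> :: "nat \<Rightarrow> real" where "\<kappa> n = 2 - (1/2)^n" for n
  have kap: "1 \<le> \<kappa> n" "\<kappa> n \<le> 2" "\<kappa> n < \<kappa> (Suc n)" for n
    by (auto simp: \<kappa>_def power_le_one)
  define P where "P n f \<longleftrightarrow> (\<forall>m a. m \<le> n \<longrightarrow> norm (\<Sum>i<m. a i *\<^sub>R w (f i)) \<le> \<kappa> n * norm (\<Sum>i<n. a i *\<^sub>R w (f i)))"
    for n and f :: "nat \<Rightarrow> nat"
  \<comment> \<open>Finite stages are total functions of which only the first \<open>n\<close>
    values matter; \<open>Q\<close> says that the next stage keeps these and appends a larger
    index.\<close>
  define Q where "Q n f g \<longleftrightarrow> (\<forall>i<n. g i = f i) \<and> (\<forall>i<n. f i < g n)" for n and f g :: "nat \<Rightarrow> nat"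
  have "\<exists>F. \<forall>n. P n (F n) \<and> Q n (F n) (F (Suc n))"
  proof (rule dependent_nat_choice)
    show "\<exists>f. P 0 f" by (simp add: P_def)
  next
    fix f n assume P: "P n f"
    have co: "\<bar>a i\<bar> \<le> (2 * \<kappa> n) * norm (\<Sum>i<n. a i *\<^sub>R w (f i))" if "i < n" for a i
    proof -
      have "\<bar>a i\<bar> * norm ((w \<circ> f) i) \<le> 2 * \<kappa> n * norm (\<Sum>i<n. a i *\<^sub>R (w \<circ> f) i)"
        by (rule UN.coefficient_bound[OF _ _ that]) (use P in \<open>simp_all add: P_def\<close>)
      then show ?thesis by (simp add: w(2))
    qed
    define \<eta> where "\<eta> = \<kappa> (Suc n) / \<kappa> n - 1"
    have eta: "\<eta> > 0" "\<kappa> n * (1 + \<eta>) = \<kappa> (Suc n)" using kap[of n] by (auto simp: \<eta>_def field_simps)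
    have "\<exists>K. \<forall>k\<ge>K. \<forall>a b. norm (\<Sum>i<n. a i *\<^sub>R w (f i)) \<le> (1 + \<eta>) * norm ((\<Sum>i<n. a i *\<^sub>R w (f i)) + b *\<^sub>R w k)"
      by (rule mazur_step[OF w co eta(1)])
    then obtain K where K: "\<And>k a b. k \<ge> K \<Longrightarrow> norm (\<Sum>i<n. a i *\<^sub>R w (f i)) \<le> (1 + \<eta>) * norm ((\<Sum>i<n. a i *\<^sub>R w (f i)) + b *\<^sub>R w k)"
      by blast
    define k where "k = K + 1 + (\<Sum>i<n. f i)"
    define g where "g = f(n := k)"
    have fk: "f i < k" if "i < n" for i
    proof -
      have "f i \<le> (\<Sum>i<n. f i)" using that by (intro member_le_sum) auto
      then show ?thesis by (simp add: k_def)
    qed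
    have "P (Suc n) g" unfolding P_def
    proof (intro allI impI)
      fix m a assume m: "m \<le> Suc n"
      show "norm (\<Sum>i<m. a i *\<^sub>R w (g i)) \<le> \<kappa> (Suc n) * norm (\<Sum>i<Suc n. a i *\<^sub>R w (g i))"
      proof (cases "m = Suc n")
        case True
        show ?thesis unfolding True
          using mult_right_mono[OF kap(1)[of "Suc n"], of "norm (\<Sum>i<Suc n. a i *\<^sub>R w (g i))"] by simp
      next
        case False
        then have mn: "m \<le> n" using m by simp
        have eq: "(\<Sum>i<m. a i *\<^sub>R w (g i)) = (\<Sum>i<m. a i *\<^sub>R w (f i))" if "m \<le> n" for m
          using that by (intro sum.cong) (auto simp: g_def)
        have "norm (\<Sum>i<m. a i *\<^sub>R w (f i)) \<le> \<kappa> n * norm (\<Sum>i<n. a i *\<^sub>R w (f i))"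
          using P mn by (simp add: P_def)
        also have "\<dots> \<le> \<kappa> n * ((1 + \<eta>) * norm ((\<Sum>i<n. a i *\<^sub>R w (f i)) + a n *\<^sub>R w k))"
          using kap[of n] by (intro mult_left_mono K) (auto simp: k_def)
        also have "\<dots> = \<kappa> (Suc n) * norm (\<Sum>i<Suc n. a i *\<^sub>R w (g i))"
          using eq[of n] by (simp add: mult.assoc[symmetric] eta(2) g_def)
        finally show ?thesis using eq[OF mn] by simp
      qed
    qed
    moreover have "Q n f g" using fk by (auto simp: Q_def g_def)
    ultimately show "\<exists>g. P (Suc n) g \<and> Q n f g" by blast
  qed
  then obtain F where F: "\<And>n. P n (F n)" "\<And>n. Q n (F n) (F (Suc n))" by blast
  \<comment> \<open>The value at \<open>i\<close> is chosen in the step to stage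
    \<open>Suc i\<close> and never changed afterwards.\<close>
  define \<phi> where "\<phi> i = F (Suc i) i" for i
  have F_eq: "F n i = \<phi> i" if "i < n" for n i
    using that
  proof (induction n)
    case (Suc n)
    then show ?case using F(2)[of n] by (cases "i = n") (auto simp: Q_def \<phi>_def)
  qed simp
  have "strict_mono \<phi>"
    unfolding strict_mono_Suc_iff
  proof
    fix n
    show "\<phi> n < \<phi> (Suc n)" using F(2)[of "Suc n"] by (simp add: Q_def \<phi>_def)
  qed
  moreover have "norm (\<Sum>i<m. a i *\<^sub>R w (\<phi> i)) \<le> 2 * norm (\<Sum>i<n. a i *\<^sub>R w (\<phi> i))" if "m \<le> n" for m n a
  proof -
    have eq: "(\<Sum>i<m. a i *\<^sub>R w (\<phi> i)) = (\<Sum>i<m. a i *\<^sub>R w (F n i))" if "m \<le> n" for m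
      using that by (intro sum.cong) (auto simp: F_eq)
    have "norm (\<Sum>i<m. a i *\<^sub>R w (\<phi> i)) \<le> \<kappa> n * norm (\<Sum>i<n. a i *\<^sub>R w (\<phi> i))"
      using F(1)[of n] that eq[OF that] eq[of n] by (simp add: P_def)
    also have "\<dots> \<le> 2 * norm (\<Sum>i<n. a i *\<^sub>R w (\<phi> i))" using kap(2)[of n] by (intro mult_right_mono) auto
    finally show ?thesis .
  qed
  ultimately show ?thesis using that by blast
qed

text \<open>With the coefficients placed at the positions \<open>k i\<close> and zeros elsewhere,
  partial sums of the subsequence are partial sums of \<open>w\<close>, so the constant is
  inherited. Monotonicity on \<open>{..<n}\<close> suffices, as required for the finite index
  choices in \<open>brunel_sucheston\<close>.\<close>

lemma grunblum_subseq:
  fixes w :: "nat \<Rightarrow> 'a::real_normed_vector" and k :: "nat \<Rightarrow> nat"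
  assumes gr: "\<And>m n a. m \<le> n \<Longrightarrow> norm (\<Sum>i<m. a i *\<^sub>R w i) \<le> K * norm (\<Sum>i<n. a i *\<^sub>R w i)"
    and K: "0 \<le> K" and k: "strict_mono_on {..<n} k" and m: "m \<le> n"
  shows "norm (\<Sum>i<m. a i *\<^sub>R w (k i)) \<le> K * norm (\<Sum>i<n. a i *\<^sub>R w (k i))"
proof (cases "m = 0")
  case False
  have mono: "k i < k j" if "i < j" "j < n" for i j using k that by (auto simp: strict_mono_on_def)
  have mono_le: "k i \<le> k j" if "i \<le> j" "j < n" for i j
    using mono[of i j] that by (cases "i = j") auto
  have inj: "inj_on k {..<n}"
  proof (rule inj_onI)
    fix i j assume "i \<in> {..<n}" "j \<in> {..<n}" "k i = k j"
    then show "i = j" using mono[of i j] mono[of j i] by (cases i j rule: linorder_cases) auto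
  qed
  define b where "b t = (if t \<in> k ` {..<n} then a (the_inv_into {..<n} k t) else 0)" for t
  have bk: "b (k i) = a i" if "i < n" for i using inj that by (simp add: b_def the_inv_into_f_f)
  \<comment> \<open>\<open>Suc (k (l - 1))\<close> is the length of the shortest initial segment of
    \<open>w\<close> containing the first \<open>l\<close> chosen vectors; this is why
    \<open>l = 0\<close> is set apart.\<close>
  have sum_eq: "(\<Sum>t<Suc (k (l - 1)). b t *\<^sub>R w t) = (\<Sum>i<l. a i *\<^sub>R w (k i))" if l: "0 < l" "l \<le> n" for l
  proof -
    have sub: "k ` {..<l} \<subseteq> {..<Suc (k (l - 1))}"
    proof safe
      fix i assume "i < l"
      then have "i \<le> l - 1" "l - 1 < n" using l by auto
      then show "k i < Suc (k (l - 1))" using mono_le by (simp add: less_Suc_eq_le)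
    qed
    have zero: "b t = 0" if t: "t \<in> {..<Suc (k (l - 1))} - k ` {..<l}" for t
    proof (rule ccontr)
      assume "b t \<noteq> 0"
      then obtain i where i: "i < n" "t = k i" by (auto simp: b_def split: if_splits)
      then have "\<not> i < l" using t by auto
      then have "k (l - 1) < k i" using mono[of "l - 1" i] i l by simp
      then show False using t i by simp
    qed
    have "(\<Sum>t<Suc (k (l - 1)). b t *\<^sub>R w t) = (\<Sum>t\<in>k ` {..<l}. b t *\<^sub>R w t)"
      by (rule sum.mono_neutral_right) (use sub zero in auto)
    also have "\<dots> = (\<Sum>i<l. b (k i) *\<^sub>R w (k i))"
      by (rule sum.reindex_cong[OF inj_on_subset[OF inj]]) (use l in auto)
    also have "\<dots> = (\<Sum>i<l. a i *\<^sub>R w (k i))" using bk l by (intro sum.cong) auto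
    finally show ?thesis .
  qed
  have "Suc (k (m - 1)) \<le> Suc (k (n - 1))"
    using mono_le[of "m - 1" "n - 1"] m False by auto
  then have "norm (\<Sum>t<Suc (k (m - 1)). b t *\<^sub>R w t) \<le> K * norm (\<Sum>t<Suc (k (n - 1)). b t *\<^sub>R w t)" by (rule gr)
  then show ?thesis using sum_eq[of m] sum_eq[of n] m False by simp
qed (use K in simp)

theorem weakly_null_spreading_model:
  fixes w :: "nat \<Rightarrow> 'a::real_normed_vector"
  assumes w: "weakly_null UNIV norm w" "\<And>k. norm (w k) = 1"
  obtains \<phi> S where "strict_mono \<phi>" "basic_seq UNIV norm (w \<circ> \<phi>)" "generates_sm norm (w \<circ> \<phi>) S"
proof -
  obtain \<psi> :: "nat \<Rightarrow> nat" where psi: "strict_mono \<psi>"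
    and gr: "\<And>m n a. m \<le> n \<Longrightarrow> norm (\<Sum>i<m. a i *\<^sub>R w (\<psi> i)) \<le> 2 * norm (\<Sum>i<n. a i *\<^sub>R w (\<psi> i))"
    by (rule mazur_basic_subsequence[OF w]) (rule that)
  \<comment> \<open>Basis constant 2 in \<open>coefficient_bound\<close> gives the factor
    \<open>2 * 2\<close>, and the vectors have norm 1; hence 1/4.\<close>
  have low: "1/4 * \<bar>a i\<bar> \<le> norm (\<Sum>j<n. a j *\<^sub>R (w \<circ> \<psi>) (k j))" if "strict_mono_on {..<n} k" "i < n" for n :: nat and a k i
  proof -
    have "\<bar>a i\<bar> * norm ((w \<circ> \<psi> \<circ> k) i) \<le> 2 * 2 * norm (\<Sum>i<n. a i *\<^sub>R (w \<circ> \<psi> \<circ> k) i)"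
    proof (rule UN.coefficient_bound[OF _ _ that(2)])
      fix m and a :: "nat \<Rightarrow> real" assume "m \<le> n"
      then show "norm (\<Sum>i<m. a i *\<^sub>R (w \<circ> \<psi> \<circ> k) i) \<le> 2 * norm (\<Sum>i<n. a i *\<^sub>R (w \<circ> \<psi> \<circ> k) i)"
        using grunblum_subseq[OF gr _ that(1), of m a] by simp
    qed simp
    then show ?thesis by (simp add: w)
  qed
  have one: "norm ((w \<circ> \<psi>) i) \<le> 1" for i by (simp add: w)
  have quarter: "0 < (1/4 :: real)" by simp
  obtain r S where r: "strict_mono r" and S: "generates_sm norm (w \<circ> \<psi> \<circ> r) S"
    proof (rule brunel_sucheston[OF one quarter])
    show "1/4 * \<bar>a i\<bar> \<le> norm (\<Sum>j<n. a j *\<^sub>R (w \<circ> \<psi>) (k j))"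
      if "strict_mono_on {..<n} k" "i < n" for n :: nat and a k i
      using that by (rule low)
  qed (rule that)
  have "basic_seq UNIV norm (w \<circ> (\<psi> \<circ> r))"
  proof (rule UN.grunblum_basic[where K=2])
    fix m n :: nat and a :: "nat \<Rightarrow> real" assume "m \<le> n"
    then show "norm (\<Sum>i<m. a i *\<^sub>R (w \<circ> (\<psi> \<circ> r)) i) \<le> 2 * norm (\<Sum>i<n. a i *\<^sub>R (w \<circ> (\<psi> \<circ> r)) i)"
      using grunblum_subseq[OF gr _ monotone_on_subset[OF r subset_UNIV], of m n a] by simp
  next
    show "(w \<circ> (\<psi> \<circ> r)) i \<noteq> 0" for i using w(2)[of "\<psi> (r i)"] by auto
  qed auto
  then show ?thesis using that[OF strict_mono_o[OF psi r], of S] S by (simp add: comp_assoc)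
qed

section \<open>Countable chains of spreading models\<close>

definition l1 :: "(nat \<Rightarrow> real) \<Rightarrow> real" where
  "l1 a = (\<Sum>i\<in>{i. a i \<noteq> 0}. \<bar>a i\<bar>)"

lemma l1_nonneg: "0 \<le> l1 a" unfolding l1_def by (rule sum_nonneg) simp

lemma l1_eq: "(\<And>i. i \<ge> m \<Longrightarrow> a i = 0) \<Longrightarrow> l1 a = (\<Sum>i<m. \<bar>a i\<bar>)"
  unfolding l1_def by (rule sum.mono_neutral_left) (auto simp: not_less[symmetric])

lemma c00_seminorm_sum:
  assumes "\<And>i. i \<in> I \<Longrightarrow> c00_seminorm (S i)"
  shows "c00_seminorm (\<lambda>a. \<Sum>i\<in>I. S i a)"
  unfolding c00_seminorm_def
proof (intro conjI allI impI)
  fix a b assume "finsupp a \<and> finsupp b"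
  then have "(\<Sum>i\<in>I. S i (\<lambda>j. a j + b j)) \<le> (\<Sum>i\<in>I. S i a + S i b)"
    using assms by (intro sum_mono) (simp add: c00_seminorm_def)
  then show "(\<Sum>i\<in>I. S i (\<lambda>j. a j + b j)) \<le> (\<Sum>i\<in>I. S i a) + (\<Sum>i\<in>I. S i b)"
    by (simp add: sum.distrib)
next
  fix a c assume "finsupp a"
  then have "(\<Sum>i\<in>I. S i (\<lambda>j. c * a j)) = (\<Sum>i\<in>I. \<bar>c\<bar> * S i a)"
    using assms by (intro sum.cong) (auto simp: c00_seminorm_def)
  then show "(\<Sum>i\<in>I. S i (\<lambda>j. c * a j)) = \<bar>c\<bar> * (\<Sum>i\<in>I. S i a)" by (simp add: sum_distrib_left)
qed

lemma dominates_sum: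
  assumes "finite I" "c00_seminorm T" "\<And>i. i \<in> I \<Longrightarrow> dominates T (S i)"
  shows "dominates T (\<lambda>a. \<Sum>i\<in>I. S i a)"
proof -
  have "\<forall>i\<in>I. \<exists>C. \<forall>a. finsupp a \<longrightarrow> S i a \<le> C * T a" using assms(3) by (auto simp: dominates_def)
  then obtain C where C: "\<And>i a. i \<in> I \<Longrightarrow> finsupp a \<Longrightarrow> S i a \<le> C i * T a" by metis
  have "(\<Sum>i\<in>I. S i a) \<le> (\<Sum>i\<in>I. C i) * T a" if "finsupp a" for a
    unfolding sum_distrib_right by (intro sum_mono C that)
  then show ?thesis unfolding dominates_def by blast
qed

text \<open>One threshold for all smaller \<open>t\<close>: the next weight must satisfy several
  such requirements at once, and a minimum of thresholds meets them all.\<close>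

lemma small_perturbation:
  fixes u v k :: real
  assumes "u < v" "0 \<le> k"
  obtains d where "0 < d" "\<And>t. 0 \<le> t \<Longrightarrow> t \<le> d \<Longrightarrow> u + t * k < v"
proof
  show "0 < (v - u) / (k + 1)" using assms by (intro divide_pos_pos) auto
  fix t :: real assume t: "0 \<le> t" "t \<le> (v - u) / (k + 1)"
  have "t * k \<le> (v - u) / (k + 1) * k" using t assms by (intro mult_right_mono) auto
  also have "\<dots> < v - u" using assms by (simp add: field_simps)
  finally show "u + t * k < v" by simp
qed

text \<open>A failure of domination is witnessed at finitely supported vectors, where all terms
  beyond a given index can be made negligible. \<open>T\<close> lists representatives of all
  classes, so that the class of the new model is excluded along with every other upper bound of the
  sequence.\<close>

lemma no_strictly_increasing_spreading_models:
  fixes S T :: "nat \<Rightarrow> (nat \<Rightarrow> real) \<Rightarrow> real"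
  assumes S: "\<And>n. S n \<in> wsm (UNIV::'a::banach set) norm"
    and up: "\<And>n. dominates (S (Suc n)) (S n)" and strict: "\<And>n. \<not> dominates (S n) (S (Suc n))"
    and chain: "\<And>A B. A \<in> wsm (UNIV::'a set) norm \<Longrightarrow> B \<in> wsm (UNIV::'a set) norm \<Longrightarrow>
      dominates A B \<or> dominates B A"
    and T: "\<And>j. T j \<in> wsm (UNIV::'a set) norm"
    and Tall: "\<And>A. A \<in> wsm (UNIV::'a set) norm \<Longrightarrow> \<exists>j. equiv_sm A (T j)"
  shows False
proof -

  \<comment> \<open>Domination gaps along the increasing sequence\<close>
  note semiS = wsm_seminorm[OF S] and semiT = wsm_seminorm[OF T]
  have mono: "dominates (S n) (S m)" if "m \<le> n" for m n
    using that
  proof (induction n rule: dec_induct)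
    case (step n)
    then show ?case using dominates_trans[OF _ up[of n] semiS semiS] by blast
  qed (rule dominates_refl)
  \<comment> \<open>A crude measure for the first \<open>r\<close> terms of the sum; for
    \<open>r > 0\<close> it is equivalent to \<open>S (r - 1)\<close>.\<close>
  define W where "W r a = (\<Sum>m<r. S m a)" for r :: nat and a
  have semiW: "c00_seminorm (W r)" for r unfolding W_def by (rule c00_seminorm_sum) (rule semiS)
  have Wdom: "dominates (S r) (W (Suc r))" for r
    unfolding W_def by (rule dominates_sum) (auto intro: semiS mono)
  have S_le_W: "S n a \<le> W r a" if "finsupp a" "n < r" for n r a
    unfolding W_def using that c00_seminorm_nonneg[OF semiS that(1)] by (intro member_le_sum) auto
  \<comment> \<open>\<open>S (r - 1)\<close> dominates \<open>W r\<close> but not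
    \<open>S r\<close>, so no multiple of \<open>W r\<close> bounds \<open>S r\<close>, whatever
    weight \<open>c\<close> the latter carries.\<close>
  have gapA: "\<exists>a. finsupp a \<and> (real r + 1) * W r a < c * S r a" if "r > 0" "c > 0" for r :: nat and c :: real
  proof (rule ccontr)
    assume "\<not> ?thesis"
    then have "S r a \<le> ((real r + 1) / c) * W r a" if "finsupp a" for a
      using that \<open>c > 0\<close> by (auto simp: field_simps not_less)
    then have "dominates (W r) (S r)" unfolding dominates_def by blast
    moreover have "dominates (S (r - 1)) (W r)" using Wdom[of "r - 1"] that by simp
    ultimately have "dominates (S (r - 1)) (S r)" using dominates_trans semiW semiS by blast
    then show False using strict[of "r - 1"] that by simp
  qed
  have gapB: "\<exists>b. finsupp b \<and> M * W (Suc r) b < T j b" if "\<And>n. dominates (T j) (S n)" for j r M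
  proof (rule ccontr)
    assume "\<not> ?thesis"
    then have "dominates (W (Suc r)) (T j)" unfolding dominates_def by (auto simp: not_less)
    then have "dominates (S r) (T j)" using dominates_trans[OF _ Wdom semiW semiS] by blast
    then have "dominates (S r) (S (Suc r))" using dominates_trans[OF that _ semiT semiS] by blast
    then show False using strict by blast
  qed

  \<comment> \<open>Inductive choice of the weights\<close>
  define jr where "jr r = fst (prod_decode r)" for r
  define P :: "nat \<Rightarrow> real \<Rightarrow> bool" where "P r c \<longleftrightarrow> 0 < c \<and> c \<le> 1" for r c
  \<comment> \<open>\<open>c'\<close> is the weight of index \<open>Suc r\<close>, and
    \<open>c' * (2 * l1 a)\<close> bounds all terms after stage \<open>r\<close>. At the first
    witness the limit norm will exceed \<open>r * W r\<close>; at the second, \<open>r\<close> times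
    the limit norm will stay below \<open>T (jr r)\<close>. Every \<open>j\<close> equals
    \<open>jr r\<close> for arbitrarily large \<open>r\<close>, so each class meets every
    constant.\<close>
  define Q where "Q r c c' \<longleftrightarrow> c' \<le> c / 2 \<and>
     (r > 0 \<longrightarrow> (\<exists>a. finsupp a \<and> (real r + 1) * W r a + c' * (2 * l1 a) < c * S r a)) \<and>
     ((\<forall>n. dominates (T (jr r)) (S n)) \<longrightarrow>
       (\<exists>b. finsupp b \<and> r * W (Suc r) b + c' * (r * 2 * l1 b) < T (jr r) b))" for r c c'
  have "\<exists>c. \<forall>r. P r (c r) \<and> Q r (c r) (c (Suc r))"
  proof (rule dependent_nat_choice)
    show "\<exists>c. P 0 c" unfolding P_def by (intro exI[of _ 1]) auto
  next
    fix c r assume Pc: "P r c"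
    have "\<exists>d>0. \<forall>t. 0 \<le> t \<and> t \<le> d \<and> r > 0 \<longrightarrow> (\<exists>a. finsupp a \<and> (real r + 1) * W r a + t * (2 * l1 a) < c * S r a)"
    proof (cases "r > 0")
      case True
      then obtain a where a: "finsupp a" "(real r + 1) * W r a < c * S r a" using gapA Pc by (auto simp: P_def)
      obtain d where "0 < d" "\<And>t. 0 \<le> t \<Longrightarrow> t \<le> d \<Longrightarrow> (real r + 1) * W r a + t * (2 * l1 a) < c * S r a"
        using small_perturbation[OF a(2), of "2 * l1 a"] l1_nonneg[of a] by auto
      then show ?thesis using a(1) by blast
    qed (auto intro: exI[of _ 1])
    then obtain d1 where d1: "d1 > 0" "\<And>t. 0 \<le> t \<Longrightarrow> t \<le> d1 \<Longrightarrow> r > 0 \<Longrightarrow>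
      \<exists>a. finsupp a \<and> (real r + 1) * W r a + t * (2 * l1 a) < c * S r a" by blast
    have "\<exists>d>0. \<forall>t. 0 \<le> t \<and> t \<le> d \<and> (\<forall>n. dominates (T (jr r)) (S n)) \<longrightarrow>
      (\<exists>b. finsupp b \<and> r * W (Suc r) b + t * (r * 2 * l1 b) < T (jr r) b)"
    proof (cases "\<forall>n. dominates (T (jr r)) (S n)")
      case True
      then obtain b where b: "finsupp b" "r * W (Suc r) b < T (jr r) b" using gapB by blast
      obtain d where "0 < d" "\<And>t. 0 \<le> t \<Longrightarrow> t \<le> d \<Longrightarrow> r * W (Suc r) b + t * (r * 2 * l1 b) < T (jr r) b"
        using small_perturbation[OF b(2), of "r * 2 * l1 b"] l1_nonneg[of b] by auto
      then show ?thesis using b(1) by blast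
    qed (auto intro: exI[of _ 1])
    then obtain d2 where d2: "d2 > 0" "\<And>t. 0 \<le> t \<Longrightarrow> t \<le> d2 \<Longrightarrow> \<forall>n. dominates (T (jr r)) (S n) \<Longrightarrow>
      \<exists>b. finsupp b \<and> r * W (Suc r) b + t * (r * 2 * l1 b) < T (jr r) b" by blast
    define c' where "c' = min (c / 2) (min d1 d2)"
    have "0 < c'" "c' \<le> c / 2" "c' \<le> d1" "c' \<le> d2" using Pc d1 d2 by (auto simp: c'_def P_def)
    moreover have "c' \<le> 1" using \<open>c' \<le> c / 2\<close> Pc by (simp add: P_def)
    ultimately have "P (Suc r) c' \<and> Q r c c'" unfolding P_def Q_def using d1(2) d2(2) by auto
    then show "\<exists>c'. P (Suc r) c' \<and> Q r c c'" by blast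
  qed
  then obtain c where c: "\<And>r. 0 < c r" "\<And>r. c r \<le> 1" and Qc: "\<And>r. Q r (c r) (c (Suc r))"
    unfolding P_def by blast
  have chalf: "c (r + n) \<le> c r * (1/2)^n" for r n
  proof (induction n)
    case (Suc n)
    have "c (Suc (r + n)) \<le> c (r + n) / 2" using Qc[of "r + n"] by (simp add: Q_def)
    then show ?case using Suc by simp
  qed simp
  have geo: "(\<lambda>n. c r * (1/2)^n) sums (2 * c r)" for r
    using sums_mult[OF geometric_sums[of "1/2::real"], of "c r"] by (simp add: mult.commute)
  have c_null: "c \<longlonglongrightarrow> 0"
  proof (rule Lim_null_comparison)
    show "\<forall>\<^sub>F n in sequentially. norm (c n) \<le> (1/2)^n"
    proof (intro always_eventually allI)
      fix n
      have "c n \<le> c 0 * (1/2)^n" using chalf[of 0 n] by simp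
      also have "\<dots> \<le> 1 * (1/2)^n" using c by (intro mult_right_mono) auto
      finally show "norm (c n) \<le> (1/2)^n" using c(1)[of n] by simp
    qed
  qed (rule LIMSEQ_power_zero, simp)

  \<comment> \<open>The weighted sum and its asymptotic norms\<close>
  have "\<forall>n. \<exists>x::nat \<Rightarrow> 'a. (\<forall>i. norm (x i) = 1) \<and> weakly_null UNIV norm x \<and> generates_sm norm x (S n)"
    using S unfolding wsm_def normalized_seq_def by blast
  then obtain xs :: "nat \<Rightarrow> nat \<Rightarrow> 'a" where x1: "\<And>n i. norm (xs n i) = 1"
    and xw: "\<And>n. weakly_null UNIV norm (xs n)" and xg: "\<And>n. generates_sm norm (xs n) (S n)"
    by metis
  define y where "y i = (\<Sum>n. c n *\<^sub>R xs n i)" for i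
  \<comment> \<open>Halving makes the tail from \<open>r\<close> on a series dominated by a
    geometric one with sum \<open>2 * c r\<close>.\<close>
  have tail: "norm (y i - (\<Sum>n<r. c n *\<^sub>R xs n i)) \<le> 2 * c r" for i r
  proof -
    have nb: "norm (c (n + r) *\<^sub>R xs (n + r) i) \<le> c r * (1/2)^n" for n r
      using chalf[of r n] c(1)[of "n + r"] by (simp add: x1 add.commute)
    have "summable (\<lambda>n. c n *\<^sub>R xs n i)"
      by (rule summable_comparison_test'[OF sums_summable[OF geo[of 0]]]) (use nb[of _ 0] in simp)
    then have "y i - (\<Sum>n<r. c n *\<^sub>R xs n i) = (\<Sum>n. c (n + r) *\<^sub>R xs (n + r) i)"
      unfolding y_def by (rule suminf_minus_initial_segment[symmetric])
    also have "norm \<dots> \<le> (\<Sum>n. c r * (1/2)^n)"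
      by (rule norm_suminf_le[OF nb sums_summable[OF geo]])
    also have "\<dots> = 2 * c r" using geo by (rule sums_unique[symmetric])
    finally show ?thesis .
  qed
  have ybound: "norm (y i) \<le> 2" for i using tail[of i 0] c(2)[of 0] by simp
  have yweak: "weakly_null UNIV norm y"
    unfolding weakly_null_def
  proof (intro conjI ballI subset_UNIV)
    fix f assume f: "f \<in> dual (UNIV::'a set) norm"
    then have lin: "linear f" by (intro linearI) (auto simp: dual_def)
    obtain C where C: "\<And>x. \<bar>f x\<bar> \<le> C * norm x" using f by (auto simp: dual_def)
    have C0: "0 \<le> C" using C[of "xs 0 0"] x1[of 0 0] abs_ge_zero[of "f (xs 0 0)"] by simp
    show "(\<lambda>i. f (y i)) \<longlonglongrightarrow> 0"
    proof (rule LIMSEQ_I)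
      fix e :: real assume e: "0 < e"
      have "(\<lambda>r. C * (2 * c r)) \<longlonglongrightarrow> C * (2 * 0)" by (intro tendsto_intros c_null)
      then have "\<forall>\<^sub>F r in sequentially. C * (2 * c r) < e / 2" using e by (intro order_tendstoD) auto
      then obtain r where r: "C * (2 * c r) < e / 2" by (auto simp: eventually_sequentially)
      have "(\<lambda>i. \<Sum>n<r. c n * f (xs n i)) \<longlonglongrightarrow> (\<Sum>n<r. c n * 0)"
        using xw f by (intro tendsto_intros) (auto simp: weakly_null_def)
      then have fsum: "(\<lambda>i. \<Sum>n<r. c n * f (xs n i)) \<longlonglongrightarrow> 0" by simp
      obtain i0 where i0: "\<And>i. i \<ge> i0 \<Longrightarrow> norm ((\<Sum>n<r. c n * f (xs n i)) - 0) < e / 2"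
        using LIMSEQ_D[OF fsum, of "e / 2"] e by auto
      have "norm (f (y i) - 0) < e" if "i \<ge> i0" for i
      proof -
        have "f (y i) = f (y i - (\<Sum>n<r. c n *\<^sub>R xs n i)) + (\<Sum>n<r. c n * f (xs n i))"
          using lin by (simp add: linear_diff linear_sum linear_cmul)
        moreover have "\<bar>f (y i - (\<Sum>n<r. c n *\<^sub>R xs n i))\<bar> \<le> C * (2 * c r)"
          using C[of "y i - (\<Sum>n<r. c n *\<^sub>R xs n i)"] mult_left_mono[OF tail[of i r] C0] by linarith
        ultimately show ?thesis using i0[OF that] r by simp
      qed
      then show "\<exists>i0. \<forall>i\<ge>i0. norm (f (y i) - 0) < e" by blast
    qed
  qed
  \<comment> \<open>Stated for the limit \<open>L\<close> along an arbitrary subsequence. Above: the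
    weights are at most 1, so the head costs at most \<open>W r\<close>. Below: the
    \<open>r\<close>-th term is isolated, the head subtracted as \<open>W r\<close> and the tail
    after \<open>r\<close> through the next weight.\<close>
  have bounds: "L \<le> W r a + c r * (2 * l1 a)" "c r * S r a - W r a - c (Suc r) * (2 * l1 a) \<le> L"
    if phi: "strict_mono \<phi>" and am: "\<And>i. i \<ge> m \<Longrightarrow> a i = 0"
      and lim: "(\<lambda>t. norm (\<Sum>j<m. a j *\<^sub>R y (\<phi> (t + j)))) \<longlonglongrightarrow> L" for \<phi> m a L r
  proof -
    define Y where "Y t = (\<Sum>j<m. a j *\<^sub>R y (\<phi> (t + j)))" for t
    define Z where "Z n t = (\<Sum>j<m. a j *\<^sub>R xs n (\<phi> (t + j)))" for n t
    have limY: "(\<lambda>t. norm (Y t)) \<longlonglongrightarrow> L" using lim by (simp add: Y_def)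
    have a_trunc: "(\<lambda>i. if i < m then a i else 0) = a" using am by (auto simp: fun_eq_iff not_less)
    have fin: "finsupp a" using finsupp_truncate[of m a] unfolding a_trunc .
    have limZ: "(\<lambda>t. norm (Z n t)) \<longlonglongrightarrow> S n a" for n
      using UN.spreading_model_limit[OF subset_UNIV xg[of n] phi, where m=m and a=a] unfolding a_trunc Z_def .
    have diff: "norm (Y t - (\<Sum>n<r. c n *\<^sub>R Z n t)) \<le> c r * (2 * l1 a)" for t r
    proof -
      have "Y t - (\<Sum>n<r. c n *\<^sub>R Z n t) = (\<Sum>j<m. a j *\<^sub>R (y (\<phi> (t + j)) - (\<Sum>n<r. c n *\<^sub>R xs n (\<phi> (t + j)))))"
      proof -
        have "(\<Sum>n<r. c n *\<^sub>R Z n t) = (\<Sum>j<m. \<Sum>n<r. c n *\<^sub>R a j *\<^sub>R xs n (\<phi> (t + j)))"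
          unfolding Z_def by (subst sum.swap) (simp add: scaleR_sum_right)
        then show ?thesis
          by (simp add: Y_def scaleR_diff_right sum_subtractf scaleR_sum_right mult.commute)
      qed
      also have "norm \<dots> \<le> (\<Sum>j<m. \<bar>a j\<bar> * (2 * c r))"
        by (rule sum_norm_le) (use tail in \<open>auto intro!: mult_left_mono\<close>)
      also have "\<dots> = c r * (2 * l1 a)"
      proof -
        have "l1 a = (\<Sum>i<m. \<bar>a i\<bar>)" by (rule l1_eq) (rule am)
        then show ?thesis by (simp add: sum_distrib_left mult_ac)
      qed
      finally show ?thesis .
    qed
    have W_weight: "(\<Sum>n<r. c n * S n a) \<le> W r a" for r
      unfolding W_def
    proof (rule sum_mono)
      fix n show "c n * S n a \<le> S n a"
        using mult_right_mono[OF c(2)[of n] c00_seminorm_nonneg[OF semiS fin, of n]] by simp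
    qed
    have sum_le: "norm (\<Sum>n<r. c n *\<^sub>R Z n t) \<le> (\<Sum>n<r. c n * norm (Z n t))" for t r
      by (rule sum_norm_le) (use c in \<open>auto simp: less_imp_le\<close>)
    have "L \<le> (\<Sum>n<r. c n * S n a) + c r * (2 * l1 a)"
    proof (rule LIMSEQ_le[OF limY])
      show "(\<lambda>t. (\<Sum>n<r. c n * norm (Z n t)) + c r * (2 * l1 a)) \<longlonglongrightarrow> (\<Sum>n<r. c n * S n a) + c r * (2 * l1 a)"
        by (intro tendsto_intros limZ)
      have "norm (Y t) \<le> (\<Sum>n<r. c n * norm (Z n t)) + c r * (2 * l1 a)" for t
        using norm_triangle_ineq[of "Y t - (\<Sum>n<r. c n *\<^sub>R Z n t)" "\<Sum>n<r. c n *\<^sub>R Z n t"] diff[of t r] sum_le[of t r]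
        by simp
      then show "\<exists>N. \<forall>t\<ge>N. norm (Y t) \<le> (\<Sum>n<r. c n * norm (Z n t)) + c r * (2 * l1 a)" by blast
    qed
    then show "L \<le> W r a + c r * (2 * l1 a)" using W_weight[of r] by linarith
    have "c r * S r a - (\<Sum>n<r. c n * S n a) - c (Suc r) * (2 * l1 a) \<le> L"
    proof (rule LIMSEQ_le[OF _ limY])
      show "(\<lambda>t. c r * norm (Z r t) - (\<Sum>n<r. c n * norm (Z n t)) - c (Suc r) * (2 * l1 a))
          \<longlonglongrightarrow> c r * S r a - (\<Sum>n<r. c n * S n a) - c (Suc r) * (2 * l1 a)"
        by (intro tendsto_intros limZ)
      have "c r * norm (Z r t) - (\<Sum>n<r. c n * norm (Z n t)) - c (Suc r) * (2 * l1 a) \<le> norm (Y t)" for t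
      proof -
        define R where "R = Y t - (\<Sum>n<Suc r. c n *\<^sub>R Z n t)"
        define A where "A = (\<Sum>n<r. c n *\<^sub>R Z n t)"
        have "c r *\<^sub>R Z r t = Y t - R - A" by (simp add: R_def A_def)
        then have "norm (c r *\<^sub>R Z r t) \<le> norm (Y t) + norm R + norm A"
          using norm_triangle_ineq4[of "Y t - R" A] norm_triangle_ineq4[of "Y t" R] by simp
        moreover have "norm (c r *\<^sub>R Z r t) = c r * norm (Z r t)" using c(1)[of r] by simp
        ultimately show ?thesis using diff[of t "Suc r"] sum_le[of t r] unfolding R_def A_def by linarith
      qed
      then show "\<exists>N. \<forall>t\<ge>N. c r * norm (Z r t) - (\<Sum>n<r. c n * norm (Z n t)) - c (Suc r) * (2 * l1 a) \<le> norm (Y t)"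
        by blast
    qed
    then show "c r * S r a - W r a - c (Suc r) * (2 * l1 a) \<le> L" using W_weight[of r] by linarith
  qed

  \<comment> \<open>A normalized subsequence and its spreading model\<close>
  have not_null: "\<not> y \<longlonglongrightarrow> 0"
  proof
    assume y0: "y \<longlonglongrightarrow> 0"
    \<comment> \<open>At this witness, from the first stage that provides one, the lower bound for
      limit norms is positive, whereas a null sequence has limit 0.\<close>
    obtain a where a: "finsupp a" "(real 1 + 1) * W 1 a + c (Suc 1) * (2 * l1 a) < c 1 * S 1 a"
      using Qc[of 1] by (auto simp: Q_def)
    obtain m where m: "\<forall>i\<ge>m. a i = 0" using finsupp_bounded[OF a(1)] by blast
    have "(\<lambda>t. norm (\<Sum>j<m. a j *\<^sub>R y (id (t + j)))) \<longlonglongrightarrow> norm (\<Sum>j<m. a j *\<^sub>R (0::'a))"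
      using LIMSEQ_ignore_initial_segment[OF y0] by (intro tendsto_intros) simp
    then have "c 1 * S 1 a - W 1 a - c (Suc 1) * (2 * l1 a) \<le> 0"
      using bounds(2)[of id m a 0 1] m by (simp add: strict_mono_id)
    moreover have "0 \<le> W 1 a" using c00_seminorm_nonneg[OF semiW a(1)] .
    ultimately show False using a(2) by simp
  qed
  then obtain \<delta> where \<delta>: "\<delta> > 0" "\<And>N. \<exists>i\<ge>N. \<delta> \<le> norm (y i)"
    unfolding lim_sequentially by (auto simp: not_less)
  define I where "I = {i. \<delta> \<le> norm (y i)}"
  have "infinite I" unfolding infinite_nat_iff_unbounded_le I_def using \<delta>(2) by auto
  then have en: "strict_mono (enumerate I)" "\<And>i. enumerate I i \<in> I"
    by (auto simp: strict_mono_enumerate enumerate_in_set)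
  have "seq_compact {\<delta>..2::real}" by (simp add: compact_imp_seq_compact)
  moreover have "\<forall>i. norm (y (enumerate I i)) \<in> {\<delta>..2}" using en(2) ybound by (auto simp: I_def)
  ultimately obtain \<mu> \<rho> where lam: "\<mu> \<in> {\<delta>..2}" "strict_mono \<rho>" "((\<lambda>i. norm (y (enumerate I i))) \<circ> \<rho>) \<longlonglongrightarrow> \<mu>"
    by (rule seq_compactE)
  define \<psi> where "\<psi> = enumerate I \<circ> \<rho>"
  have psi: "strict_mono \<psi>" unfolding \<psi>_def using en(1) lam(2) by (rule strict_mono_o)
  have lampos: "\<mu> > 0" using lam(1) \<delta>(1) by simp
  have nlam: "(\<lambda>i. norm (y (\<psi> i))) \<longlonglongrightarrow> \<mu>" using lam(3) by (simp add: \<psi>_def comp_def)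
  have ypos: "norm (y (\<psi> i)) > 0" for i using en(2)[of "\<rho> i"] \<delta>(1) unfolding \<psi>_def I_def comp_def by (simp only: mem_Collect_eq)
  define w where "w i = inverse (norm (y (\<psi> i))) *\<^sub>R y (\<psi> i)" for i
  have w1: "norm (w i) = 1" for i using ypos[of i] by (simp add: w_def)
  have y_w: "y (\<psi> i) = norm (y (\<psi> i)) *\<^sub>R w i" for i using ypos[of i] by (simp add: w_def)
  have wweak: "weakly_null UNIV norm w"
    unfolding weakly_null_def
  proof (intro conjI ballI subset_UNIV)
    fix f assume f: "f \<in> dual (UNIV::'a set) norm"
    have "(\<lambda>i. f ((y \<circ> \<psi>) i)) \<longlonglongrightarrow> 0" using weakly_null_subseq[OF yweak psi] f by (simp add: weakly_null_def)
    then have "(\<lambda>i. inverse (norm (y (\<psi> i))) * f ((y \<circ> \<psi>) i)) \<longlonglongrightarrow> inverse \<mu> * 0"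
      using lampos by (intro tendsto_intros nlam) auto
    then show "(\<lambda>i. f (w i)) \<longlonglongrightarrow> 0" using f by (simp add: w_def dual_def)
  qed
  obtain \<phi> U where phi: "strict_mono \<phi>" and bas: "basic_seq UNIV norm (w \<circ> \<phi>)" and gen: "generates_sm norm (w \<circ> \<phi>) U"
    using weakly_null_spreading_model[OF wweak w1] by blast
  have U: "U \<in> wsm (UNIV::'a set) norm"
    unfolding wsm_def normalized_seq_def using bas gen weakly_null_subseq[OF wweak phi] w1
    by (auto intro!: exI[of _ "w \<circ> \<phi>"])
  note semiU = wsm_seminorm[OF U]
  have pp: "strict_mono (\<lambda>i. \<psi> (\<phi> i))" using strict_mono_o[OF psi phi] by (simp add: comp_def)
  \<comment> \<open>Replacing the individual norms of \<open>y\<close> by their limit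
    \<open>\<mu>\<close> changes the sums by a null sequence. Thus \<open>\<mu> * U\<close> is the
    asymptotic norm of the unnormalized \<open>y\<close>, to which \<open>bounds\<close>
    applies.\<close>
  have limU: "(\<lambda>t. norm (\<Sum>j<m. a j *\<^sub>R y (\<psi> (\<phi> (t + j))))) \<longlonglongrightarrow> \<mu> * U a" if am: "\<And>i. i \<ge> m \<Longrightarrow> a i = 0" for m a
  proof -
    have a_trunc: "(\<lambda>i. if i < m then a i else 0) = a" using am by (auto simp: fun_eq_iff not_less)
    define A where "A t = (\<Sum>j<m. a j *\<^sub>R w (\<phi> (t + j)))" for t
    define B where "B t = (\<Sum>j<m. a j *\<^sub>R y (\<psi> (\<phi> (t + j))))" for t
    have A: "(\<lambda>t. norm (A t)) \<longlonglongrightarrow> U a"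
      using UN.spreading_model_limit[OF subset_UNIV gen strict_mono_id, where m=m and a=a] unfolding a_trunc A_def by simp
    have "norm (B t - \<mu> *\<^sub>R A t) \<le> (\<Sum>j<m. \<bar>a j\<bar> * \<bar>norm (y (\<psi> (\<phi> (t + j)))) - \<mu>\<bar>)" for t
    proof -
      have "B t - \<mu> *\<^sub>R A t = (\<Sum>j<m. (a j * (norm (y (\<psi> (\<phi> (t + j)))) - \<mu>)) *\<^sub>R w (\<phi> (t + j)))"
        unfolding A_def B_def scaleR_sum_right sum_subtractf[symmetric]
        by (rule sum.cong[OF refl], subst y_w) (simp add: algebra_simps)
      also have "norm \<dots> \<le> (\<Sum>j<m. \<bar>a j\<bar> * \<bar>norm (y (\<psi> (\<phi> (t + j)))) - \<mu>\<bar>)"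
        by (rule sum_norm_le) (simp add: w1 abs_mult)
      finally show ?thesis .
    qed
    moreover have "(\<lambda>t. \<Sum>j<m. \<bar>a j\<bar> * \<bar>norm (y (\<psi> (\<phi> (t + j)))) - \<mu>\<bar>) \<longlonglongrightarrow> (\<Sum>j<m. \<bar>a j\<bar> * \<bar>\<mu> - \<mu>\<bar>)"
      using LIMSEQ_ignore_initial_segment[OF LIMSEQ_subseq_LIMSEQ[OF nlam phi]]
      by (intro tendsto_intros) (simp add: comp_def)
    ultimately have "(\<lambda>t. B t - \<mu> *\<^sub>R A t) \<longlonglongrightarrow> 0"
      by (intro Lim_null_comparison[of "\<lambda>t. B t - \<mu> *\<^sub>R A t"]) auto
    then have "(\<lambda>t. norm (B t - \<mu> *\<^sub>R A t)) \<longlonglongrightarrow> 0" by (rule tendsto_norm_zero)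
    moreover have "norm (norm (B t) - \<mu> * norm (A t)) \<le> norm (B t - \<mu> *\<^sub>R A t)" for t
      using norm_triangle_ineq3[of "B t" "\<mu> *\<^sub>R A t"] lampos by simp
    ultimately have "(\<lambda>t. norm (B t) - \<mu> * norm (A t)) \<longlonglongrightarrow> 0"
      by (intro Lim_null_comparison[of "\<lambda>t. norm (B t) - \<mu> * norm (A t)"]) auto
    then have "(\<lambda>t. (norm (B t) - \<mu> * norm (A t)) + \<mu> * norm (A t)) \<longlonglongrightarrow> 0 + \<mu> * U a"
      by (intro tendsto_intros A)
    then show ?thesis by (simp add: B_def)
  qed
  have Ubounds: "\<mu> * U a \<le> W r a + c r * (2 * l1 a)" "c r * S r a - W r a - c (Suc r) * (2 * l1 a) \<le> \<mu> * U a"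
    if fin: "finsupp a" for a r
  proof -
    obtain m where m: "\<And>i. i \<ge> m \<Longrightarrow> a i = 0" using finsupp_bounded[OF fin] by blast
    have lim: "(\<lambda>t. norm (\<Sum>j<m. a j *\<^sub>R y (\<psi> (\<phi> (t + j))))) \<longlonglongrightarrow> \<mu> * U a" by (rule limU) (rule m)
    show "\<mu> * U a \<le> W r a + c r * (2 * l1 a)" by (rule bounds(1)[OF pp _ lim]) (rule m)
    show "c r * S r a - W r a - c (Suc r) * (2 * l1 a) \<le> \<mu> * U a" by (rule bounds(2)[OF pp _ lim]) (rule m)
  qed

  \<comment> \<open>Position of the new model in the chain\<close>
  have "\<not> dominates (S n) U" for n
  proof
    assume "dominates (S n) U"
    then obtain C where C: "C > 0" "\<And>a. finsupp a \<Longrightarrow> U a \<le> C * S n a" using dominates_posE[OF _ semiS] by blast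
    obtain k :: nat where k: "real k > \<mu> * C" using reals_Archimedean2 by blast
    \<comment> \<open>\<open>r > n\<close> makes \<open>S n\<close> a summand of \<open>W r\<close>,
      and \<open>r > \<mu> * C\<close> defeats the supposed constant.\<close>
    define r where "r = Suc (max n k)"
    obtain a where a: "finsupp a" "(real r + 1) * W r a + c (Suc r) * (2 * l1 a) < c r * S r a"
      using Qc[of r] by (auto simp: Q_def r_def)
    have Sn: "0 \<le> S n a" using c00_seminorm_nonneg[OF semiS a(1)] .
    have "\<mu> * U a \<le> \<mu> * (C * S n a)" using C(2)[OF a(1)] lampos by simp
    also have "\<dots> = (\<mu> * C) * S n a" by simp
    also have "\<dots> \<le> real r * S n a" using k Sn by (intro mult_right_mono) (auto simp: r_def)
    also have "\<dots> \<le> real r * W r a" using S_le_W[OF a(1), of n r] by (intro mult_left_mono) (auto simp: r_def)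
    also have "\<dots> < \<mu> * U a" using Ubounds(2)[OF a(1), of r] a(2) by (simp add: algebra_simps)
    finally show False by simp
  qed
  then have US: "dominates U (S n)" for n using chain[OF U S] by blast
  obtain j where j: "equiv_sm U (T j)" using Tall[OF U] by blast
  have TS: "dominates (T j) (S n)" for n
    using dominates_trans[OF US _ semiU semiT] j by (simp add: equiv_sm_def)
  obtain C where C: "C > 0" "\<And>a. finsupp a \<Longrightarrow> T j a \<le> C * U a"
    using j dominates_posE[OF _ semiU] by (auto simp: equiv_sm_def)
  obtain k :: nat where k: "real k > C / \<mu>" using reals_Archimedean2 by blast
  \<comment> \<open>A stage devoted to \<open>j\<close> with \<open>r \<ge> k > C / \<mu>\<close>;
    there \<open>r * \<mu> * U b\<close>, hence also \<open>C * U b\<close>, falls below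
    \<open>T j b\<close>.\<close>
  define r where "r = prod_encode (j, k)"
  have rk: "k \<le> r" unfolding r_def by (rule le_prod_encode_2)
  have jr: "jr r = j" by (simp add: jr_def r_def)
  obtain b where b: "finsupp b" "r * W (Suc r) b + c (Suc r) * (real r * 2 * l1 b) < T j b"
    using Qc[of r] TS unfolding Q_def jr by blast
  have "C * U b \<le> (real r * \<mu>) * U b"
  proof (rule mult_right_mono)
    have "C / \<mu> \<le> real r" using k rk by linarith
    then show "C \<le> real r * \<mu>" using lampos by (simp add: field_simps)
  qed (rule c00_seminorm_nonneg[OF semiU b(1)])
  also have "\<dots> = real r * (\<mu> * U b)" by simp
  also have "\<dots> \<le> real r * (W (Suc r) b + c (Suc r) * (2 * l1 b))"
    using Ubounds(1)[OF b(1), of "Suc r"] by (intro mult_left_mono) auto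
  also have "\<dots> < T j b" using b(2) by (simp add: algebra_simps)
  finally show False using C(2)[OF b(1)] by simp
qed

text \<open>The classes are numbered injectively and their order is reversed. An infinite descent in
  \<open>r - Id\<close> is then a strictly increasing sequence of classes, excluded by passing to
  representatives.\<close>

theorem countable_chain_reverse_well_ordered:
  assumes cnt: "countable (SPw (UNIV::'a::banach set) norm)"
    and ch: "\<forall>c1\<in>SPw (UNIV::'a set) norm. \<forall>c2\<in>SPw (UNIV::'a set) norm. sp_le c1 c2 \<or> sp_le c2 c1"
  shows "\<exists>r::nat rel. Well_order r \<and> iso_reverse (UNIV::'a set) norm r"
proof -
  define W where "W = wsm (UNIV::'a set) norm"
  define Q where "Q = SPw (UNIV::'a set) norm"
  define cls where "cls S = {T\<in>W. equiv_sm S T}" for S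
  have Q_eq: "Q = cls ` W" by (simp add: Q_def SPw_def cls_def[abs_def] W_def)
  have le: "sp_le (cls S) (cls T) \<longleftrightarrow> dominates T S" if "S \<in> W" "T \<in> W" for S T
    using sp_le_iff that unfolding W_def cls_def by blast
  have eq: "cls S = cls T \<longleftrightarrow> equiv_sm S T" if "S \<in> W" "T \<in> W" for S T
    using class_eq_iff that unfolding W_def cls_def by blast
  have semi: "c00_seminorm S" if "S \<in> W" for S using that wsm_seminorm unfolding W_def by blast
  have refl: "sp_le p p" if "p \<in> Q" for p using that le dominates_refl unfolding Q_eq by blast
  have trans: "sp_le p s" if pqs: "p \<in> Q" "q \<in> Q" "s \<in> Q" "sp_le p q" "sp_le q s" for p q s
  proof -
    obtain A B C where abc: "A \<in> W" "B \<in> W" "C \<in> W" "p = cls A" "q = cls B" "s = cls C"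
      using pqs(1-3) unfolding Q_eq by blast
    have "dominates C A" using pqs(4,5) abc le dominates_trans[of B A C] semi by auto
    then show ?thesis using abc le by simp
  qed
  have anti: "p = q" if "p \<in> Q" "q \<in> Q" "sp_le p q" "sp_le q p" for p q
    using that le eq unfolding Q_eq equiv_sm_def by blast
  have total: "sp_le p q \<or> sp_le q p" if "p \<in> Q" "q \<in> Q" for p q using ch that unfolding Q_def by blast
  define h where "h = to_nat_on Q"
  have inj: "inj_on h Q" unfolding h_def using cnt by (intro inj_on_to_nat_on) (simp add: Q_def)
  define r where "r = {(h q, h p) | p q. p \<in> Q \<and> q \<in> Q \<and> sp_le p q}"
  have r_iff: "(h q, h p) \<in> r \<longleftrightarrow> sp_le p q" if "p \<in> Q" "q \<in> Q" for p q
    using that inj unfolding r_def by (auto simp: inj_on_eq_iff)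
  have Field: "Field r = h ` Q" using refl unfolding Field_def r_def by auto
  have "Well_order r"
    unfolding well_order_on_def linear_order_on_def partial_order_on_def preorder_on_def
  proof (intro conjI)
    show "r \<subseteq> Field r \<times> Field r" by (auto simp: Field_def)
    show "refl_on (Field r) r" unfolding refl_on_def Field using r_iff refl by auto
    show "trans r"
    proof (rule transI)
      fix x y z assume "(x, y) \<in> r" "(y, z) \<in> r"
      then obtain p q q' s where "x = h q" "y = h p" "p \<in> Q" "q \<in> Q" "sp_le p q" "y = h q'" "z = h s" "s \<in> Q" "q' \<in> Q" "sp_le s q'"
        unfolding r_def by blast
      moreover have "p = q'" using inj calculation by (meson inj_onD)
      ultimately show "(x, z) \<in> r" using r_iff[of s q] trans[of s q' q] by simp
    qed
    show "antisym r"
    proof (rule antisymI)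
      fix x y assume "(x, y) \<in> r" "(y, x) \<in> r"
      then obtain p q where "x = h q" "y = h p" "p \<in> Q" "q \<in> Q" "sp_le p q" unfolding r_def by blast
      then show "x = y" using \<open>(y, x) \<in> r\<close> r_iff[of q p] anti[of p q] by simp
    qed
    show "total_on (Field r) r" unfolding total_on_def Field using r_iff total by blast
    show "wf (r - Id)"
      unfolding wf_iff_no_infinite_down_chain
    proof
      assume "\<exists>f. \<forall>i. (f (Suc i), f i) \<in> r - Id"
      then obtain f where f: "\<And>i. (f (Suc i), f i) \<in> r" "\<And>i. f (Suc i) \<noteq> f i" by auto
      have "\<exists>A. A \<in> W \<and> f i = h (cls A)" for i
        using f(1)[of i] unfolding r_def Q_eq by blast
      then obtain A where A: "\<And>i. A i \<in> W" "\<And>i. f i = h (cls (A i))" by metis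
      have up: "dominates (A (Suc i)) (A i)" for i
        using f(1)[of i] r_iff[of "cls (A i)" "cls (A (Suc i))"] A le unfolding Q_eq by simp
      have "\<not> dominates (A i) (A (Suc i))" for i
        using f(2)[of i] up[of i] A eq[of "A i" "A (Suc i)"] by (auto simp: equiv_sm_def)
      \<comment> \<open>\<open>from_nat_into\<close> enumerates any nonempty countable set, with
        repetitions if it is finite, so finitely many classes are no separate case.\<close>
      moreover have "Q \<noteq> {}" using A(1)[of 0] unfolding Q_eq by blast
      then have "\<exists>T. T \<in> W \<and> from_nat_into Q j = cls T" for j
        using from_nat_into[of Q j] unfolding Q_eq by blast
      then obtain T where T: "\<And>j. T j \<in> W" "\<And>j. from_nat_into Q j = cls (T j)" by metis
      have "\<exists>j. equiv_sm B (T j)" if "B \<in> W" for B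
      proof -
        have "cls B \<in> Q" using that unfolding Q_eq by blast
        then obtain j where "from_nat_into Q j = cls B"
          using from_nat_into_surj[of Q "cls B"] cnt unfolding Q_def by blast
        then show ?thesis using eq[of B "T j"] T that by auto
      qed
      moreover have "dominates B C \<or> dominates C B" if "B \<in> W" "C \<in> W" for B C
        using total[of "cls B" "cls C"] le that unfolding Q_eq by blast
      ultimately show False
        using no_strictly_increasing_spreading_models[where S=A and T=T and 'a='a] A(1) T(1) up unfolding W_def by blast
    qed
  qed
  moreover have "iso_reverse (UNIV::'a set) norm r"
    unfolding iso_reverse_def Q_def[symmetric]
    using inj r_iff Field by (intro exI[of _ h]) (auto simp: bij_betw_def)
  ultimately show ?thesis by blast
qed

section \<open>Finite \<open>l\<^sub>p\<close> norms\<close>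

definition lpn :: "real \<Rightarrow> 'i set \<Rightarrow> ('i \<Rightarrow> real) \<Rightarrow> real" where
  "lpn p A f = (\<Sum>i\<in>A. \<bar>f i\<bar> powr p) powr (1 / p)"

lemma lpn_nonneg [simp]: "0 \<le> lpn p A f" by (simp add: lpn_def)

lemma lpn_cong: "(\<And>i. i \<in> A \<Longrightarrow> \<bar>f i\<bar> = \<bar>g i\<bar>) \<Longrightarrow> lpn p A f = lpn p A g"
  by (simp add: lpn_def)

lemma lpn_powr: "0 < p \<Longrightarrow> lpn p A f powr p = (\<Sum>i\<in>A. \<bar>f i\<bar> powr p)"
  by (simp add: lpn_def powr_powr sum_nonneg)

lemma lpn_eqI:
  assumes "0 < p" "0 \<le> t" "(\<Sum>i\<in>A. \<bar>f i\<bar> powr p) = t powr p"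
  shows "lpn p A f = t"
  using assms by (simp add: lpn_def powr_powr)

lemma lpn_leI:
  assumes "0 < p" "0 \<le> t" "(\<Sum>i\<in>A. \<bar>f i\<bar> powr p) \<le> t powr p"
  shows "lpn p A f \<le> t"
proof -
  have "lpn p A f \<le> (t powr p) powr (1 / p)"
    unfolding lpn_def using assms by (intro powr_mono2) (auto intro: sum_nonneg)
  also have "\<dots> = t" using assms by (simp add: powr_powr)
  finally show ?thesis .
qed

lemma lpn_mono:
  assumes "0 < p" "finite A" "\<And>i. i \<in> A \<Longrightarrow> \<bar>f i\<bar> \<le> \<bar>g i\<bar>"
  shows "lpn p A f \<le> lpn p A g"
  using assms unfolding lpn_def by (intro powr_mono2 sum_nonneg sum_mono) auto

lemma lpn_mono_set:
  assumes "0 < p" "finite B" "A \<subseteq> B"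
  shows "lpn p A f \<le> lpn p B f"
  using assms unfolding lpn_def by (intro powr_mono2 sum_nonneg sum_mono2) auto

lemma lpn_mono_neutral:
  assumes "finite B" "A \<subseteq> B" "\<And>i. i \<in> B - A \<Longrightarrow> f i = 0"
  shows "lpn p A f = lpn p B f"
proof -
  have "(\<Sum>i\<in>A. \<bar>f i\<bar> powr p) = (\<Sum>i\<in>B. \<bar>f i\<bar> powr p)"
    by (rule sum.mono_neutral_left) (use assms in auto)
  then show ?thesis by (simp add: lpn_def)
qed

lemma lpn_scale:
  assumes "0 < p" shows "lpn p A (\<lambda>i. c * f i) = \<bar>c\<bar> * lpn p A f"
proof (rule lpn_eqI)
  show "(\<Sum>i\<in>A. \<bar>c * f i\<bar> powr p) = (\<bar>c\<bar> * lpn p A f) powr p"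
    by (simp add: powr_mult lpn_powr assms abs_mult sum_distrib_left)
qed (use assms in auto)

lemma lpn_zero: "(\<And>i. i \<in> A \<Longrightarrow> f i = 0) \<Longrightarrow> lpn p A f = 0"
  by (simp add: lpn_def)

lemma lpn_member:
  assumes "0 < p" "finite A" "i \<in> A" shows "\<bar>f i\<bar> \<le> lpn p A f"
proof -
  have "\<bar>f i\<bar> = lpn p {i} f" using assms by (simp add: lpn_def powr_powr)
  also have "\<dots> \<le> lpn p A f" using assms by (intro lpn_mono_set) auto
  finally show ?thesis .
qed

text \<open>Convexity of the power. If one argument is 0, the claim reduces to
  \<open>s powr p \<le> s\<close> on the unit interval.\<close>

lemma powr_convex_combination:
  fixes u v t p :: real
  assumes "1 \<le> p" "0 \<le> u" "0 \<le> v" "0 \<le> t" "t \<le> 1"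
  shows "(t * u + (1 - t) * v) powr p \<le> t * u powr p + (1 - t) * v powr p"
proof -
  have le: "s powr p \<le> s" if "0 \<le> s" "s \<le> 1" for s :: real
    using powr_mono'[of 1 p s] that assms by simp
  consider "u = 0" | "v = 0" | "u > 0" "v > 0" using assms by linarith
  then show ?thesis
  proof cases
    case 1
    have "((1 - t) * v) powr p \<le> (1 - t) * v powr p"
      using le[of "1 - t"] assms by (simp add: powr_mult mult_right_mono)
    then show ?thesis using 1 assms by simp
  next
    case 2
    have "(t * u) powr p \<le> t * u powr p"
      using le[of t] assms by (simp add: powr_mult mult_right_mono)
    then show ?thesis using 2 assms by simp
  next
    case 3
    have "(1 - (1 - t)) *\<^sub>R u + (1 - t) *\<^sub>R v = t * u + (1 - t) * v" by simp
    then show ?thesis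
      using convex_onD[OF powr_convex[OF assms(1)], of "1 - t" u v] 3 assms by simp
  qed
qed

text \<open>Minkowski's inequality from convexity: \<open>f + g\<close> is \<open>a + b\<close>
  times the convex combination of the normalized \<open>f / a\<close> and \<open>g / b\<close> with
  weights \<open>a / (a + b)\<close> and \<open>b / (a + b)\<close>.\<close>

theorem lpn_triangle:
  assumes p: "1 \<le> p" and A: "finite A"
  shows "lpn p A (\<lambda>i. f i + g i) \<le> lpn p A f + lpn p A g"
proof -
  define a where "a = lpn p A f"
  define b where "b = lpn p A g"
  have p0: "0 < p" using p by simp
  have zero: "h i = 0" if "lpn p A h = 0" "i \<in> A" for h i
    using lpn_member[OF p0 A that(2), of h] that(1) by simp
  consider "a = 0" | "b = 0" | "a > 0" "b > 0"
    unfolding a_def b_def using lpn_nonneg[of p A f] lpn_nonneg[of p A g] by linarith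
  then show ?thesis
  proof cases
    case 1
    then have "lpn p A (\<lambda>i. f i + g i) = lpn p A g" using zero[of f] by (intro lpn_cong) (auto simp: a_def)
    then show ?thesis by simp
  next
    case 2
    then have "lpn p A (\<lambda>i. f i + g i) = lpn p A f" using zero[of g] by (intro lpn_cong) (auto simp: b_def)
    then show ?thesis by simp
  next
    case 3
    define t where "t = a / (a + b)"
    have t: "0 \<le> t" "t \<le> 1" "1 - t = b / (a + b)" using 3 by (auto simp: t_def field_simps)
    have "lpn p A (\<lambda>i. f i + g i) \<le> a + b"
    proof (rule lpn_leI[OF p0])
      have norm1: "(\<Sum>i\<in>A. (\<bar>f i\<bar> / a) powr p) = 1" "(\<Sum>i\<in>A. (\<bar>g i\<bar> / b) powr p) = 1"
        using lpn_powr[OF p0, of A f] lpn_powr[OF p0, of A g] 3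
        by (auto simp: powr_divide sum_divide_distrib[symmetric] a_def b_def)
      have pt: "\<bar>f i + g i\<bar> powr p \<le> (a + b) powr p * (t * (\<bar>f i\<bar> / a) powr p + (1 - t) * (\<bar>g i\<bar> / b) powr p)" for i
      proof -
        have "\<bar>f i\<bar> + \<bar>g i\<bar> = (a + b) * (t * (\<bar>f i\<bar> / a) + (1 - t) * (\<bar>g i\<bar> / b))"
        proof -
          have "t * (\<bar>f i\<bar> / a) = \<bar>f i\<bar> / (a + b)" "b / (a + b) * (\<bar>g i\<bar> / b) = \<bar>g i\<bar> / (a + b)"
            using 3 by (auto simp: t_def)
          then show ?thesis using 3 unfolding t(3) by (simp add: add_divide_distrib[symmetric])
        qed
        then have "\<bar>f i + g i\<bar> powr p \<le> ((a + b) * (t * (\<bar>f i\<bar> / a) + (1 - t) * (\<bar>g i\<bar> / b))) powr p"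
          using p0 abs_triangle_ineq[of "f i" "g i"] by (intro powr_mono2) auto
        also have "\<dots> = (a + b) powr p * (t * (\<bar>f i\<bar> / a) + (1 - t) * (\<bar>g i\<bar> / b)) powr p"
          by (rule powr_mult)
        also have "\<dots> \<le> (a + b) powr p * (t * (\<bar>f i\<bar> / a) powr p + (1 - t) * (\<bar>g i\<bar> / b) powr p)"
          using 3 t p by (intro mult_left_mono powr_convex_combination) auto
        finally show ?thesis .
      qed
      have "(\<Sum>i\<in>A. \<bar>f i + g i\<bar> powr p) \<le> (\<Sum>i\<in>A. (a + b) powr p * (t * (\<bar>f i\<bar> / a) powr p + (1 - t) * (\<bar>g i\<bar> / b) powr p))"
        by (intro sum_mono pt)
      also have "\<dots> = (a + b) powr p * (t * (\<Sum>i\<in>A. (\<bar>f i\<bar> / a) powr p) + (1 - t) * (\<Sum>i\<in>A. (\<bar>g i\<bar> / b) powr p))"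
        by (simp add: sum_distrib_left[symmetric] sum.distrib)
      also have "\<dots> = (a + b) powr p" by (simp add: norm1)
      finally show "(\<Sum>i\<in>A. \<bar>f i + g i\<bar> powr p) \<le> (a + b) powr p" .
    qed (use 3 in simp)
    then show ?thesis by (simp add: a_def b_def)
  qed
qed

lemma lpn_sum_le:
  assumes "1 \<le> p" "finite A" "finite J"
  shows "lpn p A (\<lambda>i. \<Sum>j\<in>J. f j i) \<le> (\<Sum>j\<in>J. lpn p A (f j))"
  using assms(3)
proof (induction J rule: finite_induct)
  case empty
  then show ?case by (simp add: lpn_zero)
next
  case (insert j J)
  then show ?case using lpn_triangle[OF assms(1,2), of "f j" "\<lambda>i. \<Sum>j\<in>J. f j i"] by simp
qed

lemma lpn_antimono_exponent:
  assumes p: "0 < p" "p \<le> q" and A: "finite A"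
  shows "lpn q A f \<le> lpn p A f"
proof (rule lpn_leI)
  define a where "a = lpn p A f"
  have "(\<Sum>i\<in>A. \<bar>f i\<bar> powr q) \<le> (\<Sum>i\<in>A. a powr (q - p) * \<bar>f i\<bar> powr p)"
  proof (rule sum_mono)
    fix i assume i: "i \<in> A"
    have "\<bar>f i\<bar> powr q = \<bar>f i\<bar> powr (q - p) * \<bar>f i\<bar> powr p" by (simp add: powr_add[symmetric])
    also have "\<dots> \<le> a powr (q - p) * \<bar>f i\<bar> powr p"
      using p lpn_member[OF p(1) A i, of f] by (intro mult_right_mono powr_mono2) (auto simp: a_def)
    finally show "\<bar>f i\<bar> powr q \<le> a powr (q - p) * \<bar>f i\<bar> powr p" .
  qed
  also have "\<dots> = a powr (q - p) * a powr p" by (simp add: sum_distrib_left[symmetric] a_def lpn_powr p)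
  also have "\<dots> = a powr q" by (simp add: powr_add[symmetric])
  finally show "(\<Sum>i\<in>A. \<bar>f i\<bar> powr q) \<le> lpn p A f powr q" by (simp add: a_def)
qed (use p in auto)

lemma lpn_le_sum:
  assumes "1 \<le> p" "finite A" shows "lpn p A f \<le> (\<Sum>i\<in>A. \<bar>f i\<bar>)"
  using lpn_antimono_exponent[of 1 p A f] assms by (simp add: lpn_def sum_nonneg)

lemma lpn_2: "(lpn 2 A f)\<^sup>2 = (\<Sum>i\<in>A. (f i)\<^sup>2)"
  using lpn_powr[of 2 A f] by (simp add: powr_numeral)

lemma lpn_disjoint:
  assumes p: "0 < p" and A: "finite A" and J: "finite J"
    and disj: "\<And>i j k. i \<in> A \<Longrightarrow> j \<in> J \<Longrightarrow> k \<in> J \<Longrightarrow> j \<noteq> k \<Longrightarrow> u j i = 0 \<or> u k i = 0"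
  shows "lpn p A (\<lambda>i. \<Sum>j\<in>J. u j i) = lpn p J (\<lambda>j. lpn p A (u j))"
proof (rule lpn_eqI[OF p])
  have pt: "\<bar>\<Sum>j\<in>J. u j i\<bar> powr p = (\<Sum>j\<in>J. \<bar>u j i\<bar> powr p)" if i: "i \<in> A" for i
  proof (cases "\<exists>j\<in>J. u j i \<noteq> 0")
    case True
    then obtain j where j: "j \<in> J" "u j i \<noteq> 0" by blast
    have z: "u k i = 0" if "k \<in> J" "k \<noteq> j" for k using disj[OF i j(1) that(1)] that(2) j(2) by blast
    have "(\<Sum>j\<in>J. u j i) = u j i"
      using sum.remove[OF J j(1), of "\<lambda>j. u j i"] z by simp
    moreover have "(\<Sum>j\<in>J. \<bar>u j i\<bar> powr p) = \<bar>u j i\<bar> powr p"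
      using sum.remove[OF J j(1), of "\<lambda>j. \<bar>u j i\<bar> powr p"] z by simp
    ultimately show ?thesis by simp
  qed simp
  have "(\<Sum>i\<in>A. \<bar>\<Sum>j\<in>J. u j i\<bar> powr p) = (\<Sum>i\<in>A. \<Sum>j\<in>J. \<bar>u j i\<bar> powr p)" using pt by (intro sum.cong) auto
  also have "\<dots> = (\<Sum>j\<in>J. \<Sum>i\<in>A. \<bar>u j i\<bar> powr p)" by (rule sum.swap)
  also have "\<dots> = lpn p J (\<lambda>j. lpn p A (u j)) powr p" by (simp add: lpn_powr p)
  finally show "(\<Sum>i\<in>A. \<bar>\<Sum>j\<in>J. u j i\<bar> powr p) = lpn p J (\<lambda>j. lpn p A (u j)) powr p" .
qed simp

lemma tendsto_lpn:
  assumes "0 < p" "\<And>i. i \<in> A \<Longrightarrow> ((\<lambda>t. f t i) \<longlongrightarrow> g i) F"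
  shows "((\<lambda>t. lpn p A (f t)) \<longlongrightarrow> lpn p A g) F"
  unfolding lpn_def using assms
  by (intro tendsto_powr' tendsto_sum tendsto_rabs tendsto_const) (auto intro!: always_eventually sum_nonneg)

definition ell :: "real \<Rightarrow> (nat \<Rightarrow> real) \<Rightarrow> real" where
  "ell q a = lpn q {i. a i \<noteq> 0} a"

lemma ell_eq:
  assumes "\<And>i. i \<ge> m \<Longrightarrow> a i = 0"
  shows "ell q a = lpn q {..<m} a"
  unfolding ell_def by (rule lpn_mono_neutral) (use assms in \<open>auto simp: not_less[symmetric]\<close>)

lemma ell_seminorm:
  assumes "1 \<le> q" shows "c00_seminorm (ell q)"
  unfolding c00_seminorm_def
proof (intro conjI allI impI)
  fix a b assume "finsupp a \<and> finsupp b"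
  then obtain m1 m2 where m12: "\<forall>i\<ge>m1. a i = 0" "\<forall>i\<ge>m2. b i = 0" using finsupp_bounded by blast
  define m where "m = max m1 m2"
  have "ell q a = lpn q {..<m} a" "ell q b = lpn q {..<m} b" "ell q (\<lambda>i. a i + b i) = lpn q {..<m} (\<lambda>i. a i + b i)"
    using m12 by (auto intro!: ell_eq simp: m_def)
  then show "ell q (\<lambda>i. a i + b i) \<le> ell q a + ell q b" using lpn_triangle[OF assms, of "{..<m}"] by simp
next
  fix a c assume "finsupp a"
  then obtain m where m: "\<forall>i\<ge>m. a i = 0" using finsupp_bounded by blast
  have "ell q a = lpn q {..<m} a" "ell q (\<lambda>i. c * a i) = lpn q {..<m} (\<lambda>i. c * a i)"
    using m by (auto intro!: ell_eq)
  then show "ell q (\<lambda>i. c * a i) = \<bar>c\<bar> * ell q a" using lpn_scale[of q "{..<m}"] assms by simp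
qed

text \<open>For the converse, the vectors of \<open>m\<close> ones have norms
  \<open>m powr (1 / q)\<close> and \<open>m powr (1 / p)\<close>, whose quotient is unbounded if
  \<open>q < p\<close>.\<close>

lemma ell_dominates_iff:
  assumes "1 \<le> p" "1 \<le> q"
  shows "dominates (ell p) (ell q) \<longleftrightarrow> p \<le> q"
proof
  assume "p \<le> q"
  then show "dominates (ell p) (ell q)"
    unfolding dominates_def ell_def finsupp_def using assms
    by (intro exI[of _ 1]) (simp add: lpn_antimono_exponent)
next
  assume dom: "dominates (ell p) (ell q)"
  show "p \<le> q"
  proof (rule ccontr)
    assume "\<not> p \<le> q"
    then have gap: "1 / q - 1 / p > 0" using assms by (simp add: field_simps)
    obtain C where C: "\<And>a. finsupp a \<Longrightarrow> ell q a \<le> C * ell p a" using dom unfolding dominates_def by blast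
    have val: "ell r (\<lambda>i. if i < m then 1 else 0) = real m powr (1 / r)" for r m
    proof -
      have "ell r (\<lambda>i. if i < m then 1 else 0) = lpn r {..<m} (\<lambda>i. if i < m then 1 else 0)" by (rule ell_eq) simp
      then show ?thesis by (simp add: lpn_def)
    qed
    have le: "real m powr (1 / q - 1 / p) \<le> C" if "m > 0" for m
    proof -
      have "real m powr (1 / q) \<le> C * real m powr (1 / p)"
        using C[OF finsupp_truncate[of m "\<lambda>_. 1"]] by (simp add: val)
      then show ?thesis using that by (simp add: powr_diff field_simps)
    qed
    define g where "g = 1 / q - 1 / p"
    have g: "g > 0" using gap by (simp add: g_def)
    obtain m :: nat where m: "(\<bar>C\<bar> + 1) powr (1 / g) < real m" using reals_Archimedean2 by blast
    have "\<bar>C\<bar> + 1 = ((\<bar>C\<bar> + 1) powr (1 / g)) powr g" using g by (simp add: powr_powr)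
    also have "\<dots> \<le> real m powr g" using m g by (intro powr_mono2) auto
    finally have "\<bar>C\<bar> + 1 \<le> real m powr (1 / q - 1 / p)" by (simp add: g_def)
    moreover have "m > 0" using m by (cases m) (auto simp: not_less[symmetric])
    ultimately show False using le[of m] by simp
  qed
qed

section \<open>The \<open>l\<^sub>2\<close> sum of finite \<open>l\<^sub>p\<close> norms\<close>

text \<open>Exponents may repeat and need not be monotone in the index; repetition of the value 2 is
  how indices outside the given order are absorbed later.\<close>

locale lp_sum =
  fixes p :: "nat \<Rightarrow> real"
  assumes p2: "\<And>n. 2 \<le> p n" and p3: "\<And>n. p n \<le> 3"
begin

lemma p_pos: "0 < p n" and p_ge1: "1 \<le> p n" using p2[of n] by simp_all

text \<open>One index truncates the outer and the inner sums together. The norm of the space becomes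
  a supremum over a single increasing parameter, and every estimate is first proved for finite
  sums.\<close>

definition nm :: "nat \<Rightarrow> (nat \<Rightarrow> nat \<Rightarrow> real) \<Rightarrow> real" where
  "nm m F = L2_set (\<lambda>n. lpn (p n) {..<m} (F n)) {..<m}"

lemma nm_nonneg [simp]: "0 \<le> nm m F" by (simp add: nm_def)

lemma nm_sq: "(nm m F)\<^sup>2 = (\<Sum>n<m. (lpn (p n) {..<m} (F n))\<^sup>2)"
  by (simp add: nm_def L2_set_def sum_nonneg)

lemma nm_triangle: "nm m (\<lambda>n i. F n i + G n i) \<le> nm m F + nm m G"
proof -
  have "nm m (\<lambda>n i. F n i + G n i) \<le> L2_set (\<lambda>n. lpn (p n) {..<m} (F n) + lpn (p n) {..<m} (G n)) {..<m}"
    unfolding nm_def by (intro L2_set_mono lpn_triangle p_ge1) auto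
  also have "\<dots> \<le> nm m F + nm m G" unfolding nm_def by (rule L2_set_triangle_ineq)
  finally show ?thesis .
qed

lemma nm_scale: "nm m (\<lambda>n i. c * F n i) = \<bar>c\<bar> * nm m F"
  by (simp add: nm_def lpn_scale p_pos L2_set_right_distrib)

lemma nm_mono:
  assumes "\<And>n i. n < m \<Longrightarrow> i < m \<Longrightarrow> \<bar>F n i\<bar> \<le> \<bar>G n i\<bar>"
  shows "nm m F \<le> nm m G"
  unfolding nm_def by (intro L2_set_mono lpn_mono p_pos) (use assms in auto)

lemma nm_cong:
  assumes "\<And>n i. n < m \<Longrightarrow> i < m \<Longrightarrow> F n i = G n i"
  shows "nm m F = nm m G"
  using assms by (intro antisym nm_mono) auto

lemma nm_mono_index:
  assumes "m \<le> M" shows "nm m F \<le> nm M F"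
proof (rule power2_le_imp_le)
  have "(\<Sum>n<m. (lpn (p n) {..<m} (F n))\<^sup>2) \<le> (\<Sum>n<m. (lpn (p n) {..<M} (F n))\<^sup>2)"
    using assms by (intro sum_mono power_mono lpn_mono_set p_pos) auto
  also have "\<dots> \<le> (\<Sum>n<M. (lpn (p n) {..<M} (F n))\<^sup>2)"
    using assms by (intro sum_mono2) auto
  finally show "(nm m F)\<^sup>2 \<le> (nm M F)\<^sup>2" by (simp add: nm_sq)
qed simp

lemma nm_neutral:
  assumes "m \<le> M" and F: "\<And>n i. F n i \<noteq> 0 \<Longrightarrow> n < m \<and> i < m"
  shows "nm M F = nm m F"
proof -
  have "(nm M F)\<^sup>2 = (\<Sum>n<m. (lpn (p n) {..<M} (F n))\<^sup>2)"
    unfolding nm_sq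
  proof (rule sum.mono_neutral_right)
    show "\<forall>n\<in>{..<M} - {..<m}. (lpn (p n) {..<M} (F n))\<^sup>2 = 0"
    proof
      fix n assume "n \<in> {..<M} - {..<m}"
      then have "F n i = 0" for i using F[of n i] by auto
      then show "(lpn (p n) {..<M} (F n))\<^sup>2 = 0" by (simp add: lpn_zero)
    qed
  qed (use assms in auto)
  also have "\<dots> = (\<Sum>n<m. (lpn (p n) {..<m} (F n))\<^sup>2)"
  proof (rule sum.cong[OF refl])
    fix n
    have "lpn (p n) {..<m} (F n) = lpn (p n) {..<M} (F n)"
    proof (rule lpn_mono_neutral)
      fix i assume "i \<in> {..<M} - {..<m}"
      then show "F n i = 0" using F[of n i] by auto
    qed (use assms in auto)
    then show "(lpn (p n) {..<M} (F n))\<^sup>2 = (lpn (p n) {..<m} (F n))\<^sup>2" by simp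
  qed
  finally have "(nm M F)\<^sup>2 = (nm m F)\<^sup>2" by (simp add: nm_sq)
  then show ?thesis by simp
qed

lemma nm_coord:
  assumes "n < m" "i < m" shows "\<bar>F n i\<bar> \<le> nm m F"
proof -
  have "\<bar>F n i\<bar> \<le> lpn (p n) {..<m} (F n)" using assms by (intro lpn_member p_pos) auto
  also have "\<dots> \<le> nm m F" unfolding nm_def using assms by (intro member_le_L2_set) auto
  finally show ?thesis .
qed

lemma nm_le_sum: "nm m F \<le> (\<Sum>n<m. \<Sum>i<m. \<bar>F n i\<bar>)"
proof -
  have "nm m F \<le> (\<Sum>n<m. lpn (p n) {..<m} (F n))" unfolding nm_def by (rule L2_set_le_sum) simp
  also have "\<dots> \<le> (\<Sum>n<m. \<Sum>i<m. \<bar>F n i\<bar>)" by (intro sum_mono lpn_le_sum p_ge1) auto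
  finally show ?thesis .
qed

lemma nm_disjoint_sq:
  assumes J: "finite J"
    and disj: "\<And>n i j k. j \<in> J \<Longrightarrow> k \<in> J \<Longrightarrow> j \<noteq> k \<Longrightarrow> F j n i = 0 \<or> F k n i = 0"
  shows "(nm m (\<lambda>n i. \<Sum>j\<in>J. F j n i))\<^sup>2 = (\<Sum>n<m. (lpn (p n) J (\<lambda>j. lpn (p n) {..<m} (F j n)))\<^sup>2)"
  unfolding nm_sq by (intro sum.cong refl arg_cong[of _ _ "\<lambda>x. x\<^sup>2"] lpn_disjoint p_pos J disj) auto

text \<open>Within a component, disjoint pieces combine by an \<open>lp\<close> norm, which is at
  most the \<open>l2\<close> norm as \<open>2 \<le> p n\<close>; after that both sums are sums of
  squares and can be swapped.\<close>

lemma nm_upper_estimate: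
  assumes J: "finite J"
    and disj: "\<And>n i j k. j \<in> J \<Longrightarrow> k \<in> J \<Longrightarrow> j \<noteq> k \<Longrightarrow> F j n i = 0 \<or> F k n i = 0"
  shows "(nm m (\<lambda>n i. \<Sum>j\<in>J. F j n i))\<^sup>2 \<le> (\<Sum>j\<in>J. (nm m (F j))\<^sup>2)"
proof -
  have "(nm m (\<lambda>n i. \<Sum>j\<in>J. F j n i))\<^sup>2 = (\<Sum>n<m. (lpn (p n) J (\<lambda>j. lpn (p n) {..<m} (F j n)))\<^sup>2)"
    by (rule nm_disjoint_sq[OF J disj])
  also have "\<dots> \<le> (\<Sum>n<m. (lpn 2 J (\<lambda>j. lpn (p n) {..<m} (F j n)))\<^sup>2)"
    by (intro sum_mono power_mono lpn_antimono_exponent p2 J) auto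
  also have "\<dots> = (\<Sum>j\<in>J. (nm m (F j))\<^sup>2)" unfolding lpn_2 nm_sq by (rule sum.swap)
  finally show ?thesis .
qed

text \<open>All exponents are at most 3, so each summand satisfies a lower 3-estimate; Minkowski's inequality
  with exponent 3/2, applied to the pairs of squared component norms, transfers it to the sum.\<close>

lemma nm_lower_estimate:
  assumes disj: "\<And>n i. F n i = 0 \<or> G n i = 0"
  shows "(nm m F)^3 + (nm m G)^3 \<le> (nm m (\<lambda>n i. F n i + G n i))^3"
proof -
  define a where "a n = lpn (p n) {..<m} (F n)" for n
  define b where "b n = lpn (p n) {..<m} (G n)" for n
  define w where "w n j = (if j then (a n)\<^sup>2 else (b n)\<^sup>2)" for n and j :: bool
  have nn: "0 \<le> a n" "0 \<le> b n" for n by (auto simp: a_def b_def)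
  have pw: "(x\<^sup>2) powr (3/2) = x^3" if "0 \<le> x" for x :: real
    using that powr_powr[of x 2 "3/2"] by (simp add: powr_numeral)
  have comp: "lpn (3/2) UNIV (w n) \<le> (lpn (p n) {..<m} (\<lambda>i. F n i + G n i))\<^sup>2" for n
  proof -
    \<comment> \<open>The \<open>l3\<close> norm of the two component norms. Its square is the norm
      with exponent 3/2 of the pair of squares \<open>w n\<close>, since \<open>x\<^sup>2\<close>
      raised to 3/2 is the cube of \<open>x\<close>.\<close>
    define c where "c = lpn 3 UNIV (\<lambda>j. if j then a n else b n)"
    have c3: "c^3 = a n^3 + b n^3"
      using lpn_powr[of 3 UNIV "\<lambda>j. if j then a n else b n"] nn[of n]
      by (simp add: c_def UNIV_bool powr_numeral)
    have "lpn (3/2) UNIV (w n) = c\<^sup>2"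
    proof (rule lpn_eqI)
      have "(\<Sum>j\<in>UNIV. \<bar>w n j\<bar> powr (3/2)) = a n^3 + b n^3"
        using nn[of n] by (simp add: UNIV_bool w_def pw)
      also have "\<dots> = (c\<^sup>2) powr (3/2)" using c3 by (simp add: pw c_def)
      finally show "(\<Sum>j\<in>UNIV. \<bar>w n j\<bar> powr (3/2)) = (c\<^sup>2) powr (3/2)" .
    qed auto
    moreover have "c \<le> lpn (p n) {..<m} (\<lambda>i. F n i + G n i)"
    proof -
      have "c \<le> lpn (p n) UNIV (\<lambda>j. if j then a n else b n)"
        unfolding c_def by (intro lpn_antimono_exponent p_pos p3) auto
      also have "\<dots> = lpn (p n) UNIV (\<lambda>j. lpn (p n) {..<m} (if j then F n else G n))"
        by (rule lpn_cong) (simp add: a_def b_def)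
      also have "\<dots> = lpn (p n) {..<m} (\<lambda>i. \<Sum>j\<in>UNIV. (if j then F n else G n) i)"
        by (rule lpn_disjoint[symmetric]) (use disj[of n] p_pos in \<open>auto split: if_splits\<close>)
      also have "\<dots> = lpn (p n) {..<m} (\<lambda>i. F n i + G n i)"
        by (rule lpn_cong) (simp add: UNIV_bool add.commute)
      finally show ?thesis .
    qed
    ultimately show ?thesis using power_mono[of c _ 2] by (simp add: c_def)
  qed
  have "lpn (3/2) UNIV (\<lambda>j. \<Sum>n<m. w n j) \<le> (\<Sum>n<m. lpn (3/2) UNIV (w n))" by (rule lpn_sum_le) auto
  also have "\<dots> \<le> (nm m (\<lambda>n i. F n i + G n i))\<^sup>2" unfolding nm_sq by (intro sum_mono comp)
  finally have le: "lpn (3/2) UNIV (\<lambda>j. \<Sum>n<m. w n j) \<le> (nm m (\<lambda>n i. F n i + G n i))\<^sup>2" .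
  have "(nm m F)^3 + (nm m G)^3 = (\<Sum>j\<in>UNIV. \<bar>\<Sum>n<m. w n j\<bar> powr (3/2))"
    using pw[of "nm m F"] pw[of "nm m G"]
    by (simp add: UNIV_bool w_def nm_sq a_def b_def sum_nonneg add.commute)
  also have "\<dots> = lpn (3/2) UNIV (\<lambda>j. \<Sum>n<m. w n j) powr (3/2)" by (rule lpn_powr[symmetric]) simp
  also have "\<dots> \<le> ((nm m (\<lambda>n i. F n i + G n i))\<^sup>2) powr (3/2)" using le by (intro powr_mono2) auto
  also have "\<dots> = (nm m (\<lambda>n i. F n i + G n i))^3" by (rule pw) simp
  finally show ?thesis .
qed

end

section \<open>The Banach space and its reflexivity\<close>

text \<open>Bounded sequences form the ambient vector space, with double indices coded by pairing.
  Vectors of the sum fit in, since each coordinate is bounded by the norm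
  (\<open>coord_le\<close>).\<close>

definition co :: "(nat \<Rightarrow>\<^sub>C real) \<Rightarrow> nat \<Rightarrow> nat \<Rightarrow> real" where
  "co x n i = apply_bcontfun x (prod_encode (n, i))"

definition mk :: "(nat \<Rightarrow> nat \<Rightarrow> real) \<Rightarrow> (nat \<Rightarrow>\<^sub>C real)" where
  "mk F = Bcontfun (\<lambda>k. F (fst (prod_decode k)) (snd (prod_decode k)))"

lemma co_mk:
  assumes "\<And>n i. \<bar>F n i\<bar> \<le> C" shows "co (mk F) = F"
proof -
  have "(\<lambda>k. F (fst (prod_decode k)) (snd (prod_decode k))) \<in> bcontfun"
    unfolding bcontfun_def using assms
    by (auto intro!: boundedI[where B=C] continuous_at_imp_continuous_on simp: continuous_discrete)
  then show ?thesis by (simp add: co_def mk_def Bcontfun_inverse fun_eq_iff)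
qed

lemma co_eqI:
  assumes "\<And>n i. co x n i = co y n i" shows "x = y"
proof (rule bcontfun_eqI)
  fix k show "apply_bcontfun x k = apply_bcontfun y k"
    using assms[of "fst (prod_decode k)" "snd (prod_decode k)"] by (simp add: co_def)
qed

lemma co_simps [simp]: "co 0 n i = 0" "co (x + y) n i = co x n i + co y n i"
  "co (x - y) n i = co x n i - co y n i" "co (c *\<^sub>R x) n i = c * co x n i"
  by (simp_all add: co_def zero_bcontfun.rep_eq plus_bcontfun.rep_eq minus_bcontfun.rep_eq scaleR_bcontfun.rep_eq)

lemma co_sum [simp]: "co (\<Sum>j\<in>J. f j) n i = (\<Sum>j\<in>J. co (f j) n i)"
  by (induction J rule: infinite_finite_induct) auto

definition cut :: "nat \<Rightarrow> (nat \<Rightarrow> nat \<Rightarrow> real) \<Rightarrow> nat \<Rightarrow> nat \<Rightarrow> real" where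
  "cut m F n i = (if n < m \<and> i < m then F n i else 0)"

definition pr :: "nat \<Rightarrow> (nat \<Rightarrow>\<^sub>C real) \<Rightarrow> (nat \<Rightarrow>\<^sub>C real)" where
  "pr m x = mk (cut m (co x))"

definition unit_vec :: "nat \<Rightarrow> nat \<Rightarrow> (nat \<Rightarrow>\<^sub>C real)" where
  "unit_vec n i = mk (\<lambda>n' i'. if n' = n \<and> i' = i then 1 else 0)"

lemma co_pr [simp]: "co (pr m x) n i = (if n < m \<and> i < m then co x n i else 0)"
proof -
  have "\<bar>cut m (co x) n i\<bar> \<le> (\<Sum>n<m. \<Sum>i<m. \<bar>co x n i\<bar>)" for n i
  proof (cases "n < m \<and> i < m")
    case True
    have "\<bar>co x n i\<bar> \<le> (\<Sum>i<m. \<bar>co x n i\<bar>)" using True by (intro member_le_sum) auto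
    also have "\<dots> \<le> (\<Sum>n<m. \<Sum>i<m. \<bar>co x n i\<bar>)"
      by (rule member_le_sum[of n "{..<m}" "\<lambda>n. \<Sum>i<m. \<bar>co x n i\<bar>"]) (use True in \<open>auto intro: sum_nonneg\<close>)
    finally show ?thesis using True by (simp add: cut_def)
  qed (auto simp: cut_def intro!: sum_nonneg)
  then have "co (pr m x) = cut m (co x)" unfolding pr_def by (rule co_mk)
  then show ?thesis by (simp add: cut_def)
qed

lemma co_unit_vec [simp]: "co (unit_vec n i) n' i' = (if n' = n \<and> i' = i then 1 else 0)"
proof -
  have "co (unit_vec n i) = (\<lambda>n' i'. if n' = n \<and> i' = i then 1 else 0)"
    unfolding unit_vec_def by (rule co_mk[where C=1]) auto
  then show ?thesis by simp
qed

lemma pr_unit_vec: "pr m x = (\<Sum>n<m. \<Sum>i<m. co x n i *\<^sub>R unit_vec n i)"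
proof (rule co_eqI)
  fix n i
  have "(\<Sum>n'<m. \<Sum>i'<m. co x n' i' * (if n = n' \<and> i = i' then 1 else 0))
    = (\<Sum>n'<m. if n = n' then (\<Sum>i'<m. if i = i' then co x n' i' else 0) else 0)"
  proof (rule sum.cong[OF refl])
    fix n'
    show "(\<Sum>i'<m. co x n' i' * (if n = n' \<and> i = i' then 1 else 0))
      = (if n = n' then (\<Sum>i'<m. if i = i' then co x n' i' else 0) else 0)"
      by (simp add: mult_delta_right)
  qed
  also have "\<dots> = (if n < m \<and> i < m then co x n i else 0)" by simp
  finally show "co (pr m x) n i = co (\<Sum>n<m. \<Sum>i<m. co x n i *\<^sub>R unit_vec n i) n i"
    by (simp only: co_sum co_simps co_unit_vec co_pr)
qed

section \<open>Functionals and the dual norm on a carrier\<close>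

context normed_carrier
begin

lemma dualnorm_bdd:
  assumes "f \<in> dual V N" shows "bdd_above ((\<lambda>x. \<bar>f x\<bar>) ` {x \<in> V. N x \<le> 1})"
proof -
  obtain C where C: "\<forall>x\<in>V. \<bar>f x\<bar> \<le> C * N x" using assms by (auto simp: dual_def)
  have "\<bar>f x\<bar> \<le> \<bar>C\<bar>" if "x \<in> V" "N x \<le> 1" for x
  proof -
    have "\<bar>f x\<bar> \<le> C * N x" using C that by blast
    also have "\<dots> \<le> \<bar>C\<bar> * 1" using that N_nonneg[OF that(1)] by (intro mult_mono) auto
    finally show ?thesis by simp
  qed
  then show ?thesis by (intro bdd_aboveI2[where M="\<bar>C\<bar>"]) auto
qed

lemma dualnorm_ge: "f \<in> dual V N \<Longrightarrow> x \<in> V \<Longrightarrow> N x \<le> 1 \<Longrightarrow> \<bar>f x\<bar> \<le> dualnorm V N f"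
  unfolding dualnorm_def by (rule cSUP_upper[OF _ dualnorm_bdd]) auto

lemma dualnorm_le: "(\<And>x. x \<in> V \<Longrightarrow> N x \<le> 1 \<Longrightarrow> \<bar>f x\<bar> \<le> K) \<Longrightarrow> dualnorm V N f \<le> K"
  unfolding dualnorm_def by (rule cSUP_least) (auto intro: exI[of _ 0])

lemma dual_scale: "f \<in> dual V N \<Longrightarrow> x \<in> V \<Longrightarrow> f (c *\<^sub>R x) = c * f x"
  and dual_add: "f \<in> dual V N \<Longrightarrow> x \<in> V \<Longrightarrow> y \<in> V \<Longrightarrow> f (x + y) = f x + f y"
  by (auto simp: dual_def)

lemma dual_zero: "f \<in> dual V N \<Longrightarrow> f 0 = 0" using dual_scale[of f 0 0] by simp

lemma dual_diff: "f \<in> dual V N \<Longrightarrow> x \<in> V \<Longrightarrow> y \<in> V \<Longrightarrow> f (x - y) = f x - f y"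
  using dual_add[of f "x - y" y] by (simp add: V_diff)

lemma dual_sum: "f \<in> dual V N \<Longrightarrow> (\<And>j. j \<in> J \<Longrightarrow> g j \<in> V) \<Longrightarrow> f (\<Sum>j\<in>J. g j) = (\<Sum>j\<in>J. f (g j))"
  by (induction J rule: infinite_finite_induct) (auto simp: dual_zero dual_add V_sum)

lemma dualnorm_bound:
  assumes f: "f \<in> dual V N" and x: "x \<in> V" shows "\<bar>f x\<bar> \<le> dualnorm V N f * N x"
proof (cases "x = 0")
  case False
  then have pos: "N x > 0" using N_nonneg[OF x] N_eq_0[OF x] by linarith
  have "N (inverse (N x) *\<^sub>R x) = 1" using pos N_scale[OF x] by simp
  then have "\<bar>f (inverse (N x) *\<^sub>R x)\<bar> \<le> dualnorm V N f" using dualnorm_ge[OF f V_scale[OF x]] by simp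
  then show ?thesis using pos by (simp add: dual_scale[OF f x] abs_mult field_simps)
qed (simp add: dual_zero[OF f])

lemma dual_closed_add: "f \<in> dual V N \<Longrightarrow> g \<in> dual V N \<Longrightarrow> (\<lambda>x. f x + g x) \<in> dual V N"
proof -
  assume f: "f \<in> dual V N" and g: "g \<in> dual V N"
  obtain C D where "\<forall>x\<in>V. \<bar>f x\<bar> \<le> C * N x" "\<forall>x\<in>V. \<bar>g x\<bar> \<le> D * N x" using f g by (auto simp: dual_def)
  then have "\<forall>x\<in>V. \<bar>f x + g x\<bar> \<le> (C + D) * N x" by (fastforce simp: algebra_simps)
  then have "\<exists>D. \<forall>x\<in>V. \<bar>f x + g x\<bar> \<le> D * N x" by blast
  then show ?thesis using f g unfolding dual_def by (auto simp: algebra_simps)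
qed

lemma dual_closed_scale: "f \<in> dual V N \<Longrightarrow> (\<lambda>x. c * f x) \<in> dual V N"
proof -
  assume f: "f \<in> dual V N"
  then obtain C where C: "\<forall>x\<in>V. \<bar>f x\<bar> \<le> C * N x" by (auto simp: dual_def)
  have "\<bar>c * f x\<bar> \<le> (\<bar>c\<bar> * C) * N x" if "x \<in> V" for x
    using mult_left_mono[OF bspec[OF C that], of "\<bar>c\<bar>"] by (simp add: abs_mult mult.assoc)
  then have "\<exists>D. \<forall>x\<in>V. \<bar>c * f x\<bar> \<le> D * N x" by blast
  then show ?thesis using f unfolding dual_def by (auto simp: algebra_simps)
qed

lemma dual_closed_zero: "(\<lambda>x. 0) \<in> dual V N" unfolding dual_def by (auto intro!: exI[of _ 0])

lemma dual_closed_sum: "(\<And>j. j \<in> J \<Longrightarrow> g j \<in> dual V N) \<Longrightarrow> (\<lambda>x. \<Sum>j\<in>J. b j * g j x) \<in> dual V N"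
proof (induction J rule: infinite_finite_induct)
  case (insert j J)
  then have "(\<lambda>x. b j * g j x + (\<Sum>j\<in>J. b j * g j x)) \<in> dual V N"
    by (intro dual_closed_add dual_closed_scale) auto
  then show ?case using insert by simp
qed (simp_all add: dual_closed_zero)

end

section \<open>The complete norm and its two one-sided estimates\<close>

context lp_sum
begin

definition VX :: "(nat \<Rightarrow>\<^sub>C real) set" where
  "VX = {x. bdd_above (range (\<lambda>m. nm m (co x)))}"

definition NX :: "(nat \<Rightarrow>\<^sub>C real) \<Rightarrow> real" where
  "NX x = (SUP m. nm m (co x))"

lemma nm_le_NX: "x \<in> VX \<Longrightarrow> nm m (co x) \<le> NX x"
  unfolding NX_def VX_def by (auto intro: cSUP_upper)

lemma VX_I: "(\<And>m. nm m (co x) \<le> C) \<Longrightarrow> x \<in> VX"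
  unfolding VX_def by (auto intro: bdd_aboveI2[where M=C])

lemma NX_le: "(\<And>m. nm m (co x) \<le> C) \<Longrightarrow> NX x \<le> C"
  unfolding NX_def by (rule cSUP_least) auto

lemma NX_nonneg: "x \<in> VX \<Longrightarrow> 0 \<le> NX x" using nm_le_NX[of x 0] nm_nonneg[of 0 "co x"] by linarith

lemma coord_le: "x \<in> VX \<Longrightarrow> \<bar>co x n i\<bar> \<le> NX x"
  using nm_coord[of n "Suc (max n i)" i "co x"] nm_le_NX[of x "Suc (max n i)"] by (simp add: less_Suc_eq_le)

lemma co_fun: "co (x + y) = (\<lambda>n i. co x n i + co y n i)" "co (c *\<^sub>R x) = (\<lambda>n i. c * co x n i)"
  "co (\<Sum>j\<in>J. f j) = (\<lambda>n i. \<Sum>j\<in>J. co (f j) n i)"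
  by (auto simp: fun_eq_iff)

lemma nm_co_triangle: "nm m (co (x + y)) \<le> nm m (co x) + nm m (co y)"
  unfolding co_fun by (rule nm_triangle)

lemma nm_co_scale: "nm m (co (c *\<^sub>R x)) = \<bar>c\<bar> * nm m (co x)"
  unfolding co_fun by (rule nm_scale)

lemma NX_add: "x \<in> VX \<Longrightarrow> y \<in> VX \<Longrightarrow> x + y \<in> VX \<and> NX (x + y) \<le> NX x + NX y"
proof -
  assume "x \<in> VX" "y \<in> VX"
  then have "nm m (co (x + y)) \<le> NX x + NX y" for m
    using nm_co_triangle[of m x y] nm_le_NX[of x m] nm_le_NX[of y m] by linarith
  then show ?thesis using VX_I NX_le by blast
qed

lemma NX_scale_le: "x \<in> VX \<Longrightarrow> c *\<^sub>R x \<in> VX \<and> NX (c *\<^sub>R x) \<le> \<bar>c\<bar> * NX x"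
proof -
  assume "x \<in> VX"
  then have "nm m (co (c *\<^sub>R x)) \<le> \<bar>c\<bar> * NX x" for m
    unfolding nm_co_scale by (intro mult_left_mono nm_le_NX) auto
  then show ?thesis using VX_I NX_le by blast
qed

lemma nm_co_zero: "nm m (co 0) = 0"
  using nm_co_scale[of m 0 0] by simp

lemma normed_VX: "normed_on VX NX"
  unfolding normed_on_def
proof (intro conjI ballI allI)
  have zero: "0 \<in> VX" "NX 0 = 0"
    using VX_I[of 0 0] NX_le[of 0 0] NX_nonneg[of 0] by (auto simp: nm_co_zero)
  show "subspace VX"
    by (rule subspaceI) (use zero NX_add NX_scale_le in auto)
  fix x assume x: "x \<in> VX"
  show "0 \<le> NX x" by (rule NX_nonneg[OF x])
  show "NX x = 0 \<longleftrightarrow> x = 0"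
  proof
    assume "NX x = 0"
    then have "co x n i = 0" for n i using coord_le[OF x, of n i] by simp
    then show "x = 0" by (intro co_eqI) simp
  qed (simp add: zero)
  show "NX (x + y) \<le> NX x + NX y" if "y \<in> VX" for y using NX_add x that by blast
  show "NX (c *\<^sub>R x) = \<bar>c\<bar> * NX x" for c
  proof (cases "c = 0")
    case False
    have "NX (inverse c *\<^sub>R (c *\<^sub>R x)) \<le> \<bar>inverse c\<bar> * NX (c *\<^sub>R x)" using NX_scale_le x by blast
    then have "\<bar>c\<bar> * NX x \<le> NX (c *\<^sub>R x)" using False by (simp add: field_simps)
    then show ?thesis using NX_scale_le[OF x, of c] by simp
  qed (simp add: zero)
qed

sublocale X: normed_carrier VX NX by unfold_locales (rule normed_VX)

lemma banach_VX: "banach_on VX NX"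
  unfolding banach_on_def
proof (intro conjI normed_VX allI impI)
  fix x :: "nat \<Rightarrow> nat \<Rightarrow>\<^sub>C real" assume x: "range x \<subseteq> VX \<and> ncauchy NX x"
  then have xV: "x k \<in> VX" for k by auto
  have cauchy: "\<exists>M. \<forall>k\<ge>M. \<forall>l\<ge>M. NX (x k - x l) < e" if "e > 0" for e
    using x that by (auto simp: ncauchy_def)
  have "\<exists>F. (\<lambda>k. co (x k) n i) \<longlonglongrightarrow> F" for n i
  proof -
    have "Cauchy (\<lambda>k. co (x k) n i)"
    proof (rule metric_CauchyI)
      fix e :: real assume "e > 0"
      then obtain M where M: "\<forall>k\<ge>M. \<forall>l\<ge>M. NX (x k - x l) < e" using cauchy by blast
      have "dist (co (x k) n i) (co (x l) n i) < e" if "k \<ge> M" "l \<ge> M" for k l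
      proof -
        have "\<bar>co (x k - x l) n i\<bar> \<le> NX (x k - x l)" using coord_le X.V_diff xV by blast
        then show ?thesis using M that unfolding dist_real_def co_simps by (meson le_less_trans)
      qed
      then show "\<exists>M. \<forall>k\<ge>M. \<forall>l\<ge>M. dist (co (x k) n i) (co (x l) n i) < e" by blast
    qed
    then show ?thesis using Cauchy_convergent_iff convergent_def by blast
  qed
  then obtain F where F: "\<And>n i. (\<lambda>k. co (x k) n i) \<longlonglongrightarrow> F n i" by metis
  obtain M1 where M1: "\<forall>k\<ge>M1. \<forall>l\<ge>M1. NX (x k - x l) < 1" using cauchy[of 1] by auto
  define B where "B = NX (x M1) + 1"
  have bnd: "NX (x k) \<le> B" if "k \<ge> M1" for k
    using X.N_le_diff[OF xV xV, of k M1] M1 that unfolding B_def by (smt (verit) order_refl)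
  have "\<bar>F n i\<bar> \<le> B" for n i
  proof (rule LIMSEQ_le_const2)
    show "(\<lambda>k. \<bar>co (x k) n i\<bar>) \<longlonglongrightarrow> \<bar>F n i\<bar>" by (intro tendsto_intros F)
    show "\<exists>N. \<forall>k\<ge>N. \<bar>co (x k) n i\<bar> \<le> B" using coord_le[OF xV] bnd by (meson order_trans)
  qed
  then have coF: "co (mk F) = F" by (rule co_mk)
  define y where "y = mk F"
  \<comment> \<open>For fixed \<open>m\<close> the truncated norm is bounded by finitely many
    coordinates, so the coordinatewise limit in \<open>l\<close> may be taken; the resulting bound
    \<open>e\<close> does not depend on \<open>m\<close>.\<close>
  have near: "nm m (co (x k - y)) \<le> e" if e: "\<And>l. l \<ge> M \<Longrightarrow> NX (x k - x l) \<le> e" for M k e m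
  proof (rule LIMSEQ_le_const)
    have "(\<lambda>l. e + (\<Sum>n<m. \<Sum>i<m. \<bar>co (x l) n i - F n i\<bar>)) \<longlonglongrightarrow> e + (\<Sum>n<m. \<Sum>i<m. \<bar>F n i - F n i\<bar>)"
      by (intro tendsto_intros F)
    then show "(\<lambda>l. e + (\<Sum>n<m. \<Sum>i<m. \<bar>co (x l) n i - F n i\<bar>)) \<longlonglongrightarrow> e" by simp
    have "nm m (co (x k - y)) \<le> e + (\<Sum>n<m. \<Sum>i<m. \<bar>co (x l) n i - F n i\<bar>)" if "l \<ge> M" for l
    proof -
      have "nm m (co ((x k - x l) + (x l - y))) \<le> nm m (co (x k - x l)) + nm m (co (x l - y))" by (rule nm_co_triangle)
      moreover have "nm m (co (x k - x l)) \<le> e"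
        using nm_le_NX[OF X.V_diff[OF xV xV], of m k l] e[OF that] by linarith
      moreover have "nm m (co (x l - y)) \<le> (\<Sum>n<m. \<Sum>i<m. \<bar>co (x l) n i - F n i\<bar>)"
        using nm_le_sum[of m "co (x l - y)"] by (simp add: y_def coF)
      ultimately show ?thesis by simp
    qed
    then show "\<exists>N. \<forall>l\<ge>N. nm m (co (x k - y)) \<le> e + (\<Sum>n<m. \<Sum>i<m. \<bar>co (x l) n i - F n i\<bar>)" by blast
  qed
  \<comment> \<open>Membership of \<open>y\<close> itself is obtained from the difference with one
    member of the sequence, whose truncated norms are bounded by 1.\<close>
  have diffV: "x M1 - y \<in> VX"
    by (rule VX_I[where C=1], rule near[where M=M1]) (use M1 in \<open>auto intro: less_imp_le\<close>)
  then have yV: "y \<in> VX" using X.V_diff[OF xV[of M1] diffV] by simp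
  have "nlim NX x y"
    unfolding nlim_def
  proof (intro allI impI)
    fix e :: real assume "e > 0"
    then obtain M where M: "\<forall>k\<ge>M. \<forall>l\<ge>M. NX (x k - x l) < e / 2" using cauchy[of "e / 2"] by auto
    have "NX (x k - y) \<le> e / 2" if "k \<ge> M" for k
      by (rule NX_le, rule near[where M=M]) (use M that in \<open>auto intro: less_imp_le\<close>)
    then show "\<exists>M. \<forall>k\<ge>M. NX (x k - y) < e" using \<open>e > 0\<close> by (intro exI[of _ M]) force
  qed
  then show "\<exists>y\<in>VX. nlim NX x y" using yV by blast
qed

lemma finite_support_VX:
  assumes "\<And>n i. co x n i \<noteq> 0 \<Longrightarrow> n < M \<and> i < M"
  shows "x \<in> VX" "NX x = nm M (co x)"
proof -
  have le: "nm m (co x) \<le> nm M (co x)" for m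
  proof (cases "m \<le> M")
    case False
    then show ?thesis using nm_neutral[of M m "co x"] assms by simp
  qed (rule nm_mono_index)
  then show x: "x \<in> VX" by (rule VX_I)
  show "NX x = nm M (co x)" using NX_le[OF le] nm_le_NX[OF x, of M] by simp
qed

lemma unit_vec_VX: "unit_vec n i \<in> VX"
  by (rule finite_support_VX[where M="Suc (max n i)"]) (auto split: if_splits)

lemma pr_VX: "pr m x \<in> VX" and NX_pr: "NX (pr m x) = nm m (co x)"
proof -
  have fs: "\<And>n i. co (pr m x) n i \<noteq> 0 \<Longrightarrow> n < m \<and> i < m" by (auto split: if_splits)
  show "pr m x \<in> VX" by (rule finite_support_VX[OF fs])
  have "NX (pr m x) = nm m (co (pr m x))" by (rule finite_support_VX[OF fs])
  also have "\<dots> = nm m (co x)" by (rule nm_cong) simp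
  finally show "NX (pr m x) = nm m (co x)" .
qed

lemma NX_mono:
  assumes y: "y \<in> VX" and le: "\<And>n i. \<bar>co x n i\<bar> \<le> \<bar>co y n i\<bar>"
  shows "x \<in> VX" "NX x \<le> NX y"
proof -
  have "nm m (co x) \<le> NX y" for m using nm_mono[of m "co x" "co y"] le nm_le_NX[OF y, of m] by (meson order_trans)
  then show "x \<in> VX" "NX x \<le> NX y" using VX_I NX_le by blast+
qed

text \<open>The lower 3-estimate for the disjoint parts \<open>pr m x\<close> and
  \<open>x - pr m x\<close> bounds the cube of the tail by
  \<open>NX x ^ 3 - nm m (co x) ^ 3\<close>, and truncated norms increase to
  \<open>NX x\<close>.\<close>

lemma pr_tendsto:
  assumes x: "x \<in> VX" shows "(\<lambda>m. NX (x - pr m x)) \<longlonglongrightarrow> 0"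
proof -
  have "incseq (\<lambda>m. nm m (co x))" by (simp add: incseq_def nm_mono_index)
  then have lim: "(\<lambda>m. nm m (co x)) \<longlonglongrightarrow> NX x"
    unfolding NX_def using x by (intro LIMSEQ_incseq_SUP) (simp add: VX_def)
  have bound: "NX (x - pr m x) \<le> root 3 (NX x ^ 3 - nm m (co x) ^ 3)" for m
  proof -
    have ge: "nm M (co (x - pr m x)) ^ 3 \<le> NX x ^ 3 - nm m (co x) ^ 3" if M: "M \<ge> m" for M
    proof -
      have eqx: "(\<lambda>n i. co (x - pr m x) n i + co (pr m x) n i) = co x" by (auto simp: fun_eq_iff)
      have "nm M (co (pr m x)) = nm m (co (pr m x))"
        by (rule nm_neutral[OF M]) (auto split: if_splits)
      also have "\<dots> = nm m (co x)" by (rule nm_cong) simp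
      finally have eqp: "nm M (co (pr m x)) = nm m (co x)" .
      have "nm M (co (x - pr m x)) ^ 3 + nm M (co (pr m x)) ^ 3
          \<le> nm M (\<lambda>n i. co (x - pr m x) n i + co (pr m x) n i) ^ 3"
        by (rule nm_lower_estimate) simp
      then have "nm M (co (x - pr m x)) ^ 3 + nm m (co x) ^ 3 \<le> nm M (co x) ^ 3"
        unfolding eqx eqp .
      moreover have "nm M (co x) ^ 3 \<le> NX x ^ 3" by (intro power_mono nm_le_NX x) simp
      ultimately show ?thesis unfolding le_diff_eq by (rule order_trans)
    qed
    have max: "nm (max m M) (co (x - pr m x)) ^ 3 \<le> NX x ^ 3 - nm m (co x) ^ 3" for M
      by (rule ge[OF max.cobounded1])
    have all: "nm M (co (x - pr m x)) ^ 3 \<le> NX x ^ 3 - nm m (co x) ^ 3" for M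
      by (rule order_trans[OF power_mono[OF nm_mono_index[OF max.cobounded2] nm_nonneg] max])
    show ?thesis
    proof (rule NX_le)
      fix M
      have "nm M (co (x - pr m x)) = root 3 (nm M (co (x - pr m x)) ^ 3)"
        by (rule real_root_power_cancel[symmetric]) simp_all
      also have "\<dots> \<le> root 3 (NX x ^ 3 - nm m (co x) ^ 3)" by (rule real_root_le_mono[OF _ all]) simp
      finally show "nm M (co (x - pr m x)) \<le> root 3 (NX x ^ 3 - nm m (co x) ^ 3)" .
    qed
  qed
  have "(\<lambda>m. root 3 (NX x ^ 3 - nm m (co x) ^ 3)) \<longlonglongrightarrow> root 3 (NX x ^ 3 - NX x ^ 3)"
    by (intro tendsto_real_root tendsto_diff tendsto_power tendsto_const lim)
  then have root0: "(\<lambda>m. root 3 (NX x ^ 3 - nm m (co x) ^ 3)) \<longlonglongrightarrow> 0" by simp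
  have "norm (NX (x - pr m x)) \<le> root 3 (NX x ^ 3 - nm m (co x) ^ 3)" for m
    unfolding real_norm_def abs_of_nonneg[OF NX_nonneg[OF X.V_diff[OF x pr_VX]]] by (rule bound)
  then show ?thesis by (intro Lim_null_comparison[OF _ root0] always_eventually allI)
qed

lemma NX_upper_estimate:
  assumes x: "x \<in> VX" and y: "y \<in> VX" and disj: "\<And>n i. co x n i = 0 \<or> co y n i = 0"
  shows "NX (x + y) ^ 2 \<le> NX x ^ 2 + NX y ^ 2"
proof -
  have "nm m (co (x + y)) \<le> sqrt (NX x ^ 2 + NX y ^ 2)" for m
  proof (rule real_le_rsqrt)
    have eq: "co (x + y) = (\<lambda>n i. \<Sum>j\<in>UNIV. (if j then co x else co y) n i)"
      by (auto simp: fun_eq_iff UNIV_bool)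
    have "(nm m (co (x + y)))\<^sup>2 \<le> (\<Sum>j\<in>UNIV. (nm m (if j then co x else co y))\<^sup>2)"
      unfolding eq by (rule nm_upper_estimate) (use disj in \<open>auto split: if_splits\<close>)
    also have "\<dots> = (nm m (co x))\<^sup>2 + (nm m (co y))\<^sup>2" by (simp add: UNIV_bool)
    also have "\<dots> \<le> NX x ^ 2 + NX y ^ 2" by (intro add_mono power_mono nm_le_NX x y) auto
    finally show "(nm m (co (x + y)))\<^sup>2 \<le> NX x ^ 2 + NX y ^ 2" .
  qed
  then have "NX (x + y) \<le> sqrt (NX x ^ 2 + NX y ^ 2)" by (rule NX_le)
  then have "NX (x + y) ^ 2 \<le> sqrt (NX x ^ 2 + NX y ^ 2) ^ 2"
    using NX_nonneg[OF X.V_add[OF x y]] by (intro power_mono) auto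
  then show ?thesis by simp
qed

text \<open>The upper 2-estimate in the space dualises to a lower 2-estimate in the dual. Applied to a
  truncation almost attaining the norm of the functional it makes the tails small, that is, the unit
  vector basis is shrinking.\<close>

lemma dual_lower_estimate:
  assumes f: "f \<in> dual VX NX" and A: "A \<in> VX" "NX A \<le> 1" and B: "B \<in> VX" "NX B \<le> 1"
    and disj: "\<And>n i. co A n i = 0 \<or> co B n i = 0"
  shows "(f A)\<^sup>2 + (f B)\<^sup>2 \<le> (dualnorm VX NX f)\<^sup>2"
proof -
  define D where "D = dualnorm VX NX f"
  define s where "s = f A" define t where "t = f B"
  \<comment> \<open>The vector \<open>s *\<^sub>R A + t *\<^sub>R B\<close> is the extremal choice:
    \<open>f\<close> takes the value \<open>S\<close> there, while the upper 2-estimate bounds its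
    norm by the square root of \<open>S\<close>.\<close>
  define S where "S = s\<^sup>2 + t\<^sup>2"
  have V: "s *\<^sub>R A \<in> VX" "t *\<^sub>R B \<in> VX" using A B X.V_scale by auto
  have "f (s *\<^sub>R A + t *\<^sub>R B) = S"
    using f A B V by (simp add: X.dual_add X.dual_scale s_def t_def S_def power2_eq_square)
  then have "S \<le> D * NX (s *\<^sub>R A + t *\<^sub>R B)"
    using X.dualnorm_bound[OF f X.V_add[OF V]] by (simp add: D_def)
  moreover have "S \<ge> 0" by (simp add: S_def)
  ultimately have "S\<^sup>2 \<le> (D * NX (s *\<^sub>R A + t *\<^sub>R B))\<^sup>2" by (intro power_mono)
  also have "\<dots> = D\<^sup>2 * NX (s *\<^sub>R A + t *\<^sub>R B) ^ 2" by (simp add: power_mult_distrib)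
  also have "\<dots> \<le> D\<^sup>2 * S"
  proof (rule mult_left_mono)
    have "NX (s *\<^sub>R A + t *\<^sub>R B) ^ 2 \<le> NX (s *\<^sub>R A) ^ 2 + NX (t *\<^sub>R B) ^ 2"
      using disj by (intro NX_upper_estimate V) auto
    also have "\<dots> = s\<^sup>2 * NX A ^ 2 + t\<^sup>2 * NX B ^ 2"
      using A B by (simp add: X.N_scale power_mult_distrib)
    also have "\<dots> \<le> s\<^sup>2 * 1 + t\<^sup>2 * 1"
      using A B NX_nonneg by (intro add_mono mult_left_mono power_le_one) auto
    finally show "NX (s *\<^sub>R A + t *\<^sub>R B) ^ 2 \<le> S" by (simp add: S_def)
  qed simp
  finally have "S * S \<le> D\<^sup>2 * S" by (simp add: power2_eq_square)
  then have "S \<le> D\<^sup>2" using \<open>S \<ge> 0\<close> by (cases "S = 0") (auto simp: mult_le_cancel_right)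
  then show ?thesis by (simp add: S_def s_def t_def D_def)
qed

lemma shrinking:
  assumes f: "f \<in> dual VX NX" and e: "e > 0"
  shows "\<exists>M. \<forall>m\<ge>M. \<forall>y\<in>VX. NX y \<le> 1 \<longrightarrow> \<bar>f (y - pr m y)\<bar> \<le> e"
proof -
  define D where "D = dualnorm VX NX f"
  have D0: "0 \<le> D" using X.dualnorm_ge[OF f, of 0] by (simp add: D_def)
  \<comment> \<open>The threshold leaves at most \<open>e\<^sup>2\<close> for the square of
    \<open>f\<close> on any vector of the unit ball disjoint from a truncation of \<open>z\<close>
    that still exceeds it.\<close>
  have "\<exists>z\<in>VX. NX z \<le> 1 \<and> D\<^sup>2 - e\<^sup>2 < (f z)\<^sup>2"
  proof (rule ccontr)
    assume "\<not> ?thesis"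
    then have small: "(f z)\<^sup>2 \<le> D\<^sup>2 - e\<^sup>2" if "z \<in> VX" "NX z \<le> 1" for z using that by (auto simp: not_less)
    have "0 \<le> D\<^sup>2 - e\<^sup>2" using small[of 0] by (simp add: X.dual_zero[OF f])
    have "D \<le> sqrt (D\<^sup>2 - e\<^sup>2)" unfolding D_def
    proof (rule X.dualnorm_le)
      fix x assume "x \<in> VX" "NX x \<le> 1"
      then have "\<bar>f x\<bar>\<^sup>2 \<le> D\<^sup>2 - e\<^sup>2" using small by simp
      then show "\<bar>f x\<bar> \<le> sqrt ((dualnorm VX NX f)\<^sup>2 - e\<^sup>2)" unfolding D_def by (rule real_le_rsqrt)
    qed
    then have "D\<^sup>2 \<le> D\<^sup>2 - e\<^sup>2" using D0 \<open>0 \<le> D\<^sup>2 - e\<^sup>2\<close> by (metis power_mono real_sqrt_pow2)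
    then show False using e by simp
  qed
  then obtain z where z: "z \<in> VX" "NX z \<le> 1" "D\<^sup>2 - e\<^sup>2 < (f z)\<^sup>2" by blast
  have "(\<lambda>m. f (pr m z)) \<longlonglongrightarrow> f z"
  proof -
    have "(\<lambda>m. f (z - pr m z)) \<longlonglongrightarrow> 0"
    proof (rule Lim_null_comparison)
      show "\<forall>\<^sub>F m in sequentially. norm (f (z - pr m z)) \<le> D * NX (z - pr m z)"
        using X.dualnorm_bound[OF f X.V_diff[OF z(1) pr_VX]] by (auto simp: D_def)
      show "(\<lambda>m. D * NX (z - pr m z)) \<longlonglongrightarrow> 0" using tendsto_mult_left[OF pr_tendsto[OF z(1)], of D] by simp
    qed
    then have "(\<lambda>m. f z - f (z - pr m z)) \<longlonglongrightarrow> f z - 0" by (intro tendsto_intros)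
    then show ?thesis by (simp add: X.dual_diff[OF f z(1) pr_VX])
  qed
  then have "(\<lambda>m. (f (pr m z))\<^sup>2) \<longlonglongrightarrow> (f z)\<^sup>2" by (intro tendsto_intros)
  then have "\<forall>\<^sub>F m in sequentially. D\<^sup>2 - e\<^sup>2 < (f (pr m z))\<^sup>2" using z(3) by (rule order_tendstoD)
  then obtain M where M: "\<And>m. m \<ge> M \<Longrightarrow> D\<^sup>2 - e\<^sup>2 < (f (pr m z))\<^sup>2" by (auto simp: eventually_sequentially)
  have "\<bar>f (y - pr m y)\<bar> \<le> e" if m: "m \<ge> M" and y: "y \<in> VX" "NX y \<le> 1" for m y
  proof -
    have "NX (pr m z) \<le> NX z" "NX (y - pr m y) \<le> NX y"
      by (rule NX_mono; use z y in simp)+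
    then have "(f (pr m z))\<^sup>2 + (f (y - pr m y))\<^sup>2 \<le> D\<^sup>2"
      unfolding D_def using z y by (intro dual_lower_estimate[OF f] pr_VX X.V_diff) auto
    then have "(f (y - pr m y))\<^sup>2 \<le> e\<^sup>2" using M[OF m] by linarith
    then show ?thesis using e abs_le_square_iff[of "f (y - pr m y)" e] by simp
  qed
  then show ?thesis by blast
qed

text \<open>The coordinate functional, set to 0 outside the carrier as membership in
  \<open>dual\<close> demands.\<close>

definition ev :: "nat \<Rightarrow> nat \<Rightarrow> (nat \<Rightarrow>\<^sub>C real) \<Rightarrow> real" where
  "ev n i x = (if x \<in> VX then co x n i else 0)"

lemma ev_dual: "ev n i \<in> dual VX NX"
  unfolding dual_def ev_def using coord_le
  by (auto simp: X.V_add X.V_scale intro!: exI[of _ 1])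

text \<open>The values of \<open>\<Phi>\<close> on the coordinate functionals are the coordinates of
  the candidate \<open>x\<close>. Its truncated norms are bounded by finite-dimensional duality, and
  by \<open>shrinking\<close> each \<open>f\<close> is a limit in dual norm of finite combinations
  of coordinate functionals, on which \<open>\<Phi>\<close> is evaluation at
  \<open>x\<close>.\<close>

lemma reflexive_VX: "reflexive_on VX NX"
  unfolding reflexive_on_def
proof (intro allI impI, elim conjE exE)
  fix \<Phi> :: "((nat \<Rightarrow>\<^sub>C real) \<Rightarrow> real) \<Rightarrow> real" and C
  assume add: "\<forall>f\<in>dual VX NX. \<forall>g\<in>dual VX NX. \<Phi> (\<lambda>x. f x + g x) = \<Phi> f + \<Phi> g"
    and scale: "\<forall>f\<in>dual VX NX. \<forall>c. \<Phi> (\<lambda>x. c * f x) = c * \<Phi> f"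
    and C: "\<forall>f\<in>dual VX NX. \<bar>\<Phi> f\<bar> \<le> C * dualnorm VX NX f"
  have Phi_le: "\<bar>\<Phi> f\<bar> \<le> \<bar>C\<bar> * K" if f: "f \<in> dual VX NX" and K: "\<And>x. x \<in> VX \<Longrightarrow> NX x \<le> 1 \<Longrightarrow> \<bar>f x\<bar> \<le> K" for f K
  proof -
    have D: "0 \<le> dualnorm VX NX f" "dualnorm VX NX f \<le> K"
      using X.dualnorm_ge[OF f, of 0] X.dualnorm_le[OF K] by auto
    have "\<bar>\<Phi> f\<bar> \<le> C * dualnorm VX NX f" using C f by blast
    also have "\<dots> \<le> \<bar>C\<bar> * K" using D by (intro mult_mono) auto
    finally show ?thesis .
  qed
  have Phi_zero: "\<Phi> (\<lambda>x. 0) = 0" using bspec[OF scale X.dual_closed_zero, rule_format, of 0] by simp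
  have Phi_sum: "\<Phi> (\<lambda>x. \<Sum>j\<in>J. b j * g j x) = (\<Sum>j\<in>J. b j * \<Phi> (g j))"
    if "\<And>j. g j \<in> dual VX NX" for J :: "(nat \<times> nat) set" and b g
    using that
  proof (induction J rule: infinite_finite_induct)
    case (insert j J)
    have "\<Phi> (\<lambda>x. b j * g j x + (\<Sum>j\<in>J. b j * g j x)) = \<Phi> (\<lambda>x. b j * g j x) + \<Phi> (\<lambda>x. \<Sum>j\<in>J. b j * g j x)"
      by (rule bspec[OF bspec[OF add X.dual_closed_scale] X.dual_closed_sum]) (use insert.prems in auto)
    then show ?case using insert scale by simp
  qed (simp_all add: Phi_zero)
  define x where "x = mk (\<lambda>n i. \<Phi> (ev n i))"
  have "\<bar>\<Phi> (ev n i)\<bar> \<le> \<bar>C\<bar> * 1" for n i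
    by (rule Phi_le[OF ev_dual]) (auto simp: ev_def intro: order_trans[OF coord_le])
  then have cox: "co x n i = \<Phi> (ev n i)" for n i
    using co_mk[of "\<lambda>n i. \<Phi> (ev n i)" "\<bar>C\<bar>"] by (simp add: x_def)
  have Phi_finite: "\<Phi> (\<lambda>y. \<Sum>n<m. \<Sum>i<m. b n i * ev n i y) = (\<Sum>n<m. \<Sum>i<m. b n i * co x n i)" for m b
    using Phi_sum[of "\<lambda>j. ev (fst j) (snd j)" "\<lambda>j. b (fst j) (snd j)" "{..<m} \<times> {..<m}"] ev_dual
    by (simp add: sum.cartesian_product case_prod_beta cox)
  have nm_x: "nm m (co x) \<le> \<bar>C\<bar>" for m
  proof -
    \<comment> \<open>A functional below the seminorm \<open>nm m\<close> depends only on the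
      coordinates below \<open>m\<close>. Hence it agrees on \<open>VX\<close> with a finite
      combination of \<open>ev\<close>, whose image under \<open>\<Phi>\<close> is known.\<close>
    obtain f where f: "linear f" "\<And>y. \<bar>f y\<bar> \<le> nm m (co y)" "f x = nm m (co x)"
      by (rule seminorm_support_functional[of "\<lambda>y. nm m (co y)" x, OF nm_co_triangle nm_co_scale]) (rule that)
    have f_eq: "f y = (\<Sum>n<m. \<Sum>i<m. f (unit_vec n i) * co y n i)" for y
    proof -
      have "nm m (co (y - pr m y)) = nm m (co 0)" by (rule nm_cong) simp
      then have "f (y - pr m y) = 0" using f(2)[of "y - pr m y"] by (simp add: nm_co_zero)
      then have "f y = f (pr m y)" using f(1) by (simp add: linear_diff)
      then show ?thesis using f(1) by (simp add: pr_unit_vec linear_sum linear_cmul mult.commute)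
    qed
    define g where "g = (\<lambda>y. \<Sum>n<m. \<Sum>i<m. f (unit_vec n i) * ev n i y)"
    have g_eq: "g y = (if y \<in> VX then f y else 0)" for y
      by (simp add: g_def ev_def f_eq[of y])
    have g_bound: "\<bar>g y\<bar> \<le> NX y" if "y \<in> VX" for y
      using f(2)[of y] nm_le_NX[OF that, of m] that by (simp add: g_eq)
    have g_dual: "g \<in> dual VX NX"
      unfolding dual_def using f(1) g_bound
      by (auto simp: g_eq linear_add linear_cmul X.V_add X.V_scale intro!: exI[of _ 1])
    have "nm m (co x) = \<Phi> g" unfolding g_def Phi_finite f(3)[symmetric] by (rule f_eq)
    also have "\<dots> \<le> \<bar>C\<bar> * 1" using Phi_le[OF g_dual, of 1] g_bound by (meson abs_le_D1 order_trans)
    finally show ?thesis by simp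
  qed
  have xV: "x \<in> VX" by (rule VX_I[OF nm_x])
  show "\<exists>x\<in>VX. \<forall>f\<in>dual VX NX. \<Phi> f = f x"
  proof (intro bexI[OF _ xV] ballI)
    fix f assume f: "f \<in> dual VX NX"
    define g where "g m = (\<lambda>y. \<Sum>n<m. \<Sum>i<m. f (unit_vec n i) * ev n i y)" for m
    have f_pr: "f (pr m y) = (\<Sum>n<m. \<Sum>i<m. f (unit_vec n i) * co y n i)" for m y
      unfolding pr_unit_vec
      by (simp add: X.dual_sum[OF f] X.dual_scale[OF f] X.V_sum X.V_scale unit_vec_VX mult.commute)
    have g_eq: "g m y = (if y \<in> VX then f (pr m y) else 0)" for m y
      by (simp add: g_def ev_def f_pr)
    have g_dual: "g m \<in> dual VX NX" for m
      using X.dual_closed_sum[of "{..<m} \<times> {..<m}" "\<lambda>j. ev (fst j) (snd j)" "\<lambda>j. f (unit_vec (fst j) (snd j))"] ev_dual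
      by (simp add: g_def sum.cartesian_product case_prod_beta)
    have Phi_g: "\<Phi> (g m) = f (pr m x)" for m unfolding g_def Phi_finite f_pr ..
    have diff_dual: "(\<lambda>y. f y + (-1) * g m y) \<in> dual VX NX" for m
      by (intro X.dual_closed_add X.dual_closed_scale f g_dual)
    have Phi_diff: "\<Phi> (\<lambda>y. f y + (-1) * g m y) = \<Phi> f - f (pr m x)" for m
    proof -
      have "\<Phi> (\<lambda>y. f y + (-1) * g m y) = \<Phi> f + \<Phi> (\<lambda>y. (-1) * g m y)"
        by (rule bspec[OF bspec[OF add f] X.dual_closed_scale[OF g_dual]])
      moreover have "\<Phi> (\<lambda>y. (-1) * g m y) = (-1) * \<Phi> (g m)" using scale g_dual by blast
      ultimately show ?thesis using Phi_g[of m] by linarith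
    qed
    \<comment> \<open>\<open>g m\<close> is \<open>f\<close> composed with \<open>pr m\<close>, so
      \<open>shrinking\<close> says that \<open>f - g m\<close> tends to 0 uniformly on the unit
      ball, and boundedness of \<open>\<Phi>\<close> transfers this.\<close>
    have "(\<lambda>m. \<Phi> f - f (pr m x)) \<longlonglongrightarrow> 0"
    proof (rule LIMSEQ_I)
      fix e :: real assume e: "0 < e"
      define d where "d = e / (\<bar>C\<bar> + 1)"
      have d: "d > 0" "\<bar>C\<bar> * d < e" using e by (auto simp: d_def field_simps)
      obtain M where M: "\<And>m y. m \<ge> M \<Longrightarrow> y \<in> VX \<Longrightarrow> NX y \<le> 1 \<Longrightarrow> \<bar>f (y - pr m y)\<bar> \<le> d"
        using shrinking[OF f d(1)] by blast
      have "\<bar>\<Phi> (\<lambda>y. f y + (-1) * g m y)\<bar> \<le> \<bar>C\<bar> * d" if "m \<ge> M" for m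
      proof (rule Phi_le[OF diff_dual])
        fix y assume y: "y \<in> VX" "NX y \<le> 1"
        show "\<bar>f y + (-1) * g m y\<bar> \<le> d"
          using M[OF that y] y(1) by (simp add: g_eq X.dual_diff[OF f y(1) pr_VX])
      qed
      then have "norm (\<Phi> f - f (pr m x) - 0) < e" if "m \<ge> M" for m
        using d(2) that unfolding Phi_diff by fastforce
      then show "\<exists>M. \<forall>m\<ge>M. norm (\<Phi> f - f (pr m x) - 0) < e" by blast
    qed
    moreover have "(\<lambda>m. f (x - pr m x)) \<longlonglongrightarrow> 0"
    proof (rule Lim_null_comparison)
      show "\<forall>\<^sub>F m in sequentially. norm (f (x - pr m x)) \<le> dualnorm VX NX f * NX (x - pr m x)"
        using X.dualnorm_bound[OF f X.V_diff[OF xV pr_VX]] by auto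
      show "(\<lambda>m. dualnorm VX NX f * NX (x - pr m x)) \<longlonglongrightarrow> 0" using tendsto_mult_left[OF pr_tendsto[OF xV]] by fastforce
    qed
    ultimately have "(\<lambda>m. (\<Phi> f - f (pr m x)) - f (x - pr m x)) \<longlonglongrightarrow> 0 - 0" by (rule tendsto_diff)
    then have "(\<lambda>m::nat. \<Phi> f - f x) \<longlonglongrightarrow> 0" by (simp add: X.dual_diff[OF f xV pr_VX])
    then show "\<Phi> f = f x" by (simp add: LIMSEQ_const_iff)
  qed
qed

end

section \<open>Spreading models of the space\<close>

context lp_sum
begin

lemma disjoint_norm_sq:
  assumes J: "finite J"
    and supp: "\<And>j n i. j \<in> J \<Longrightarrow> co (u j) n i \<noteq> 0 \<Longrightarrow> n < M \<and> i < M"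
    and disj: "\<And>j k n i. j \<in> J \<Longrightarrow> k \<in> J \<Longrightarrow> j \<noteq> k \<Longrightarrow> co (u j) n i = 0 \<or> co (u k) n i = 0"
  shows "(NX (\<Sum>j\<in>J. b j *\<^sub>R u j))\<^sup>2 = (\<Sum>n<M. (lpn (p n) J (\<lambda>j. b j * lpn (p n) {..<M} (co (u j) n)))\<^sup>2)"
proof -
  define x where "x = (\<Sum>j\<in>J. b j *\<^sub>R u j)"
  have cox: "co x = (\<lambda>n i. \<Sum>j\<in>J. b j * co (u j) n i)" by (simp add: x_def fun_eq_iff)
  have "n < M \<and> i < M" if "co x n i \<noteq> 0" for n i
  proof -
    have "\<exists>j\<in>J. b j * co (u j) n i \<noteq> 0"
      using that unfolding cox by (meson sum.neutral)
    then show ?thesis using supp by auto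
  qed
  then have "NX x = nm M (co x)" by (rule finite_support_VX)
  then have "(NX x)\<^sup>2 = (nm M (\<lambda>n i. \<Sum>j\<in>J. b j * co (u j) n i))\<^sup>2" by (simp add: cox)
  also have "\<dots> = (\<Sum>n<M. (lpn (p n) J (\<lambda>j. lpn (p n) {..<M} (\<lambda>i. b j * co (u j) n i)))\<^sup>2)"
    by (rule nm_disjoint_sq[OF J]) (use disj in auto)
  also have "\<dots> = (\<Sum>n<M. (lpn (p n) J (\<lambda>j. b j * lpn (p n) {..<M} (co (u j) n)))\<^sup>2)"
    by (intro sum.cong refl arg_cong[of _ _ "\<lambda>x. x\<^sup>2"] lpn_cong) (simp add: lpn_scale p_pos abs_mult)
  finally show ?thesis by (simp add: x_def)
qed

text \<open>The component norms of \<open>u j\<close> are \<open>\<rho> j n\<close> with limits \<open>c n\<close>, and the squared limit norm is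
  squeezed around \<open>\<Sum>n. (c n)\<^sup>2 * (ell (p n) a)\<^sup>2\<close>. If \<open>\<Sum>n. (c n)\<^sup>2 = 1\<close> no mass escapes and the smallest exponent with
  \<open>c n > 0\<close> wins; otherwise the escaping mass lies in successive blocks of the outer \<open>l\<^sub>2\<close> sum.\<close>

lemma spreading_model_of_disjoint:
  fixes u :: "nat \<Rightarrow> (nat \<Rightarrow>\<^sub>C real)" and M :: "nat \<Rightarrow> nat"
  assumes two: "p n2 = 2" and least: "\<And>A. A \<noteq> {} \<Longrightarrow> \<exists>n\<in>A. \<forall>k\<in>A. p n \<le> p k"
    and supp: "\<And>j n i. co (u j) n i \<noteq> 0 \<Longrightarrow> n < M j \<and> i < M j"
    and disj: "\<And>j k n i. j \<noteq> k \<Longrightarrow> co (u j) n i = 0 \<or> co (u k) n i = 0"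
    and M: "incseq M" and u1: "\<And>j. NX (u j) \<le> 1" and ulim: "(\<lambda>j. NX (u j)) \<longlonglongrightarrow> 1"
    and c: "\<And>n. (\<lambda>j. lpn (p n) {..<M j} (co (u j) n)) \<longlonglongrightarrow> c n"
    and S: "c00_seminorm S"
    and lim: "\<And>(\<psi> :: nat \<Rightarrow> nat) m a. strict_mono \<psi> \<Longrightarrow>
      (\<lambda>t. NX (\<Sum>j<m. a j *\<^sub>R u (\<psi> (t + j)))) \<longlonglongrightarrow> S (\<lambda>i. if i < m then a i else 0)"
  shows "\<exists>n. equiv_sm S (ell (p n))"
proof -
  define \<rho> where "\<rho> j n = lpn (p n) {..<M j} (co (u j) n)" for j n
  have rho_ext: "lpn (p n) {..<K} (co (u j) n) = \<rho> j n" if "K \<ge> M j" for j n K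
    unfolding \<rho>_def
  proof (rule lpn_mono_neutral[symmetric])
    fix i assume "i \<in> {..<K} - {..<M j}"
    then show "co (u j) n i = 0" using supp[of j n i] by auto
  qed (use that in auto)
  have rho_zero: "\<rho> j n = 0" if "n \<ge> M j" for j n
    unfolding \<rho>_def by (rule lpn_zero) (use supp[of j n] that in force)
  have rho_nonneg: "0 \<le> \<rho> j n" for j n by (simp add: \<rho>_def)
  have c: "(\<lambda>j. \<rho> j n) \<longlonglongrightarrow> c n" for n unfolding \<rho>_def by (rule c)
  have c_nonneg: "0 \<le> c n" for n by (rule LIMSEQ_le_const[OF c]) (use rho_nonneg in auto)
  \<comment> \<open>From here on only the matrix \<open>\<rho>\<close> of component norms matters;
    \<open>K\<close> is any bound for the supports.\<close>
  have formula: "(NX (\<Sum>j<m. a j *\<^sub>R u (k j)))\<^sup>2 = (\<Sum>n<K. (lpn (p n) {..<m} (\<lambda>j. a j * \<rho> (k j) n))\<^sup>2)"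
    if k: "inj_on k {..<m}" and K: "\<And>j. j < m \<Longrightarrow> M (k j) \<le> K" for k :: "nat \<Rightarrow> nat" and m a K
  proof -
    have "(NX (\<Sum>j<m. a j *\<^sub>R u (k j)))\<^sup>2 = (\<Sum>n<K. (lpn (p n) {..<m} (\<lambda>j. a j * lpn (p n) {..<K} (co (u (k j)) n)))\<^sup>2)"
    proof (rule disjoint_norm_sq)
      show "n < K \<and> i < K" if "j \<in> {..<m}" "co (u (k j)) n i \<noteq> 0" for j n i
        using supp[OF that(2)] K[of j] that(1) by auto
      show "co (u (k i)) n i' = 0 \<or> co (u (k j)) n i' = 0" if "i \<in> {..<m}" "j \<in> {..<m}" "i \<noteq> j" for i j n i'
        using disj[of "k i" "k j"] k that by (auto simp: inj_on_def)
    qed simp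
    also have "\<dots> = (\<Sum>n<K. (lpn (p n) {..<m} (\<lambda>j. a j * \<rho> (k j) n))\<^sup>2)"
      by (intro sum.cong refl arg_cong[of _ _ "\<lambda>x. x\<^sup>2"] lpn_cong) (use rho_ext K in simp)
    finally show ?thesis .
  qed
  have u_sq: "(NX (u j))\<^sup>2 = (\<Sum>n<K. (\<rho> j n)\<^sup>2)" if "K \<ge> M j" for j K
  proof -
    have "NX (u j) = nm K (co (u j))"
      by (rule finite_support_VX) (use supp[of j] that in \<open>meson less_le_trans\<close>)
    then show ?thesis using that by (simp add: nm_sq rho_ext)
  qed
  have head: "(\<Sum>n<R. (\<rho> j n)\<^sup>2) \<le> 1" for R j
  proof -
    have "(\<Sum>n<R. (\<rho> j n)\<^sup>2) \<le> (\<Sum>n<max R (M j). (\<rho> j n)\<^sup>2)" by (rule sum_mono2) auto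
    also have "\<dots> = (NX (u j))\<^sup>2" by (rule u_sq[symmetric]) simp
    also have "\<dots> \<le> 1"
      using u1[of j] NX_nonneg[OF finite_support_VX(1)[of "u j" "M j"]] supp by (intro power_le_one) auto
    finally show ?thesis .
  qed
  have block: "(\<Sum>n\<in>{R..<K}. (\<rho> j n)\<^sup>2) = (NX (u j))\<^sup>2 - (\<Sum>n<R. (\<rho> j n)\<^sup>2)" if "M j \<le> K" "R \<le> K" for j R K
  proof -
    have "(\<Sum>n<K. (\<rho> j n)\<^sup>2) = (\<Sum>n<R. (\<rho> j n)\<^sup>2) + (\<Sum>n\<in>{R..<K}. (\<rho> j n)\<^sup>2)"
      using that(2) by (metis atLeast0LessThan le0 sum.atLeastLessThan_concat)
    then show ?thesis using u_sq[OF that(1)] by simp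
  qed
  define s where "s R = (\<Sum>n<R. (c n)\<^sup>2)" for R
  have s_lim: "(\<lambda>j. \<Sum>n<R. (\<rho> j n)\<^sup>2) \<longlonglongrightarrow> s R" for R
    unfolding s_def by (intro tendsto_intros c)
  have s1: "s R \<le> 1" for R by (rule LIMSEQ_le_const2[OF s_lim]) (use head in auto)
  have bounds: "(S a)\<^sup>2 \<le> (\<Sum>n<R. (c n)\<^sup>2 * (ell (p n) a)\<^sup>2) + (1 - s R) * (ell 2 a)\<^sup>2"
    "(\<Sum>n<R. (c n)\<^sup>2 * (ell (p n) a)\<^sup>2) \<le> (S a)\<^sup>2" if fin: "finsupp a" for a R
  proof -
    obtain m where m: "\<forall>i\<ge>m. a i = 0" using finsupp_bounded[OF fin] by blast
    have trunc: "(\<lambda>i. if i < m then a i else 0) = a" using m by (auto simp: fun_eq_iff not_less)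
    have ell_m: "ell q a = lpn q {..<m} a" for q by (rule ell_eq) (use m in auto)
    define Y where "Y t = (NX (\<Sum>j<m. a j *\<^sub>R u (t + j)))\<^sup>2" for t
    define H where "H t = (\<Sum>n<R. (lpn (p n) {..<m} (\<lambda>j. a j * \<rho> (t + j) n))\<^sup>2)" for t
    \<comment> \<open>Bounds what the components from \<open>R\<close> on contribute: there the
      \<open>lp\<close> norm is at most the \<open>l2\<close> norm, and the squared mass left to
      each vector is at most 1 minus that of its head.\<close>
    define E where "E t = (\<Sum>j<m. (a j)\<^sup>2 * (1 - (\<Sum>n<R. (\<rho> (t + j) n)\<^sup>2)))" for t
    have Ylim: "Y \<longlonglongrightarrow> (S a)\<^sup>2"
      using tendsto_power[OF lim[OF strict_mono_id, where m=m and a=a], of 2] unfolding trunc Y_def id_def .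
    have shift: "(\<lambda>t. \<rho> (t + j) n) \<longlonglongrightarrow> c n" for j n by (rule LIMSEQ_ignore_initial_segment[OF c])
    have "H \<longlonglongrightarrow> (\<Sum>n<R. (lpn (p n) {..<m} (\<lambda>j. a j * c n))\<^sup>2)"
      unfolding H_def by (intro tendsto_intros tendsto_lpn p_pos shift)
    also have "(\<Sum>n<R. (lpn (p n) {..<m} (\<lambda>j. a j * c n))\<^sup>2) = (\<Sum>n<R. (c n)\<^sup>2 * (ell (p n) a)\<^sup>2)"
    proof (rule sum.cong[OF refl])
      fix n
      have "lpn (p n) {..<m} (\<lambda>j. a j * c n) = \<bar>c n\<bar> * lpn (p n) {..<m} a"
        using lpn_scale[OF p_pos, of n "{..<m}" "c n" a] by (simp add: mult.commute)
      then show "(lpn (p n) {..<m} (\<lambda>j. a j * c n))\<^sup>2 = (c n)\<^sup>2 * (ell (p n) a)\<^sup>2"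
        by (simp add: ell_m power_mult_distrib)
    qed
    finally have Hlim: "H \<longlonglongrightarrow> (\<Sum>n<R. (c n)\<^sup>2 * (ell (p n) a)\<^sup>2)" .
    have "E \<longlonglongrightarrow> (\<Sum>j<m. (a j)\<^sup>2 * (1 - s R))"
      unfolding E_def by (intro tendsto_intros LIMSEQ_ignore_initial_segment[OF s_lim])
    also have "(\<Sum>j<m. (a j)\<^sup>2 * (1 - s R)) = (1 - s R) * (ell 2 a)\<^sup>2"
      unfolding ell_m lpn_2 by (simp add: sum_distrib_left mult.commute)
    finally have Elim: "E \<longlonglongrightarrow> (1 - s R) * (ell 2 a)\<^sup>2" .
    have HYE: "H t \<le> Y t" "Y t \<le> H t + E t" for t
    proof -
      define K where "K = R + (\<Sum>j<m. M (t + j))"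
      have MK: "M (t + j) \<le> K" if "j < m" for j
      proof -
        have "M (t + j) \<le> (\<Sum>j<m. M (t + j))" using that by (intro member_le_sum) auto
        then show ?thesis by (simp add: K_def)
      qed
      define g where "g n = (lpn (p n) {..<m} (\<lambda>j. a j * \<rho> (t + j) n))\<^sup>2" for n
      have Y: "Y t = (\<Sum>n<K. g n)"
        unfolding Y_def g_def by (rule formula) (auto simp: MK)
      also have "\<dots> = (\<Sum>n<R. g n) + (\<Sum>n\<in>{R..<K}. g n)"
        by (metis K_def atLeast0LessThan le0 le_add1 sum.atLeastLessThan_concat)
      finally have split: "Y t = H t + (\<Sum>n\<in>{R..<K}. g n)" by (simp add: H_def g_def)
      then show "H t \<le> Y t" by (simp add: sum_nonneg g_def)
      have "(\<Sum>n\<in>{R..<K}. g n) \<le> (\<Sum>n\<in>{R..<K}. \<Sum>j<m. (a j * \<rho> (t + j) n)\<^sup>2)"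
      proof (rule sum_mono)
        fix n
        have "lpn (p n) {..<m} (\<lambda>j. a j * \<rho> (t + j) n) \<le> lpn 2 {..<m} (\<lambda>j. a j * \<rho> (t + j) n)"
          by (rule lpn_antimono_exponent) (use p2 in auto)
        then show "g n \<le> (\<Sum>j<m. (a j * \<rho> (t + j) n)\<^sup>2)"
          unfolding g_def lpn_2[symmetric] by (intro power_mono) auto
      qed
      also have "\<dots> = (\<Sum>j<m. (a j)\<^sup>2 * (\<Sum>n\<in>{R..<K}. (\<rho> (t + j) n)\<^sup>2))"
        by (subst sum.swap) (simp add: power_mult_distrib sum_distrib_left)
      also have "\<dots> \<le> E t"
        unfolding E_def
      proof (intro sum_mono mult_left_mono)
        fix j assume "j \<in> {..<m}"
        then have "(\<Sum>n\<in>{R..<K}. (\<rho> (t + j) n)\<^sup>2) = (NX (u (t + j)))\<^sup>2 - (\<Sum>n<R. (\<rho> (t + j) n)\<^sup>2)"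
          by (intro block MK) (auto simp: K_def)
        moreover have "(NX (u (t + j)))\<^sup>2 \<le> 1" using u_sq[of "t + j" "M (t + j)"] head by simp
        ultimately show "(\<Sum>n\<in>{R..<K}. (\<rho> (t + j) n)\<^sup>2) \<le> 1 - (\<Sum>n<R. (\<rho> (t + j) n)\<^sup>2)" by simp
      qed simp
      finally show "Y t \<le> H t + E t" using split by simp
    qed
    show "(S a)\<^sup>2 \<le> (\<Sum>n<R. (c n)\<^sup>2 * (ell (p n) a)\<^sup>2) + (1 - s R) * (ell 2 a)\<^sup>2"
      by (rule LIMSEQ_le[OF Ylim tendsto_add[OF Hlim Elim]]) (use HYE in auto)
    show "(\<Sum>n<R. (c n)\<^sup>2 * (ell (p n) a)\<^sup>2) \<le> (S a)\<^sup>2"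
      by (rule LIMSEQ_le[OF Hlim Ylim]) (use HYE in auto)
  qed
  have S_nonneg: "finsupp a \<Longrightarrow> 0 \<le> S a" for a by (rule c00_seminorm_nonneg[OF S])
  have ell_nonneg: "0 \<le> ell q a" for q a by (simp add: ell_def)
  have summ: "summable (\<lambda>n. (c n)\<^sup>2)"
    by (rule summableI_nonneg_bounded[where x=1]) (use s1 in \<open>auto simp: s_def\<close>)
  define \<sigma> where "\<sigma> = (\<Sum>n. (c n)\<^sup>2)"
  have s_tendsto: "s \<longlonglongrightarrow> \<sigma>" using summable_LIMSEQ[OF summ] unfolding s_def \<sigma>_def .
  have s_le: "s R \<le> \<sigma>" for R unfolding s_def \<sigma>_def by (rule sum_le_suminf[OF summ]) auto
  have sigma1: "\<sigma> \<le> 1" by (rule LIMSEQ_le_const2[OF s_tendsto]) (use s1 in auto)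
  show ?thesis
  proof (cases "\<sigma> < 1")
    case True
    \<comment> \<open>With \<open>R = 0\<close> the upper bound is the \<open>l2\<close> norm, which
      is \<open>ell (p n2)\<close> because the exponent 2 occurs.\<close>
    have "S a \<le> 1 * ell (p n2) a" if "finsupp a" for a
      using bounds(1)[OF that, of 0] ell_nonneg[of 2 a] by (simp add: s_def two power2_le_iff_abs_le)
    then have up: "dominates (ell (p n2)) S" unfolding dominates_def by blast
    \<comment> \<open>Half of the escaping mass, which leaves a strict inequality that holds from
      some index on.\<close>
    define \<delta> where "\<delta> = (1 - \<sigma>) / 2"
    have \<delta>: "\<delta> > 0" using True by (simp add: \<delta>_def)
    have next_ex: "\<exists>j>k. (\<Sum>n<R. (\<rho> j n)\<^sup>2) \<le> (NX (u j))\<^sup>2 - \<delta>" for k R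
    proof -
      have "(\<lambda>j. (NX (u j))\<^sup>2 - (\<Sum>n<R. (\<rho> j n)\<^sup>2)) \<longlonglongrightarrow> 1\<^sup>2 - s R" by (intro tendsto_intros ulim s_lim)
      moreover have "\<delta> < 1\<^sup>2 - s R" using s_le[of R] True by (simp add: \<delta>_def)
      ultimately have "\<forall>\<^sub>F j in sequentially. \<delta> < (NX (u j))\<^sup>2 - (\<Sum>n<R. (\<rho> j n)\<^sup>2)" by (rule order_tendstoD)
      then have "\<forall>\<^sub>F j in sequentially. \<delta> < (NX (u j))\<^sup>2 - (\<Sum>n<R. (\<rho> j n)\<^sup>2) \<and> k < j"
        using eventually_gt_at_top[of k] by eventually_elim simp
      then obtain j where "\<delta> < (NX (u j))\<^sup>2 - (\<Sum>n<R. (\<rho> j n)\<^sup>2)" "k < j" by (auto simp: eventually_sequentially)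
      then show ?thesis by (intro exI[of _ j]) auto
    qed
    \<comment> \<open>Each chosen vector keeps squared mass at least \<open>\<delta>\<close> in
      components beyond the support of its predecessor. The conjunct \<open>True\<close> is the
      empty invariant in the shape of \<open>dependent_nat_choice\<close>.\<close>
    have "\<exists>\<psi>. \<forall>i. True \<and> (\<psi> i < \<psi> (Suc i) \<and>
        (\<Sum>n<M (\<psi> i). (\<rho> (\<psi> (Suc i)) n)\<^sup>2) \<le> (NX (u (\<psi> (Suc i))))\<^sup>2 - \<delta>)"
      by (rule dependent_nat_choice) (use next_ex in auto)
    then obtain \<psi> where psi_Suc: "\<And>i. \<psi> i < \<psi> (Suc i)"
      and psi_mass: "\<And>i. (\<Sum>n<M (\<psi> i). (\<rho> (\<psi> (Suc i)) n)\<^sup>2) \<le> (NX (u (\<psi> (Suc i))))\<^sup>2 - \<delta>" by blast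
    have psi: "strict_mono \<psi>" using psi_Suc by (simp add: strict_mono_Suc_iff)
    have M_psi: "M (\<psi> i) \<le> M (\<psi> j)" if "i \<le> j" for i j
      using M psi that by (meson incseqD strict_mono_less_eq)
    have "sqrt \<delta> * ell 2 a \<le> S a" if fin: "finsupp a" for a
    proof -
      obtain m where m: "\<forall>i\<ge>m. a i = 0" using finsupp_bounded[OF fin] by blast
      have trunc: "(\<lambda>i. if i < m then a i else 0) = a" using m by (auto simp: fun_eq_iff not_less)
      have ell_m: "ell q a = lpn q {..<m} a" for q by (rule ell_eq) (use m in auto)
      have "\<delta> * (ell 2 a)\<^sup>2 \<le> (NX (\<Sum>j<m. a j *\<^sub>R u (\<psi> (Suc t + j))))\<^sup>2" for t
      proof -
        define k where "k j = \<psi> (Suc t + j)" for j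
        define K where "K = M (\<psi> (t + m))"
        have MK: "M (k j) \<le> K" if "j < m" for j unfolding k_def K_def by (rule M_psi) (use that in simp)
        have inj: "inj_on k {..<m}" unfolding k_def by (rule inj_onI) (simp add: strict_mono_eq[OF psi])
        define g where "g n = (lpn (p n) {..<m} (\<lambda>j. a j * \<rho> (k j) n))\<^sup>2" for n
        \<comment> \<open>The components newly reached by the \<open>j\<close>-th vector. These
          blocks are disjoint, and inside \<open>B j\<close> all terms but the \<open>j\<close>-th
          are dropped from \<open>g\<close>. Starting \<open>k\<close> at \<open>Suc t\<close>
          provides a predecessor even for \<open>j = 0\<close>.\<close>
        define B where "B j = {M (\<psi> (t + j))..<M (k j)}" for j
        have BK: "(\<Union>j<m. B j) \<subseteq> {..<K}" using MK unfolding B_def by fastforce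
        have Bdisj: "B i \<inter> B j = {}" if "i \<noteq> j" for i j
        proof -
          have "B i \<inter> B j = {}" if "i < j" for i j
          proof -
            have "M (k i) \<le> M (\<psi> (t + j))" unfolding k_def by (rule M_psi) (use that in simp)
            then show ?thesis unfolding B_def by auto
          qed
          then show ?thesis using that by (metis Int_commute linorder_neqE_nat)
        qed
        have "\<delta> * (ell 2 a)\<^sup>2 = (\<Sum>j<m. (a j)\<^sup>2 * \<delta>)"
          unfolding ell_m lpn_2 by (simp add: sum_distrib_left mult.commute)
        also have "\<dots> \<le> (\<Sum>j<m. (a j)\<^sup>2 * (\<Sum>n\<in>B j. (\<rho> (k j) n)\<^sup>2))"
        proof (intro sum_mono mult_left_mono)
          fix j
          have "(\<Sum>n\<in>B j. (\<rho> (k j) n)\<^sup>2) = (NX (u (k j)))\<^sup>2 - (\<Sum>n<M (\<psi> (t + j)). (\<rho> (k j) n)\<^sup>2)"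
            unfolding B_def by (rule block) (auto simp: k_def intro: M_psi)
          then show "\<delta> \<le> (\<Sum>n\<in>B j. (\<rho> (k j) n)\<^sup>2)" using psi_mass[of "t + j"] by (simp add: k_def)
        qed simp
        also have "\<dots> \<le> (\<Sum>j<m. \<Sum>n\<in>B j. g n)"
        proof (rule sum_mono)
          fix j assume j: "j \<in> {..<m}"
          have "(a j * \<rho> (k j) n)\<^sup>2 \<le> g n" for n
          proof -
            have "\<bar>a j * \<rho> (k j) n\<bar> \<le> lpn (p n) {..<m} (\<lambda>j. a j * \<rho> (k j) n)"
              by (rule lpn_member[OF p_pos _ j]) simp
            then have "\<bar>a j * \<rho> (k j) n\<bar>\<^sup>2 \<le> g n" unfolding g_def by (rule power_mono) simp
            then show ?thesis by simp
          qed
          then show "(a j)\<^sup>2 * (\<Sum>n\<in>B j. (\<rho> (k j) n)\<^sup>2) \<le> (\<Sum>n\<in>B j. g n)"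
            unfolding sum_distrib_left power_mult_distrib[symmetric] by (intro sum_mono)
        qed
        also have "\<dots> = (\<Sum>n\<in>(\<Union>j<m. B j). g n)"
          by (rule sum.UNION_disjoint[symmetric]) (use Bdisj in \<open>auto simp: B_def\<close>)
        also have "\<dots> \<le> (\<Sum>n<K. g n)" using BK by (intro sum_mono2) (auto simp: g_def)
        also have "\<dots> = (NX (\<Sum>j<m. a j *\<^sub>R u (k j)))\<^sup>2"
          unfolding g_def by (rule formula[symmetric, OF inj MK])
        finally show ?thesis by (simp add: k_def)
      qed
      moreover have "(\<lambda>t. (NX (\<Sum>j<m. a j *\<^sub>R u (\<psi> (Suc t + j))))\<^sup>2) \<longlonglongrightarrow> (S a)\<^sup>2"
      proof -
        have sm: "strict_mono (\<lambda>t. \<psi> (Suc t))" using psi by (simp add: strict_mono_def)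
        show ?thesis using tendsto_power[OF lim[OF sm, where m=m and a=a], of 2] unfolding trunc by simp
      qed
      ultimately have "\<delta> * (ell 2 a)\<^sup>2 \<le> (S a)\<^sup>2" by (intro LIMSEQ_le_const) auto
      then have "(sqrt \<delta> * ell 2 a)\<^sup>2 \<le> (S a)\<^sup>2" using \<delta> by (simp add: power_mult_distrib)
      then show ?thesis by (rule power2_le_imp_le) (rule S_nonneg[OF fin])
    qed
    then have "ell (p n2) a \<le> inverse (sqrt \<delta>) * S a" if "finsupp a" for a
      using that \<delta> by (simp add: two field_simps)
    then have "dominates S (ell (p n2))" unfolding dominates_def by blast
    then show ?thesis using up unfolding equiv_sm_def by blast
  next
    case False
    then have sigma: "\<sigma> = 1" using sigma1 by simp
    have "{n. c n > 0} \<noteq> {}"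
    proof
      assume "{n. c n > 0} = {}"
      then have "c n = 0" for n using c_nonneg[of n] by (metis empty_Collect_eq order_le_less)
      then show False using sigma by (simp add: \<sigma>_def)
    qed
    \<comment> \<open>Infinitely many components may keep mass; an attained minimum of their
      exponents is what produces a single dominating \<open>lp\<close> norm.\<close>
    then obtain n0 where n0: "c n0 > 0" "\<And>k. c k > 0 \<Longrightarrow> p n0 \<le> p k" using least[of "{n. c n > 0}"] by auto
    have "ell (p n0) a \<le> inverse (c n0) * S a" if fin: "finsupp a" for a
    proof -
      have "(c n0)\<^sup>2 * (ell (p n0) a)\<^sup>2 \<le> (\<Sum>n<Suc n0. (c n)\<^sup>2 * (ell (p n) a)\<^sup>2)" by (simp add: sum_nonneg)
      also have "\<dots> \<le> (S a)\<^sup>2" by (rule bounds(2)[OF fin])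
      finally have "(c n0 * ell (p n0) a)\<^sup>2 \<le> (S a)\<^sup>2" by (simp add: power_mult_distrib)
      then have "c n0 * ell (p n0) a \<le> S a" by (rule power2_le_imp_le) (rule S_nonneg[OF fin])
      then show ?thesis using n0(1) by (simp add: field_simps)
    qed
    then have low: "dominates S (ell (p n0))" unfolding dominates_def by blast
    have "S a \<le> 1 * ell (p n0) a" if fin: "finsupp a" for a
    proof -
      \<comment> \<open>Exponents above the least one only decrease the norm. As \<open>R\<close>
        grows, \<open>1 - s R\<close> tends to 0 and removes the \<open>l2\<close> remainder, which
        could not be dominated otherwise.\<close>
      have le: "(S a)\<^sup>2 \<le> s R * (ell (p n0) a)\<^sup>2 + (1 - s R) * (ell 2 a)\<^sup>2" for R
      proof -
        have "(\<Sum>n<R. (c n)\<^sup>2 * (ell (p n) a)\<^sup>2) \<le> (\<Sum>n<R. (c n)\<^sup>2 * (ell (p n0) a)\<^sup>2)"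
        proof (rule sum_mono)
          fix n
          show "(c n)\<^sup>2 * (ell (p n) a)\<^sup>2 \<le> (c n)\<^sup>2 * (ell (p n0) a)\<^sup>2"
          proof (cases "c n = 0")
            case False
            then have "p n0 \<le> p n" using n0(2)[of n] c_nonneg[of n] by simp
            then have "ell (p n) a \<le> ell (p n0) a"
              unfolding ell_def using fin p_pos by (intro lpn_antimono_exponent) (auto simp: finsupp_def)
            then show ?thesis by (intro mult_left_mono power_mono ell_nonneg) auto
          qed simp
        qed
        also have "\<dots> = s R * (ell (p n0) a)\<^sup>2" by (simp add: s_def sum_distrib_right)
        finally show ?thesis using bounds(1)[OF fin, of R] by simp
      qed
      have "(\<lambda>R. s R * (ell (p n0) a)\<^sup>2 + (1 - s R) * (ell 2 a)\<^sup>2) \<longlonglongrightarrow> \<sigma> * (ell (p n0) a)\<^sup>2 + (1 - \<sigma>) * (ell 2 a)\<^sup>2"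
        by (intro tendsto_intros s_tendsto)
      then have "(\<lambda>R. s R * (ell (p n0) a)\<^sup>2 + (1 - s R) * (ell 2 a)\<^sup>2) \<longlonglongrightarrow> (ell (p n0) a)\<^sup>2" by (simp add: sigma)
      then have "(S a)\<^sup>2 \<le> (ell (p n0) a)\<^sup>2" by (rule LIMSEQ_le_const) (use le in auto)
      then show ?thesis using power2_le_imp_le[OF _ ell_nonneg] by simp
    qed
    then have "dominates (ell (p n0)) S" unfolding dominates_def by blast
    then show ?thesis using low unfolding equiv_sm_def by blast
  qed
qed

text \<open>Gliding hump. For a given left end \<open>l\<close>, the head of \<open>z k\<close> is
  small for late \<open>k\<close> because coordinates tend to 0; then \<open>pr_tendsto\<close>
  supplies a right end \<open>r\<close> with small tail. Each error gets half of the
  allowance.\<close>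

lemma disjoint_blocks:
  fixes z :: "nat \<Rightarrow> (nat \<Rightarrow>\<^sub>C real)"
  assumes z: "\<And>k. z k \<in> VX" and null: "\<And>n i. (\<lambda>k. co (z k) n i) \<longlonglongrightarrow> 0"
  obtains k l r :: "nat \<Rightarrow> nat" where "strict_mono k" "\<And>j. l j \<le> r j" "\<And>j. l (Suc j) = r j"
    "\<And>j. NX (z (k j) - (pr (r j) (z (k j)) - pr (l j) (z (k j)))) \<le> 1 / (real j + 1)"
proof -
  define P where "P j = (\<lambda>(k::nat, l::nat, r::nat). l \<le> r \<and> NX (z k - (pr r (z k) - pr l (z k))) \<le> 1 / (real j + 1))" for j :: nat
  define Q where "Q = (\<lambda>(k::nat, l::nat, r::nat) (k'::nat, l'::nat, r'::nat). k < k' \<and> l' = r)"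
  have ex: "\<exists>k r. K < k \<and> l \<le> r \<and> NX (z k - (pr r (z k) - pr l (z k))) \<le> e" if e: "e > 0" for K l e
  proof -
    have "(\<lambda>k. \<Sum>n<l. \<Sum>i<l. \<bar>co (z k) n i\<bar>) \<longlonglongrightarrow> (\<Sum>n<l. \<Sum>i<l. \<bar>0\<bar>)" by (intro tendsto_intros null)
    then have "(\<lambda>k. \<Sum>n<l. \<Sum>i<l. \<bar>co (z k) n i\<bar>) \<longlonglongrightarrow> 0" by simp
    then have "\<forall>\<^sub>F k in sequentially. (\<Sum>n<l. \<Sum>i<l. \<bar>co (z k) n i\<bar>) < e / 2" using e by (intro order_tendstoD) auto
    then have "\<forall>\<^sub>F k in sequentially. (\<Sum>n<l. \<Sum>i<l. \<bar>co (z k) n i\<bar>) < e / 2 \<and> K < k"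
      using eventually_gt_at_top[of K] by eventually_elim simp
    then obtain k where k: "(\<Sum>n<l. \<Sum>i<l. \<bar>co (z k) n i\<bar>) < e / 2" "K < k" by (auto simp: eventually_sequentially)
    have "\<forall>\<^sub>F r in sequentially. NX (z k - pr r (z k)) < e / 2"
      using pr_tendsto[OF z[of k]] e by (intro order_tendstoD) auto
    then have "\<forall>\<^sub>F r in sequentially. NX (z k - pr r (z k)) < e / 2 \<and> l \<le> r"
      using eventually_ge_at_top[of l] by eventually_elim simp
    then obtain r where r: "NX (z k - pr r (z k)) < e / 2" "l \<le> r" by (auto simp: eventually_sequentially)
    have "NX (pr l (z k)) < e / 2" using nm_le_sum[of l "co (z k)"] k(1) by (simp add: NX_pr)
    moreover have "NX (z k - (pr r (z k) - pr l (z k))) \<le> NX (z k - pr r (z k)) + NX (pr l (z k))"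
    proof -
      have "z k - (pr r (z k) - pr l (z k)) = (z k - pr r (z k)) + pr l (z k)" by simp
      then show ?thesis using X.N_triangle[OF X.V_diff[OF z[of k] pr_VX[of r "z k"]] pr_VX[of l "z k"]] by (simp only:)
    qed
    ultimately have "NX (z k - (pr r (z k) - pr l (z k))) \<le> e" using r(1) by linarith
    then show ?thesis using k(2) r(2) by blast
  qed
  have "\<exists>f. \<forall>j. P j (f j) \<and> Q (f j) (f (Suc j))"
  proof (rule dependent_nat_choice)
    show "\<exists>x. P 0 x" using ex[of 1 0 0] by (auto simp: P_def)
  next
    fix x j assume "P j x"
    obtain k l r where x: "x = (k, l, r)" by (cases x)
    obtain k' r' where "k < k'" "r \<le> r'" "NX (z k' - (pr r' (z k') - pr r (z k'))) \<le> 1 / (real (Suc j) + 1)"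
      using ex[of "1 / (real (Suc j) + 1)" k r] by (auto simp: add_pos_nonneg)
    then show "\<exists>y. P (Suc j) y \<and> Q x y" by (intro exI[of _ "(k', r, r')"]) (simp add: P_def Q_def x)
  qed
  then obtain f where f: "\<And>j. P j (f j)" "\<And>j. Q (f j) (f (Suc j))" by blast
  define k where "k j = fst (f j)" for j
  define l where "l j = fst (snd (f j))" for j
  define r where "r j = snd (snd (f j))" for j
  have f_eq: "f j = (k j, l j, r j)" for j by (simp add: k_def l_def r_def)
  have "k j < k (Suc j)" "l (Suc j) = r j" for j using f(2)[of j] by (auto simp: Q_def f_eq)
  moreover have "l j \<le> r j" "NX (z (k j) - (pr (r j) (z (k j)) - pr (l j) (z (k j)))) \<le> 1 / (real j + 1)" for j
    using f(1)[of j] by (auto simp: P_def f_eq)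
  ultimately show ?thesis using that[of k l r] by (simp add: strict_mono_Suc_iff)
qed

text \<open>The sequence is replaced by disjoint blocks with the same asymptotic norms and then
  thinned until all component norms converge, which is the situation of
  \<open>spreading_model_of_disjoint\<close>.\<close>

lemma wsm_equiv_ell:
  assumes two: "p n2 = 2" and least: "\<And>A. A \<noteq> {} \<Longrightarrow> \<exists>n\<in>A. \<forall>k\<in>A. p n \<le> p k"
    and S: "S \<in> wsm VX NX"
  shows "\<exists>n. equiv_sm S (ell (p n))"
proof -
  obtain z where z1: "\<And>k. NX (z k) = 1" and zw: "weakly_null VX NX z" and gen: "generates_sm NX z S"
    using S by (auto simp: wsm_def normalized_seq_def)
  have zV: "z k \<in> VX" for k using zw by (auto simp: weakly_null_def)
  have null: "(\<lambda>k. co (z k) n i) \<longlonglongrightarrow> 0" for n i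
  proof -
    have "(\<lambda>k. ev n i (z k)) \<longlonglongrightarrow> 0" using zw ev_dual by (simp add: weakly_null_def)
    then show ?thesis by (simp add: ev_def zV)
  qed
  obtain k l r where k: "strict_mono k" and lr: "\<And>j. l j \<le> r j" "\<And>j. l (Suc j) = r j"
    and err: "\<And>j. NX (z (k j) - (pr (r j) (z (k j)) - pr (l j) (z (k j)))) \<le> 1 / (real j + 1)"
    by (rule disjoint_blocks[OF zV null]) (rule that)
  define v where "v j = pr (r j) (z (k j)) - pr (l j) (z (k j))" for j
  have vV: "v j \<in> VX" for j unfolding v_def by (intro X.V_diff pr_VX)
  have co_v: "co (v j) n i = (if n < r j \<and> i < r j \<and> \<not> (n < l j \<and> i < l j) then co (z (k j)) n i else 0)" for j n i
    using lr(1)[of j] by (auto simp: v_def)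
  have r_mono: "incseq r"
  proof (rule incseq_SucI)
    fix j show "r j \<le> r (Suc j)" using lr(1)[of "Suc j"] lr(2)[of j] by simp
  qed
  have rl: "r i \<le> l j" if "i < j" for i j
  proof -
    define j' where "j' = j - 1"
    have j': "j = Suc j'" "i \<le> j'" using that by (auto simp: j'_def)
    then show ?thesis using incseqD[OF r_mono j'(2)] lr(2)[of j'] by simp
  qed
  have v_supp: "n < r j \<and> i < r j" if "co (v j) n i \<noteq> 0" for j n i using that by (auto simp: co_v split: if_splits)
  have v_disj: "co (v i) n m = 0 \<or> co (v j) n m = 0" if "i \<noteq> j" for i j n m
  proof -
    have "co (v i) n m = 0 \<or> co (v j) n m = 0" if "i < j" for i j
      using rl[OF that] by (auto simp: co_v)
    then show ?thesis using that by (metis linorder_neqE_nat)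
  qed
  have v1: "NX (v j) \<le> 1" for j
  proof -
    have "NX (v j) \<le> NX (z (k j))" by (rule NX_mono[OF zV]) (simp add: co_v)
    then show ?thesis by (simp add: z1)
  qed
  have err0: "(\<lambda>j. NX (z (k j) - v j)) \<longlonglongrightarrow> 0"
  proof (rule Lim_null_comparison)
    show "\<forall>\<^sub>F j in sequentially. norm (NX (z (k j) - v j)) \<le> inverse (real (Suc j))"
      using err X.N_nonneg[OF X.V_diff[OF zV vV]] by (simp add: v_def inverse_eq_divide add.commute)
  qed (rule LIMSEQ_inverse_real_of_nat)
  have v_lim: "(\<lambda>j. NX (v j)) \<longlonglongrightarrow> 1"
  proof -
    have "(\<lambda>j. NX (v j) - 1) \<longlonglongrightarrow> 0"
    proof (rule Lim_null_comparison[OF _ err0])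
      have "\<bar>NX (v j) - 1\<bar> \<le> NX (z (k j) - v j)" for j
        using X.N_abs_diff_le[OF zV vV, of "k j" j] by (simp add: z1 abs_minus_commute)
      then show "\<forall>\<^sub>F j in sequentially. norm (NX (v j) - 1) \<le> NX (z (k j) - v j)" by simp
    qed
    then show ?thesis by (simp add: LIM_zero_iff)
  qed
  define \<rho> where "\<rho> j n = lpn (p n) {..<r j} (co (v j) n)" for j n
  have rho1: "norm (\<rho> j n) \<le> 1" for j n
  proof -
    have "\<rho> j n \<le> lpn (p n) {..<max (r j) (Suc n)} (co (v j) n)"
      unfolding \<rho>_def by (rule lpn_mono_set[OF p_pos]) auto
    also have "\<dots> \<le> nm (max (r j) (Suc n)) (co (v j))"
      unfolding nm_def by (rule member_le_L2_set) auto
    also have "\<dots> \<le> 1" using nm_le_NX[OF vV] v1 by (rule order_trans)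
    finally show ?thesis by (simp add: \<rho>_def)
  qed
  obtain q where q: "strict_mono q" "\<And>n. n \<in> UNIV \<Longrightarrow> \<exists>c. (\<lambda>j. \<rho> (q j) n) \<longlonglongrightarrow> c"
    by (rule function_convergent_subsequence[of "UNIV :: nat set" \<rho> 1]) (use rho1 in auto)
  have "\<forall>n. \<exists>c. (\<lambda>j. \<rho> (q j) n) \<longlonglongrightarrow> c" using q(2) by simp
  then obtain c where c: "\<And>n. (\<lambda>j. \<rho> (q j) n) \<longlonglongrightarrow> c n" by metis
  \<comment> \<open>The blocks differ from the vectors \<open>z (k j)\<close> by a null sequence, so
    they have the same limits along every further subsequence. The freedom in \<open>\<psi>\<close>
    serves the case of escaping mass, where a sparse subsequence is chosen.\<close>
  have lim: "(\<lambda>t. NX (\<Sum>j<m. a j *\<^sub>R v (q (\<psi> (t + j))))) \<longlonglongrightarrow> S (\<lambda>i. if i < m then a i else 0)"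
    if psi: "strict_mono \<psi>" for \<psi> :: "nat \<Rightarrow> nat" and m a
  proof -
    define \<phi> where "\<phi> i = q (\<psi> i)" for i
    have phi: "strict_mono \<phi>" unfolding \<phi>_def using strict_mono_o[OF q(1) psi] by (simp add: comp_def)
    have kphi: "strict_mono (\<lambda>i. k (\<phi> i))" using strict_mono_o[OF k phi] by (simp add: comp_def)
    define A where "A t = (\<Sum>j<m. a j *\<^sub>R z (k (\<phi> (t + j))))" for t
    define B where "B t = (\<Sum>j<m. a j *\<^sub>R v (\<phi> (t + j)))" for t
    have AV: "A t \<in> VX" and BV: "B t \<in> VX" for t
      unfolding A_def B_def by (intro X.V_sum X.V_scale zV vV)+
    have Alim: "(\<lambda>t. NX (A t)) \<longlonglongrightarrow> S (\<lambda>i. if i < m then a i else 0)"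
      unfolding A_def by (rule X.spreading_model_limit[OF _ gen kphi]) (use zV in auto)
    have "(\<lambda>t. NX (A t) - NX (B t)) \<longlonglongrightarrow> 0"
    proof (rule Lim_null_comparison)
      have "\<bar>NX (A t) - NX (B t)\<bar> \<le> (\<Sum>j<m. \<bar>a j\<bar> * NX (z (k (\<phi> (t + j))) - v (\<phi> (t + j))))" for t
      proof -
        have eq: "A t - B t = (\<Sum>j<m. a j *\<^sub>R (z (k (\<phi> (t + j))) - v (\<phi> (t + j))))"
          by (simp add: A_def B_def sum_subtractf scaleR_diff_right)
        have "\<bar>NX (A t) - NX (B t)\<bar> \<le> NX (A t - B t)" by (rule X.N_abs_diff_le[OF AV BV])
        also have "\<dots> \<le> (\<Sum>j<m. NX (a j *\<^sub>R (z (k (\<phi> (t + j))) - v (\<phi> (t + j)))))"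
          unfolding eq by (rule X.N_sum_le) (auto intro: X.V_scale X.V_diff zV vV)
        also have "\<dots> = (\<Sum>j<m. \<bar>a j\<bar> * NX (z (k (\<phi> (t + j))) - v (\<phi> (t + j))))"
          by (intro sum.cong refl X.N_scale X.V_diff zV vV)
        finally show ?thesis .
      qed
      then show "\<forall>\<^sub>F t in sequentially. norm (NX (A t) - NX (B t)) \<le> (\<Sum>j<m. \<bar>a j\<bar> * NX (z (k (\<phi> (t + j))) - v (\<phi> (t + j))))"
        by simp
      have "(\<lambda>t. \<Sum>j<m. \<bar>a j\<bar> * NX (z (k (\<phi> (t + j))) - v (\<phi> (t + j)))) \<longlonglongrightarrow> (\<Sum>j<m. \<bar>a j\<bar> * 0)"
        using LIMSEQ_ignore_initial_segment[OF LIMSEQ_subseq_LIMSEQ[OF err0 phi]]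
        by (intro tendsto_intros) (simp add: comp_def)
      then show "(\<lambda>t. \<Sum>j<m. \<bar>a j\<bar> * NX (z (k (\<phi> (t + j))) - v (\<phi> (t + j)))) \<longlonglongrightarrow> 0" by simp
    qed
    then have "(\<lambda>t. NX (A t) - (NX (A t) - NX (B t))) \<longlonglongrightarrow> S (\<lambda>i. if i < m then a i else 0) - 0"
      by (intro tendsto_diff Alim)
    then show ?thesis by (simp add: B_def \<phi>_def)
  qed
  show ?thesis
  proof (rule spreading_model_of_disjoint[of n2 "\<lambda>j. v (q j)" "\<lambda>j. r (q j)" c S])
    show "p n2 = 2" by (rule two)
    show "\<exists>n\<in>A. \<forall>k\<in>A. p n \<le> p k" if "A \<noteq> {}" for A using that by (rule least)
    show "n < r (q j) \<and> i < r (q j)" if "co (v (q j)) n i \<noteq> 0" for j n i using that by (rule v_supp)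
    show "co (v (q i)) n m = 0 \<or> co (v (q j)) n m = 0" if "i \<noteq> j" for i j n m
      using that q(1) by (intro v_disj) (simp add: strict_mono_eq)
    show "incseq (\<lambda>j. r (q j))" using r_mono q(1) by (simp add: incseq_def strict_mono_less_eq)
    show "NX (v (q j)) \<le> 1" for j by (rule v1)
    show "(\<lambda>j. NX (v (q j))) \<longlonglongrightarrow> 1" using LIMSEQ_subseq_LIMSEQ[OF v_lim q(1)] by (simp add: comp_def)
    show "(\<lambda>j. lpn (p n) {..<r (q j)} (co (v (q j)) n)) \<longlonglongrightarrow> c n" for n using c[of n] by (simp add: \<rho>_def)
    show "c00_seminorm S" by (rule wsm_seminorm[OF S])
    show "(\<lambda>t. NX (\<Sum>j<m. a j *\<^sub>R v (q (\<psi> (t + j))))) \<longlonglongrightarrow> S (\<lambda>i. if i < m then a i else 0)"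
      if "strict_mono \<psi>" for \<psi> :: "nat \<Rightarrow> nat" and m a using that by (rule lim)
  qed
qed

section \<open>The unit vectors of a single component\<close>

lemma NX_unit_vec_sum:
  fixes k :: "nat \<Rightarrow> nat" and m :: nat
  assumes k: "inj_on k {..<m}"
  shows "NX (\<Sum>j<m. a j *\<^sub>R unit_vec n (k j)) = lpn (p n) {..<m} a"
proof -
  define M where "M = Suc (n + (\<Sum>j<m. k j))"
  have kM: "k j < M" if "j < m" for j
  proof -
    have "k j \<le> (\<Sum>j<m. k j)" using that by (intro member_le_sum) auto
    then show ?thesis by (simp add: M_def)
  qed
  have row: "lpn (p n') {..<M} (co (unit_vec n (k j)) n') = (if n' = n then 1 else 0)" if "j < m" for j n'
  proof (cases "n' = n")
    case True
    have "(\<Sum>i<M. \<bar>co (unit_vec n (k j)) n' i\<bar> powr p n') = (\<Sum>i<M. if i = k j then 1 else 0)"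
      using True by (intro sum.cong) auto
    then show ?thesis using kM[OF that] True by (simp add: lpn_def)
  qed (simp add: lpn_zero)
  have "(NX (\<Sum>j<m. a j *\<^sub>R unit_vec n (k j)))\<^sup>2
      = (\<Sum>n'<M. (lpn (p n') {..<m} (\<lambda>j. a j * lpn (p n') {..<M} (co (unit_vec n (k j)) n')))\<^sup>2)"
  proof (rule disjoint_norm_sq)
    show "n' < M \<and> i < M" if "j \<in> {..<m}" "co (unit_vec n (k j)) n' i \<noteq> 0" for j n' i
      using that kM[of j] by (auto simp: M_def split: if_splits)
    show "co (unit_vec n (k i)) n' i' = 0 \<or> co (unit_vec n (k j)) n' i' = 0"
      if "i \<in> {..<m}" "j \<in> {..<m}" "i \<noteq> j" for i j n' i'
      using that k by (auto simp: inj_on_def)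
  qed simp
  also have "\<dots> = (\<Sum>n'<M. if n' = n then (lpn (p n) {..<m} a)\<^sup>2 else 0)"
  proof (rule sum.cong[OF refl])
    fix n'
    have "lpn (p n') {..<m} (\<lambda>j. a j * lpn (p n') {..<M} (co (unit_vec n (k j)) n'))
        = lpn (p n') {..<m} (\<lambda>j. a j * (if n' = n then 1 else 0))"
      by (rule lpn_cong) (simp add: row)
    then show "(lpn (p n') {..<m} (\<lambda>j. a j * lpn (p n') {..<M} (co (unit_vec n (k j)) n')))\<^sup>2
        = (if n' = n then (lpn (p n) {..<m} a)\<^sup>2 else 0)"
      by (simp add: lpn_zero)
  qed
  also have "\<dots> = (lpn (p n) {..<m} a)\<^sup>2" by (simp add: M_def)
  finally have sq: "(NX (\<Sum>j<m. a j *\<^sub>R unit_vec n (k j)))\<^sup>2 = (lpn (p n) {..<m} a)\<^sup>2" .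
  have "0 \<le> NX (\<Sum>j<m. a j *\<^sub>R unit_vec n (k j))"
    by (intro X.N_nonneg X.V_sum X.V_scale unit_vec_VX)
  then show ?thesis using sq by (simp add: power2_eq_iff_nonneg)
qed

text \<open>Unit vectors of one component span an \<open>lp\<close> norm isometrically on every
  index choice, so the spreading model is generated with error 0 and the basis constant is
  1.\<close>

lemma ell_in_wsm: "ell (p n) \<in> wsm VX NX"
proof -
  define x where "x i = unit_vec n i" for i
  have xV: "x i \<in> VX" for i by (simp add: x_def unit_vec_VX)
  have norm: "NX (\<Sum>j<m. a j *\<^sub>R x (k j)) = lpn (p n) {..<m} a" if "inj_on k {..<m}" for m :: nat and a k
    unfolding x_def by (rule NX_unit_vec_sum[OF that])
  have norm_id: "NX (\<Sum>j<m. a j *\<^sub>R x j) = lpn (p n) {..<m} a" for m a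
    using norm[of id m a] by simp
  have x1: "NX (x i) = 1" for i
    using norm[of "\<lambda>_. i" 1 "\<lambda>_. 1"] by (simp add: lpn_def inj_on_def)
  have "basic_seq VX NX x"
  proof (rule X.grunblum_basic[where K=1])
    show "range x \<subseteq> VX" using xV by auto
    show "x i \<noteq> 0" for i using x1[of i] by auto
    show "NX (\<Sum>i<m. a i *\<^sub>R x i) \<le> 1 * NX (\<Sum>i<m'. a i *\<^sub>R x i)" if "m \<le> m'" for m m' :: nat and a
      unfolding norm_id using that lpn_mono_set[OF p_pos, of "{..<m'}" "{..<m}" n a] by auto
  qed
  moreover have "weakly_null VX NX x"
    unfolding weakly_null_def
  proof (intro conjI ballI)
    show "range x \<subseteq> VX" using xV by auto
    fix f assume f: "f \<in> dual VX NX"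
    define D where "D = dualnorm VX NX f"
    have D0: "0 \<le> D" using X.dualnorm_ge[OF f, of 0] by (simp add: D_def)
    \<comment> \<open>A Bessel type inequality: \<open>f\<close> is tested on the combination with
      coefficients \<open>f (x i)\<close>, whose norm is at most the \<open>l2\<close> norm of these
      as \<open>2 \<le> p n\<close>. Square summability gives weak nullity.\<close>
    have "(\<Sum>i<m. (f (x i))\<^sup>2) \<le> D\<^sup>2" for m
    proof -
      define B where "B = lpn 2 {..<m} (\<lambda>i. f (x i))"
      have "B\<^sup>2 = f (\<Sum>i<m. f (x i) *\<^sub>R x i)"
        unfolding B_def lpn_2 by (simp add: X.dual_sum[OF f] X.dual_scale[OF f] X.V_scale xV power2_eq_square)
      also have "\<dots> \<le> D * NX (\<Sum>i<m. f (x i) *\<^sub>R x i)"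
        unfolding D_def by (rule order_trans[OF abs_ge_self X.dualnorm_bound[OF f]]) (intro X.V_sum X.V_scale xV)
      also have "\<dots> \<le> D * B"
        unfolding norm_id B_def using D0 p2 by (intro mult_left_mono lpn_antimono_exponent) auto
      finally have "B * B \<le> D * B" by (simp add: power2_eq_square)
      moreover have "0 \<le> B" by (simp add: B_def)
      ultimately have "B \<le> D" using D0 by (cases "B = 0") (auto simp: mult_le_cancel_right)
      then have "B\<^sup>2 \<le> D\<^sup>2" using \<open>0 \<le> B\<close> by (rule power_mono)
      then show ?thesis by (simp add: B_def lpn_2)
    qed
    then have "summable (\<lambda>i. (f (x i))\<^sup>2)" by (intro summableI_nonneg_bounded) auto
    then have "(\<lambda>i. (f (x i))\<^sup>2) \<longlonglongrightarrow> 0" by (rule summable_LIMSEQ_zero)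
    then have "(\<lambda>i. sqrt ((f (x i))\<^sup>2)) \<longlonglongrightarrow> sqrt 0" by (rule tendsto_real_sqrt)
    then show "(\<lambda>i. f (x i)) \<longlonglongrightarrow> 0" by (simp add: tendsto_rabs_zero_iff)
  qed
  moreover have "generates_sm NX x (ell (p n))"
    unfolding generates_sm_def
  proof (intro conjI exI[of _ "\<lambda>_. 0"] allI impI)
    show "c00_seminorm (ell (p n))" by (rule ell_seminorm[OF p_ge1])
    fix m and a :: "nat \<Rightarrow> real" and k :: "nat \<Rightarrow> nat"
    assume h: "(\<forall>i<m. \<bar>a i\<bar> \<le> 1) \<and> (\<forall>i j. i < j \<and> j < m \<longrightarrow> k i < k j) \<and> m \<le> k 0"
    have inj: "inj_on k {..<m}"
    proof (rule inj_onI)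
      fix i j assume "i \<in> {..<m}" "j \<in> {..<m}" "k i = k j"
      moreover have "k i < k j" if "i < j" "j < m" for i j using h that by blast
      ultimately show "i = j" by (metis lessThan_iff linorder_neqE_nat order_less_irrefl)
    qed
    have "ell (p n) (\<lambda>i. if i < m then a i else 0) = lpn (p n) {..<m} (\<lambda>i. if i < m then a i else 0)"
      by (rule ell_eq) simp
    also have "\<dots> = NX (\<Sum>i<m. a i *\<^sub>R x (k i))"
      unfolding norm[OF inj] by (rule lpn_cong) simp
    finally have eq: "ell (p n) (\<lambda>i. if i < m then a i else 0) = NX (\<Sum>i<m. a i *\<^sub>R x (k i))" .
    show "inverse (1 + 0) * ell (p n) (\<lambda>i. if i < m then a i else 0) \<le> NX (\<Sum>i<m. a i *\<^sub>R x (k i))"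
      "NX (\<Sum>i<m. a i *\<^sub>R x (k i)) \<le> (1 + 0) * ell (p n) (\<lambda>i. if i < m then a i else 0)"
      by (simp_all add: eq)
  qed (auto simp: decseq_def)
  ultimately show ?thesis unfolding wsm_def normalized_seq_def using x1 by blast
qed

end

section \<open>Realising countable ordinals\<close>

text \<open>The strict predecessors of \<open>n\<close> carry weights summing to at most 1, so any
  well-order on naturals embeds into \<open>[2, 3]\<close>. An index without strict predecessors
  gets the value 2.\<close>

definition expo :: "nat rel \<Rightarrow> nat \<Rightarrow> real" where
  "expo r n = 2 + (\<Sum>k. if (k, n) \<in> r \<and> k \<noteq> n then (1/2)^Suc k else 0)"

lemma expo_summable: "summable (\<lambda>k. if Q k then (1/2)^Suc k else (0::real))"
  by (rule summable_comparison_test'[of "\<lambda>k. (1/2)^Suc k" 0]) (auto simp: summable_geometric)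

lemma expo_bounds: "2 \<le> expo r n" "expo r n \<le> 3"
proof -
  have half: "(\<lambda>k. (1/2::real)^Suc k) sums 1" by (rule power_half_series)
  show "2 \<le> expo r n" unfolding expo_def using suminf_nonneg[OF expo_summable] by auto
  have "(\<Sum>k. if (k, n) \<in> r \<and> k \<noteq> n then (1/2)^Suc k else 0) \<le> (\<Sum>k. (1/2::real)^Suc k)"
    by (rule suminf_le[OF _ expo_summable sums_summable[OF half]]) auto
  then show "expo r n \<le> 3" unfolding expo_def using sums_unique[OF half] by simp
qed

text \<open>All strict predecessors of \<open>a\<close> are strict predecessors of \<open>b\<close>,
  and \<open>a\<close> itself is one more; its weight is the strict gain.\<close>

lemma expo_strict_mono:
  assumes r: "Well_order r" and ab: "(a, b) \<in> r" "a \<noteq> b"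
  shows "expo r a < expo r b"
proof -
  have tr: "trans r" and an: "antisym r"
    using r by (auto simp: well_order_on_def linear_order_on_def partial_order_on_def preorder_on_def)
  define f where "f n k = (if (k, n) \<in> r \<and> k \<noteq> n then (1/2::real)^Suc k else 0)" for n k
  have sm: "summable (f n)" for n unfolding f_def by (rule expo_summable)
  have sub: "(k, b) \<in> r \<and> k \<noteq> b" if "(k, a) \<in> r" for k
    using that ab tr an by (metis antisymD transD)
  have le: "f a k \<le> f b k" for k using sub[of k] by (auto simp: f_def)
  have "0 < suminf (\<lambda>k. f b k - f a k)"
  proof (rule suminf_pos2[OF summable_diff[OF sm sm]])
    show "0 \<le> f b k - f a k" for k using le[of k] by simp
    show "0 < f b a - f a a" using ab by (simp add: f_def)
  qed
  moreover have "expo r n = 2 + (\<Sum>k. f n k)" for n unfolding expo_def f_def ..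
  ultimately show ?thesis using suminf_diff[OF sm[of b] sm[of a]] by simp
qed

theorem ordinal_realised_by_reflexive_space:
  fixes r :: "nat rel"
  assumes r: "Well_order r" and ne: "Field r \<noteq> {}"
  shows "\<exists>(V::(nat \<Rightarrow>\<^sub>C real) set) N. banach_on V N \<and> reflexive_on V N \<and> iso_reverse V N r"
proof -
  have refl: "(a, a) \<in> r" if "a \<in> Field r" for a
    using r that by (auto simp: well_order_on_def linear_order_on_def partial_order_on_def preorder_on_def refl_on_def)
  have total: "(a, b) \<in> r \<or> (b, a) \<in> r" if "a \<in> Field r" "b \<in> Field r" for a b
    using r that refl by (cases "a = b") (auto simp: well_order_on_def linear_order_on_def total_on_def)
  have wf: "wf (r - Id)" using r by (simp add: well_order_on_def)
  have minimal: "\<exists>n\<in>A. \<forall>k\<in>A. (n, k) \<in> r" if A: "A \<noteq> {}" "A \<subseteq> Field r" for A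
  proof -
    obtain n where n: "n \<in> A" "\<And>k. (k, n) \<in> r - Id \<Longrightarrow> k \<notin> A"
      using wf A(1) unfolding wf_eq_minimal by (metis all_not_in_conv)
    have "(n, k) \<in> r" if "k \<in> A" for k
      using n that A(2) total[of n k] refl[of n] by (cases "k = n") auto
    then show ?thesis using n(1) by blast
  qed
  define p where "p = expo r"
  have p_le: "p a \<le> p b \<longleftrightarrow> (a, b) \<in> r" if "a \<in> Field r" "b \<in> Field r" for a b
  proof
    assume "(a, b) \<in> r"
    then show "p a \<le> p b" using expo_strict_mono[OF r, of a b] by (cases "a = b") (auto simp: p_def)
  next
    assume le: "p a \<le> p b"
    show "(a, b) \<in> r"
    proof (rule ccontr)
      assume "(a, b) \<notin> r"
      then have "(b, a) \<in> r" "b \<noteq> a" using total[OF that] refl[OF that(1)] by auto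
      then show False using expo_strict_mono[OF r, of b a] le by (simp add: p_def)
    qed
  qed
  \<comment> \<open>Covers two situations: the least element of the order and the indices outside
    its field.\<close>
  have p_out: "p n = 2" if "\<And>k. (k, n) \<in> r \<Longrightarrow> k = n" for n
  proof -
    have "(\<lambda>k. if (k, n) \<in> r \<and> k \<noteq> n then (1/2)^Suc k else (0::real)) = (\<lambda>_. 0)" using that by auto
    then show ?thesis by (simp only: p_def expo_def) simp
  qed
  obtain m0 where m0: "m0 \<in> Field r" "\<And>k. k \<in> Field r \<Longrightarrow> (m0, k) \<in> r" using minimal[OF ne] by blast
  have p_m0: "p m0 = 2"
  proof (rule p_out)
    fix k assume k: "(k, m0) \<in> r"
    then have "(m0, k) \<in> r" using m0(2) by (auto simp: Field_def)
    then show "k = m0" using k r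
      by (auto simp: well_order_on_def linear_order_on_def partial_order_on_def antisym_def)
  qed
  have p_off: "p n = 2" if "n \<notin> Field r" for n by (rule p_out) (use that in \<open>auto simp: Field_def\<close>)
  interpret lp_sum p by unfold_locales (simp_all add: p_def expo_bounds)
  \<comment> \<open>A set containing an index outside the field attains the overall minimum 2 there;
    otherwise the well-order supplies the minimum.\<close>
  have least: "\<exists>n\<in>A. \<forall>k\<in>A. p n \<le> p k" if A: "A \<noteq> {}" for A
  proof (cases "A \<subseteq> Field r")
    case True
    then obtain n where "n \<in> A" "\<forall>k\<in>A. (n, k) \<in> r" using minimal[OF A] by blast
    then show ?thesis using True p_le by (meson subsetD)
  next
    case False
    then obtain n where "n \<in> A" "n \<notin> Field r" by blast
    then show ?thesis using p_off[of n] p2 by (intro bexI[of _ n]) auto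
  qed
  define cls where "cls S = {T\<in>wsm VX NX. equiv_sm S T}" for S
  define idx where "idx a = cls (ell (p a))" for a
  have SP: "SPw VX NX = cls ` wsm VX NX" by (simp add: SPw_def cls_def[abs_def])
  have dom: "dominates (ell (p a)) (ell (p b)) \<longleftrightarrow> (a, b) \<in> r" if "a \<in> Field r" "b \<in> Field r" for a b
    unfolding ell_dominates_iff[OF p_ge1 p_ge1] by (rule p_le[OF that])
  have bij: "bij_betw idx (Field r) (SPw VX NX)"
    unfolding bij_betw_def
  proof
    show "inj_on idx (Field r)"
    proof (rule inj_onI)
      fix a b assume ab: "a \<in> Field r" "b \<in> Field r" "idx a = idx b"
      have "equiv_sm (ell (p a)) (ell (p b))"
        using ab(3) unfolding idx_def cls_def class_eq_iff[OF ell_in_wsm ell_in_wsm] .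
      then have "(a, b) \<in> r" "(b, a) \<in> r" using dom ab by (auto simp: equiv_sm_def)
      then show "a = b" using r
        by (auto simp: well_order_on_def linear_order_on_def partial_order_on_def antisym_def)
    qed
    show "idx ` Field r = SPw VX NX"
    proof
      show "idx ` Field r \<subseteq> SPw VX NX" unfolding SP idx_def using ell_in_wsm by blast
      show "SPw VX NX \<subseteq> idx ` Field r"
      proof
        fix C assume "C \<in> SPw VX NX"
        then obtain S where S: "S \<in> wsm VX NX" "C = cls S" unfolding SP by blast
        have "\<exists>n. equiv_sm S (ell (p n))" by (rule wsm_equiv_ell[OF p_m0 _ S(1)]) (rule least)
        then obtain n where n: "equiv_sm S (ell (p n))" by blast
        \<comment> \<open>A model found at an index outside the field has exponent 2 and is assigned
          to the least element \<open>m0\<close>, which has the same exponent.\<close>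
        define a where "a = (if n \<in> Field r then n else m0)"
        have a: "a \<in> Field r" "p a = p n" using m0 p_m0 p_off by (auto simp: a_def)
        have "C = idx a"
          unfolding S(2) idx_def cls_def a(2) class_eq_iff[OF S(1) ell_in_wsm] by (rule n)
        then show "C \<in> idx ` Field r" using a(1) by blast
      qed
    qed
  qed
  have order: "sp_le (idx a) (idx b) \<longleftrightarrow> (b, a) \<in> r" if "a \<in> Field r" "b \<in> Field r" for a b
    unfolding idx_def cls_def sp_le_iff[OF ell_in_wsm ell_in_wsm] by (rule dom[OF that(2,1)])
  \<comment> \<open>The natural map sends an index to a class, whereas \<open>iso_reverse\<close>
    asks for the opposite direction.\<close>
  define h where "h = the_inv_into (Field r) idx"
  have h_bij: "bij_betw h (SPw VX NX) (Field r)" unfolding h_def by (rule bij_betw_the_inv_into[OF bij])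
  have "sp_le c1 c2 \<longleftrightarrow> (h c2, h c1) \<in> r" if c: "c1 \<in> SPw VX NX" "c2 \<in> SPw VX NX" for c1 c2
  proof -
    have c': "c1 \<in> idx ` Field r" "c2 \<in> idx ` Field r"
      using c unfolding bij_betw_imp_surj_on[OF bij] .
    obtain a where a: "c1 = idx a" "a \<in> Field r" using c'(1) by (rule imageE)
    obtain b where b: "c2 = idx b" "b \<in> Field r" using c'(2) by (rule imageE)
    have h_idx: "h (idx a) = a" if "a \<in> Field r" for a
      unfolding h_def by (rule the_inv_into_f_f[OF bij_betw_imp_inj_on[OF bij] that])
    show ?thesis
      unfolding a(1) b(1) h_idx[OF a(2)] h_idx[OF b(2)] by (rule order[OF a(2) b(2)])
  qed
  then have "iso_reverse VX NX r" unfolding iso_reverse_def using h_bij by blast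
  then show ?thesis using banach_VX reflexive_VX by blast
qed

text \<open>Countable ordinals, finite or infinite, appear as well-orders on sets of naturals; a
  nonempty field expresses \<alpha> \<ge> 1.\<close>

theorem theorem3p7:
  shows "(separable_on (UNIV::'a::banach set) norm \<and> infinite_dim_on (UNIV::'a set) \<and>
           countable (SPw (UNIV::'a set) norm) \<and>
           (\<forall>c1\<in>SPw (UNIV::'a set) norm. \<forall>c2\<in>SPw (UNIV::'a set) norm. sp_le c1 c2 \<or> sp_le c2 c1)
         \<longrightarrow> (\<exists>r::nat rel. Well_order r \<and> iso_reverse (UNIV::'a set) norm r))
       \<and> (\<forall>r::nat rel. Well_order r \<and> Field r \<noteq> {} \<longrightarrow>
           (\<exists>(V::(nat \<Rightarrow>\<^sub>C real) set) N. banach_on V N \<and> reflexive_on V N \<and> iso_reverse V N r))"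
proof (intro conjI impI allI; elim conjE)
  assume "countable (SPw (UNIV::'a set) norm)"
    "\<forall>c1\<in>SPw (UNIV::'a set) norm. \<forall>c2\<in>SPw (UNIV::'a set) norm. sp_le c1 c2 \<or> sp_le c2 c1"
  then show "\<exists>r::nat rel. Well_order r \<and> iso_reverse (UNIV::'a set) norm r"
    by (rule countable_chain_reverse_well_ordered)
next
  fix r :: "nat rel" assume "Well_order r" "Field r \<noteq> {}"
  then show "\<exists>(V::(nat \<Rightarrow>\<^sub>C real) set) N. banach_on V N \<and> reflexive_on V N \<and> iso_reverse V N r"
    by (rule ordinal_realised_by_reflexive_space)
qed

end
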